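(* Let $B$ be a skew left brace and let $G=(B,\star)\rtimes(B,\cdot)$ act on $B$ via $\Theta$. Let $\mathcal{O}$ be the set of orbits of this action, and for each $i\in\mathcal{O}$ fix an element $a_i\in i$; let $\operatorname{St}(a_i)\leq G$ be its stabilizer. Let $I$ be a non-empty subset of $\mathcal{O}$ such that $Y=\bigcup_{i\in I} i$ generates the group $(B,\star)$. For each $i\in I$, let $J_i$ be a non-empty set and let $\{K_{i,j}\}_{j\in J_i}$ be a family of subgroups of $\operatorname{St}(a_i)$ such that $$\left\{a\in B : (1,a),(a,a)\in\bigcap_{i\in I}\bigcap_{j\in J_i}\operatorname{core}_G(K_{i,j})\right\}=\{1\}.$$ Let $X:=\bigsqcup_{i\in I}\bigsqcup_{j\in J_i}G/K_{i,j}$ be the disjoint union of the sets of left cosets $G/K_{i,j}$. Define $r:X\times X\to X\times X$ by $r(x,y)=(f_x(y),g_y(x))$, where, for $x=(b_1,c_1)K_{i_1,j_1}$ and $y=(b_2,c_2)K_{i_2,j_2}$ in $X$, $$f_x(y):=(1,\Theta_{(b_1,c_1)}(a_{i_1}))\,(b_2,c_2)K_{i_2,j_2}=(1,\,b_1\star\lambda_{c_1}(a_{i_1})\star b_1^\star)\,(b_2,c_2)K_{i_2,j_2}$$ and $$g_y(x):=\left(\Theta_{(1,\Theta_{(b_1,c_1)}(a_{i_1}))}\Theta_{(b_2,c_2)}(a_{i_2}),\ \Theta_{(1,\Theta_{(b_1,c_1)}(a_{i_1}))}\Theta_{(b_2,c_2)}(a_{i_2})\right)^{-1}(b_1,c_1)K_{i_1,j_1}.$$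 Then $(X,r)$ is a non-degenerate solution such that $\mathcal{G}(X,r)\cong B$ as skew left braces. Moreover, any non-degenerate solution $(Z,t)$ with $\mathcal{G}(Z,t)\cong B$ as skew left braces is isomorphic to a solution constructed in this way.
   Context: A skew left brace is a set $B$ with two binary operations $\star,\cdot$ such that $(B,\star)$ and $(B,\cdot)$ are groups and $a\cdot(b\star c)=(a\cdot b)\star a^\star\star(a\cdot c)$ for all $a,b,c\in B$, where $a^\star$ is the inverse of $a$ in $(B,\star)$; $a^{-1}$ denotes the inverse in $(B,\cdot)$. The two identity elements coincide and are denoted $1$. Morphisms of skew left braces preserve both operations. Put $\lambda_a(b)=a^\star\star(a\cdot b)$; then $\lambda:(B,\cdot)\to\operatorname{Aut}(B,\star)$, $a\mapsto\lambda_a$, is a group morphism. The semidirect product $(B,\star)\rtimes(B,\cdot)$ has product $(a,b)(a',b')=(a\star\lambda_b(a'),\,b\cdot b')$, and acts on $B$ by automorphisms of $(B,\star)$ via $\Theta_{(a,b)}(c)=a\star\lambda_b(c)\star a^\star$. For a subgroup $H\leq G$, $\operatorname{core}_G(H)=\bigcap_{g\in G}gHg^{-1}$. A solution (of the Yang-Baxter equation) is a pair $(X,r)$ with $X$ a non-empty set and $r:X\times X\to X\times X$ a bijection such that $r_1 r_2 r_1=r_2 r_1 r_2$ on $X^3$, where $r_1=r\times\operatorname{id}$, $r_2=\operatorname{id}\times r$. Write $r(x,y)=(f_x(y),g_y(x))$. It is non-degenerate if all $f_x,g_x:X\to X$ are bijective. Solutions $(X,r)$ and $(Y,s)$ are isomorphic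 if there is a bijection $F:X\to Y$ with $s(F(x_1),F(x_2))=(F\times F)(r(x_1,x_2))$ for all $x_1,x_2\in X$. The permutation group $\mathcal{G}(X,r)$ of a non-degenerate solution and its brace structure: the structure group is $G(X,r)=\langle X\mid x\cdot y=f_x(y)\cdot g_y(x),\ x,y\in X\rangle$, the derived group is $A(X,r)=\langle X\mid x\star f_x(y)=f_x(y)\star f_{f_x(y)}g_y(x),\ x,y\in X\rangle$, with natural maps $i_G:X\to G(X,r)$ and $i_A:X\to A(X,r)$. It is known that $x\mapsto f_x$ extends to a group morphism $f:G(X,r)\to\operatorname{Sym}_X$, that $x\mapsto g_x$ extends to a group anti-morphism $g:G(X,r)\to\operatorname{Sym}_X$, that there is a unique group morphism $\lambda:G(X,r)\to\operatorname{Aut}(A(X,r))$ with $\lambda_{i_G(x)}(i_A(y))=i_A(f_x(y))$, and that there is a bijection $\varphi:G(X,r)\to A(X,r)$ with $\varphi(i_G(x))=i_A(x)$ and $\varphi(a\cdot b)=\varphi(a)\star\lambda_a(\varphi(b))$. Transporting the operation of $A(X,r)$ along $\varphi$ gives an operation $\star$ on $G(X,r)$, making $(G(X,r),\star,\cdot)$ a skew left brace with $\lambda_a(b)=a^\star\star(a\cdot b)=\varphi^{-1}(\lambda_a(\varphi(b)))$. For $b\in G(X,r)$ and $x\in X$ put $\tilde g_b(x)=g_{\lambda_{i_G(x)}^{-1}(b)}(x)$; then $\tilde g_b\in\operatorname{Sym}_X$. The permutation group is $\mathcal{G}(X,r)=\{(f_a,\tilde g_a^{-1}) : a\in G(X,r)\}\leq\operatorname{Sym}_X\times\operatorname{Sym}_X$.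 The kernel of the group morphism $a\mapsto(f_a,\tilde g_a^{-1})$ is also normal in $(G(X,r),\star)$ and stable under all $\lambda_a$, so $\mathcal{G}(X,r)$ inherits a skew left brace structure as a quotient of $G(X,r)$: its $\cdot$ is composition in $\operatorname{Sym}_X\times\operatorname{Sym}_X$, and $(f_a,\tilde g_a^{-1})\star(f_b,\tilde g_b^{-1})=(f_{a\star b},\tilde g_{a\star b}^{-1})$. *)

theory Defs
  imports "HOL-Algebra.Group_Action" "HOL-Algebra.Generated_Groups" "HOL-Algebra.Left_Coset"
begin

text \<open>A skew left brace is given by its two groups on a common carrier:
  \<open>S\<close> is \<open>(B, \<star>)\<close> and \<open>D\<close> is \<open>(B, \<cdot>)\<close>.\<close>

locale skew_left_brace = star: group S + dot: group D
  for S :: "'b monoid" and D :: "'b monoid" +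
  assumes carrier_eq: "carrier D = carrier S"
    and compat: "\<lbrakk>a \<in> carrier S; b \<in> carrier S; c \<in> carrier S\<rbrakk> \<Longrightarrow>
      a \<otimes>\<^bsub>D\<^esub> (b \<otimes>\<^bsub>S\<^esub> c) = (a \<otimes>\<^bsub>D\<^esub> b) \<otimes>\<^bsub>S\<^esub> inv\<^bsub>S\<^esub> a \<otimes>\<^bsub>S\<^esub> (a \<otimes>\<^bsub>D\<^esub> c)"

definition brace_isomorphic ::
    "'b monoid \<Rightarrow> 'b monoid \<Rightarrow> 'c monoid \<Rightarrow> 'c monoid \<Rightarrow> bool" where
  "brace_isomorphic S D S' D' \<longleftrightarrow> (\<exists>h. h \<in> iso S S' \<and> h \<in> iso D D')"

definition brace_lambda :: "'b monoid \<Rightarrow> 'b monoid \<Rightarrow> 'b \<Rightarrow> 'b \<Rightarrow> 'b" where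
  "brace_lambda S D a = (\<lambda>b\<in>carrier S. inv\<^bsub>S\<^esub> a \<otimes>\<^bsub>S\<^esub> (a \<otimes>\<^bsub>D\<^esub> b))"

definition brace_semidirect :: "'b monoid \<Rightarrow> 'b monoid \<Rightarrow> ('b \<times> 'b) monoid" where
  "brace_semidirect S D =
    \<lparr>carrier = carrier S \<times> carrier D,
     mult = \<lambda>(a, b) (a', b'). (a \<otimes>\<^bsub>S\<^esub> brace_lambda S D b a', b \<otimes>\<^bsub>D\<^esub> b'),
     one = (\<one>\<^bsub>S\<^esub>, \<one>\<^bsub>D\<^esub>)\<rparr>"

definition brace_Theta :: "'b monoid \<Rightarrow> 'b monoid \<Rightarrow> 'b \<times> 'b \<Rightarrow> 'b \<Rightarrow> 'b" where
  "brace_Theta S D =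
    (\<lambda>(a, b). \<lambda>c\<in>carrier S. a \<otimes>\<^bsub>S\<^esub> brace_lambda S D b c \<otimes>\<^bsub>S\<^esub> inv\<^bsub>S\<^esub> a)"

definition brace_orbits :: "'b monoid \<Rightarrow> 'b monoid \<Rightarrow> 'b set set" where
  "brace_orbits S D = orbits (brace_semidirect S D) (carrier S) (brace_Theta S D)"

definition group_core :: "('g, 'm) monoid_scheme \<Rightarrow> 'g set \<Rightarrow> 'g set" where
  "group_core G H = (\<Inter>g\<in>carrier G. (g <#\<^bsub>G\<^esub> H) #>\<^bsub>G\<^esub> inv\<^bsub>G\<^esub> g)"

text \<open>A word is a list of letters \<open>(x, True)\<close>, standing for \<open>x\<close>, and \<open>(x, False)\<close>, standing
  for the formal inverse of \<open>x\<close>. The group presented by generators \<open>X\<close> and relations \<open>R\<close>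
  consists of the classes of words over \<open>X\<close> modulo the least congruence that contains \<open>R\<close>
  and cancels adjacent inverse letters.\<close>

type_synonym 'x word = "('x \<times> bool) list"

definition words_over :: "'x set \<Rightarrow> 'x word set" where
  "words_over X = lists (X \<times> UNIV)"

inductive_set presentation_rel :: "'x set \<Rightarrow> ('x word \<times> 'x word) set \<Rightarrow> ('x word \<times> 'x word) set"
  for X R where
  refl: "w \<in> words_over X \<Longrightarrow> (w, w) \<in> presentation_rel X R"
| sym: "(u, v) \<in> presentation_rel X R \<Longrightarrow> (v, u) \<in> presentation_rel X R"
| trans: "\<lbrakk>(u, v) \<in> presentation_rel X R; (v, w) \<in> presentation_rel X R\<rbrakk>
    \<Longrightarrow> (u, w) \<in> presentation_rel X R"
| cong: "\<lbrakk>(u, u') \<in> presentation_rel X R; (v, v') \<in> presentation_rel X R\<rbrakk>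
    \<Longrightarrow> (u @ v, u' @ v') \<in> presentation_rel X R"
| cancel: "x \<in> X \<Longrightarrow> ([(x, e), (x, \<not> e)], []) \<in> presentation_rel X R"
| relation: "\<lbrakk>(u, v) \<in> R; u \<in> words_over X; v \<in> words_over X\<rbrakk>
    \<Longrightarrow> (u, v) \<in> presentation_rel X R"

definition presented_group :: "'x set \<Rightarrow> ('x word \<times> 'x word) set \<Rightarrow> 'x word set monoid" where
  "presented_group X R =
    \<lparr>carrier = words_over X // presentation_rel X R,
     mult = \<lambda>A B. \<Union>u\<in>A. \<Union>v\<in>B. presentation_rel X R `` {u @ v},
     one = presentation_rel X R `` {[]}\<rparr>"

definition presented_gen :: "'x set \<Rightarrow> ('x word \<times> 'x word) set \<Rightarrow> 'x \<Rightarrow> 'x word set" where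
  "presented_gen X R x = presentation_rel X R `` {[(x, True)]}"

definition sol_f :: "('x \<times> 'x \<Rightarrow> 'x \<times> 'x) \<Rightarrow> 'x \<Rightarrow> 'x \<Rightarrow> 'x" where
  "sol_f r x y = fst (r (x, y))"

text \<open>The index comes first: \<open>r (x, y) = (sol_f r x y, sol_g r y x)\<close>.\<close>

definition sol_g :: "('x \<times> 'x \<Rightarrow> 'x \<times> 'x) \<Rightarrow> 'x \<Rightarrow> 'x \<Rightarrow> 'x" where
  "sol_g r y x = snd (r (x, y))"

definition yb_left :: "('x \<times> 'x \<Rightarrow> 'x \<times> 'x) \<Rightarrow> 'x \<times> 'x \<times> 'x \<Rightarrow> 'x \<times> 'x \<times> 'x" where
  "yb_left r = (\<lambda>(x, y, z). (fst (r (x, y)), snd (r (x, y)), z))"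

definition yb_right :: "('x \<times> 'x \<Rightarrow> 'x \<times> 'x) \<Rightarrow> 'x \<times> 'x \<times> 'x \<Rightarrow> 'x \<times> 'x \<times> 'x" where
  "yb_right r = (\<lambda>(x, y, z). (x, r (y, z)))"

definition yb_solution :: "'x set \<Rightarrow> ('x \<times> 'x \<Rightarrow> 'x \<times> 'x) \<Rightarrow> bool" where
  "yb_solution X r \<longleftrightarrow>
    X \<noteq> {} \<and> bij_betw r (X \<times> X) (X \<times> X) \<and>
    (\<forall>p \<in> X \<times> X \<times> X.
      yb_left r (yb_right r (yb_left r p)) = yb_right r (yb_left r (yb_right r p)))"

definition nondegenerate_solution :: "'x set \<Rightarrow> ('x \<times> 'x \<Rightarrow> 'x \<times> 'x) \<Rightarrow> bool" where
  "nondegenerate_solution X r \<longleftrightarrow>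
    yb_solution X r \<and> (\<forall>x\<in>X. bij_betw (sol_f r x) X X \<and> bij_betw (sol_g r x) X X)"

definition solution_isomorphic ::
    "'x set \<Rightarrow> ('x \<times> 'x \<Rightarrow> 'x \<times> 'x) \<Rightarrow> 'y set \<Rightarrow> ('y \<times> 'y \<Rightarrow> 'y \<times> 'y) \<Rightarrow> bool" where
  "solution_isomorphic X r Y s \<longleftrightarrow>
    (\<exists>F. bij_betw F X Y \<and>
      (\<forall>x1\<in>X. \<forall>x2\<in>X. s (F x1, F x2) = map_prod F F (r (x1, x2))))"

definition structure_rels :: "'x set \<Rightarrow> ('x \<times> 'x \<Rightarrow> 'x \<times> 'x) \<Rightarrow> ('x word \<times> 'x word) set" where
  "structure_rels X r =
    {([(x, True), (y, True)], [(sol_f r x y, True), (sol_g r y x, True)]) | x y. x \<in> X \<and> y \<in> X}"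

definition derived_rels :: "'x set \<Rightarrow> ('x \<times> 'x \<Rightarrow> 'x \<times> 'x) \<Rightarrow> ('x word \<times> 'x word) set" where
  "derived_rels X r =
    {([(x, True), (sol_f r x y, True)],
      [(sol_f r x y, True), (sol_f r (sol_f r x y) (sol_g r y x), True)]) | x y. x \<in> X \<and> y \<in> X}"

definition structure_group :: "'x set \<Rightarrow> ('x \<times> 'x \<Rightarrow> 'x \<times> 'x) \<Rightarrow> 'x word set monoid" where
  "structure_group X r = presented_group X (structure_rels X r)"

definition derived_group :: "'x set \<Rightarrow> ('x \<times> 'x \<Rightarrow> 'x \<times> 'x) \<Rightarrow> 'x word set monoid" where
  "derived_group X r = presented_group X (derived_rels X r)"

definition gen_G :: "'x set \<Rightarrow> ('x \<times> 'x \<Rightarrow> 'x \<times> 'x) \<Rightarrow> 'x \<Rightarrow> 'x word set" where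
  "gen_G X r = presented_gen X (structure_rels X r)"

definition gen_A :: "'x set \<Rightarrow> ('x \<times> 'x \<Rightarrow> 'x \<times> 'x) \<Rightarrow> 'x \<Rightarrow> 'x word set" where
  "gen_A X r = presented_gen X (derived_rels X r)"

text \<open>The four maps below are the unique ones with the stated properties; extensionality makes
  them unique as HOL functions. \<open>Sym\<^sub>X\<close> is \<open>BijGroup X\<close>.\<close>

definition f_ext :: "'x set \<Rightarrow> ('x \<times> 'x \<Rightarrow> 'x \<times> 'x) \<Rightarrow> 'x word set \<Rightarrow> 'x \<Rightarrow> 'x" where
  "f_ext X r = (THE h.
    h \<in> extensional (carrier (structure_group X r)) \<and>
    h \<in> hom (structure_group X r) (BijGroup X) \<and>
    (\<forall>x\<in>X. h (gen_G X r x) = restrict (sol_f r x) X))"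

definition g_ext :: "'x set \<Rightarrow> ('x \<times> 'x \<Rightarrow> 'x \<times> 'x) \<Rightarrow> 'x word set \<Rightarrow> 'x \<Rightarrow> 'x" where
  "g_ext X r = (THE h.
    h \<in> carrier (structure_group X r) \<rightarrow>\<^sub>E carrier (BijGroup X) \<and>
    (\<forall>a\<in>carrier (structure_group X r). \<forall>b\<in>carrier (structure_group X r).
      h (a \<otimes>\<^bsub>structure_group X r\<^esub> b) = h b \<otimes>\<^bsub>BijGroup X\<^esub> h a) \<and>
    (\<forall>x\<in>X. h (gen_G X r x) = restrict (sol_g r x) X))"

definition lambda_GA ::
    "'x set \<Rightarrow> ('x \<times> 'x \<Rightarrow> 'x \<times> 'x) \<Rightarrow> 'x word set \<Rightarrow> 'x word set \<Rightarrow> 'x word set" where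
  "lambda_GA X r = (THE h.
    h \<in> extensional (carrier (structure_group X r)) \<and>
    h \<in> hom (structure_group X r) (AutoGroup (derived_group X r)) \<and>
    (\<forall>x\<in>X. \<forall>y\<in>X. h (gen_G X r x) (gen_A X r y) = gen_A X r (sol_f r x y)))"

definition phi_GA :: "'x set \<Rightarrow> ('x \<times> 'x \<Rightarrow> 'x \<times> 'x) \<Rightarrow> 'x word set \<Rightarrow> 'x word set" where
  "phi_GA X r = (THE h.
    h \<in> extensional (carrier (structure_group X r)) \<and>
    bij_betw h (carrier (structure_group X r)) (carrier (derived_group X r)) \<and>
    (\<forall>x\<in>X. h (gen_G X r x) = gen_A X r x) \<and>
    (\<forall>a\<in>carrier (structure_group X r). \<forall>b\<in>carrier (structure_group X r).
      h (a \<otimes>\<^bsub>structure_group X r\<^esub> b) =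
        h a \<otimes>\<^bsub>derived_group X r\<^esub> lambda_GA X r a (h b)))"

definition structure_star :: "'x set \<Rightarrow> ('x \<times> 'x \<Rightarrow> 'x \<times> 'x) \<Rightarrow> 'x word set monoid" where
  "structure_star X r =
    \<lparr>carrier = carrier (structure_group X r),
     mult = \<lambda>a b. inv_into (carrier (structure_group X r)) (phi_GA X r)
       (phi_GA X r a \<otimes>\<^bsub>derived_group X r\<^esub> phi_GA X r b),
     one = inv_into (carrier (structure_group X r)) (phi_GA X r) \<one>\<^bsub>derived_group X r\<^esub>\<rparr>"

definition g_tilde :: "'x set \<Rightarrow> ('x \<times> 'x \<Rightarrow> 'x \<times> 'x) \<Rightarrow> 'x word set \<Rightarrow> 'x \<Rightarrow> 'x" where
  "g_tilde X r b = (\<lambda>x\<in>X.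
    g_ext X r
      (inv_into (carrier (structure_group X r))
        (brace_lambda (structure_star X r) (structure_group X r) (gen_G X r x)) b) x)"

definition perm_map ::
    "'x set \<Rightarrow> ('x \<times> 'x \<Rightarrow> 'x \<times> 'x) \<Rightarrow> 'x word set \<Rightarrow> ('x \<Rightarrow> 'x) \<times> ('x \<Rightarrow> 'x)" where
  "perm_map X r a = (f_ext X r a, inv\<^bsub>BijGroup X\<^esub> (g_tilde X r a))"

definition permutation_dot ::
    "'x set \<Rightarrow> ('x \<times> 'x \<Rightarrow> 'x \<times> 'x) \<Rightarrow> (('x \<Rightarrow> 'x) \<times> ('x \<Rightarrow> 'x)) monoid" where
  "permutation_dot X r =
    (BijGroup X \<times>\<times> BijGroup X)\<lparr>carrier := perm_map X r ` carrier (structure_group X r)\<rparr>"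

text \<open>The set under \<open>the_elem\<close> is a singleton because the operation \<open>\<star>\<close> of the structure group
  passes to the quotient by the kernel of \<open>perm_map\<close>.\<close>

definition permutation_star ::
    "'x set \<Rightarrow> ('x \<times> 'x \<Rightarrow> 'x \<times> 'x) \<Rightarrow> (('x \<Rightarrow> 'x) \<times> ('x \<Rightarrow> 'x)) monoid" where
  "permutation_star X r =
    \<lparr>carrier = perm_map X r ` carrier (structure_group X r),
     mult = \<lambda>p q. the_elem
       {perm_map X r (a \<otimes>\<^bsub>structure_star X r\<^esub> b) | a b.
          a \<in> carrier (structure_group X r) \<and> b \<in> carrier (structure_group X r) \<and>
          perm_map X r a = p \<and> perm_map X r b = q},
     one = perm_map X r \<one>\<^bsub>structure_star X r\<^esub>\<rparr>"

definition construction_data ::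
    "'b monoid \<Rightarrow> 'b monoid \<Rightarrow> ('b set \<Rightarrow> 'b) \<Rightarrow>
     'b set set \<Rightarrow> ('b set \<Rightarrow> 'j set) \<Rightarrow> ('b set \<Rightarrow> 'j \<Rightarrow> ('b \<times> 'b) set) \<Rightarrow> bool" where
  "construction_data S D a I J K \<longleftrightarrow>
    I \<noteq> {} \<and> I \<subseteq> brace_orbits S D \<and>
    generate S (\<Union>I) = carrier S \<and>
    (\<forall>i\<in>I. J i \<noteq> {}) \<and>
    (\<forall>i\<in>I. \<forall>j\<in>J i.
      subgroup (K i j) (brace_semidirect S D) \<and>
      K i j \<subseteq> stabilizer (brace_semidirect S D) (brace_Theta S D) (a i)) \<and>
    (let N = (\<Inter>i\<in>I. \<Inter>j\<in>J i. group_core (brace_semidirect S D) (K i j))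
     in {b \<in> carrier S. (\<one>\<^bsub>S\<^esub>, b) \<in> N \<and> (b, b) \<in> N} = {\<one>\<^bsub>S\<^esub>})"

text \<open>The disjoint union of the coset spaces: the left coset \<open>C\<close> of \<open>K i j\<close> is tagged by its indices.\<close>

definition coset_space ::
    "'b monoid \<Rightarrow> 'b monoid \<Rightarrow>
     'b set set \<Rightarrow> ('b set \<Rightarrow> 'j set) \<Rightarrow> ('b set \<Rightarrow> 'j \<Rightarrow> ('b \<times> 'b) set) \<Rightarrow>
     ('b set \<times> 'j \<times> ('b \<times> 'b) set) set" where
  "coset_space S D I J K =
    (SIGMA i:I. SIGMA j:J i. lcosets\<^bsub>brace_semidirect S D\<^esub> (K i j))"

text \<open>\<open>coset_point\<close> maps the coset of \<open>(b, c)\<close> to \<open>\<Theta>\<close> of \<open>(b, c)\<close> applied to \<open>a i\<close>; this does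
  not depend on \<open>(b, c)\<close> because \<open>K i j\<close> stabilizes \<open>a i\<close>.\<close>

definition coset_point ::
    "'b monoid \<Rightarrow> 'b monoid \<Rightarrow> ('b set \<Rightarrow> 'b) \<Rightarrow> 'b set \<times> 'j \<times> ('b \<times> 'b) set \<Rightarrow> 'b" where
  "coset_point S D a = (\<lambda>(i, j, C). the_elem ((\<lambda>g. brace_Theta S D g (a i)) ` C))"

definition coset_act ::
    "'b monoid \<Rightarrow> 'b monoid \<Rightarrow> 'b \<times> 'b \<Rightarrow>
     'b set \<times> 'j \<times> ('b \<times> 'b) set \<Rightarrow> 'b set \<times> 'j \<times> ('b \<times> 'b) set" where
  "coset_act S D g = (\<lambda>(i, j, C). (i, j, g <#\<^bsub>brace_semidirect S D\<^esub> C))"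

definition coset_solution ::
    "'b monoid \<Rightarrow> 'b monoid \<Rightarrow> ('b set \<Rightarrow> 'b) \<Rightarrow>
     ('b set \<times> 'j \<times> ('b \<times> 'b) set) \<times> ('b set \<times> 'j \<times> ('b \<times> 'b) set) \<Rightarrow>
     ('b set \<times> 'j \<times> ('b \<times> 'b) set) \<times> ('b set \<times> 'j \<times> ('b \<times> 'b) set)" where
  "coset_solution S D a = (\<lambda>(x, y).
    let p = coset_point S D a x;
        u = brace_Theta S D (\<one>\<^bsub>S\<^esub>, p) (coset_point S D a y)
    in (coset_act S D (\<one>\<^bsub>S\<^esub>, p) y,
        coset_act S D (inv\<^bsub>brace_semidirect S D\<^esub> (u, u)) x))"

end

theory Submission
  imports Defs
begin

text \<open>
  Let the semidirect product \<open>G\<close> of the two groups of a brace \<open>B\<close> act on a set \<open>X\<close>, and let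
  \<open>p : X \<rightarrow> B\<close> be equivariant for \<open>\<Theta>\<close>. Then
  \<open>r (x, y) = (u, (p u, p u)\<inverse> x)\<close> with \<open>u = (1, p x) y\<close> is a non-degenerate solution. The braid
  relation rests on two facts: the product \<open>p x \<cdot> p y\<close> is unchanged by \<open>r\<close>, and in \<open>G\<close> one
  has \<open>(1, a)(b, b) = (c, c)(1, d)\<close> for \<open>c = \<lambda>\<^sub>a b\<close> and \<open>c \<cdot> d = a \<cdot> b\<close>. The solutions of the
  theorem are of this kind: \<open>X\<close> is a disjoint union of coset spaces and \<open>p\<close> sends the coset of \<open>g\<close>
  to \<open>\<Theta>\<^sub>g a\<^sub>i\<close>. The locale \<open>brace_set\<close> collects the data \<open>(B, X, p, r)\<close>, and
  \<open>induced_nondegenerate\<close> is the resulting statement.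

  Every non-degenerate solution arises in this way from its own structure brace
  (\<open>structure_brace_set\<close>). For this one needs the brace structure itself. The derived group \<open>A\<close> is the
  group of a rack \<open>s\<close> on \<open>X\<close> on which the maps \<open>f\<^sub>x\<close> act by automorphisms, so the structure group acts
  on \<open>A\<close>, and \<open>x \<mapsto> x\<close> extends to a cocycle from the structure group to \<open>A\<close>. An inverse of the
  cocycle is obtained from the right action of \<open>A\<close> on the structure group that \<open>\<star>\<close>-multiplication
  has to be; the generators act by permutations because the diagonal map
  \<open>y \<mapsto> f\<^sub>y\<inverse> y\<close> is a bijection of \<open>X\<close>.

  Among all braces that induce a given solution the structure brace is initial: there is a brace
  morphism \<open>\<pi>\<close> from it to \<open>B\<close> with \<open>\<pi> x = p x\<close>, and \<open>perm_map\<close> sends \<open>a\<close> to the pair of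
  the actions of \<open>(1, \<pi> a)\<close> and \<open>(\<pi> a, \<pi> a)\<close> on \<open>X\<close> (\<open>structure_brace_hom\<close>). So the
  permutation brace is \<open>B\<close> itself as soon as \<open>p X\<close> generates \<open>B\<close> and only \<open>b = 1\<close> has the property
  that \<open>(1, b)\<close> and \<open>(b, b)\<close> fix \<open>X\<close> pointwise. For coset spaces the kernel of the action is the
  intersection of the cores, and these two conditions are the hypotheses on \<open>I\<close> and
  the \<open>K\<^sub>i\<^sub>j\<close>.

  Conversely, the action of the structure brace on a solution \<open>Z\<close> factors through the permutation brace
  (\<open>permutation_brace_set\<close>), and so it can be transported to any brace \<open>B\<close> isomorphic to it. Each orbit
  of \<open>G\<close> on \<open>Z\<close> contains a point \<open>j\<close> with \<open>p j = a\<^sub>i\<close> for some \<open>i\<close>; taking one such point from each orbit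
  as index set, and for \<open>K\<^sub>i\<^sub>j\<close> the stabilizer of \<open>j\<close>, identifies \<open>Z\<close> with a disjoint union of coset
  spaces (\<open>induced_solution_is_coset_solution\<close>).
\<close>

section \<open>Groups given by generators and relations\<close>

lemma presentation_rel_words:
  "(u, v) \<in> presentation_rel X R \<Longrightarrow> u \<in> words_over X \<and> v \<in> words_over X"
  by (induction rule: presentation_rel.induct) (auto simp: words_over_def)

lemma equiv_presentation_rel: "equiv (words_over X) (presentation_rel X R)"
proof (rule equivI)
  show "presentation_rel X R \<subseteq> words_over X \<times> words_over X"
    using presentation_rel_words by fastforce
  show "refl_on (words_over X) (presentation_rel X R)"
    by (rule refl_onI) (auto intro: presentation_rel.refl)
  show "sym (presentation_rel X R)" by (rule symI) (rule presentation_rel.sym)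
  show "trans (presentation_rel X R)" by (rule transI) (rule presentation_rel.trans)
qed

abbreviation word_class :: "'x set \<Rightarrow> ('x word \<times> 'x word) set \<Rightarrow> 'x word \<Rightarrow> 'x word set" where
  "word_class X R w \<equiv> presentation_rel X R `` {w}"

lemma word_class_eq_iff:
  "\<lbrakk>u \<in> words_over X; v \<in> words_over X\<rbrakk>
    \<Longrightarrow> word_class X R u = word_class X R v \<longleftrightarrow> (u, v) \<in> presentation_rel X R"
  using eq_equiv_class_iff[OF equiv_presentation_rel] by metis

lemma presented_carrier: "carrier (presented_group X R) = word_class X R ` words_over X"
  by (auto simp: presented_group_def quotient_def)

lemma presented_one: "\<one>\<^bsub>presented_group X R\<^esub> = word_class X R []"
  by (simp add: presented_group_def)

lemma presented_mult:
  assumes "u \<in> words_over X" "v \<in> words_over X"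
  shows "word_class X R u \<otimes>\<^bsub>presented_group X R\<^esub> word_class X R v = word_class X R (u @ v)"
proof -
  have "word_class X R (u' @ v') = word_class X R (u @ v)"
    if "u' \<in> word_class X R u" "v' \<in> word_class X R v" for u' v'
    using that presentation_rel.cong[of u u' X R v v']
    by (intro equiv_class_eq[OF equiv_presentation_rel]) (auto intro: presentation_rel.sym)
  moreover have "u \<in> word_class X R u" "v \<in> word_class X R v"
    using assms by (auto intro: presentation_rel.refl)
  ultimately have "(\<Union>u'\<in>word_class X R u. \<Union>v'\<in>word_class X R v. word_class X R (u' @ v'))
      = word_class X R (u @ v)"
    by blast
  then show ?thesis by (simp add: presented_group_def)
qed

lemma presented_relation:
  assumes "(u, v) \<in> R" "u \<in> words_over X" "v \<in> words_over X"
  shows "word_class X R u = word_class X R v"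
  using presentation_rel.relation[of u v R X] assms by (simp add: word_class_eq_iff)

definition word_inv :: "'x word \<Rightarrow> 'x word" where
  "word_inv w = rev (map (\<lambda>(x, e). (x, \<not> e)) w)"

lemma word_inv_words: "w \<in> words_over X \<Longrightarrow> word_inv w \<in> words_over X"
  by (auto simp: words_over_def word_inv_def)

lemma word_inv_word_inv: "word_inv (word_inv w) = w"
  by (induction w) (auto simp: word_inv_def)

lemma word_inv_cancel:
  "w \<in> words_over X \<Longrightarrow> (w @ word_inv w, []) \<in> presentation_rel X R"
proof (induction w)
  case Nil
  then show ?case by (simp add: word_inv_def presentation_rel.refl)
next
  case (Cons l w)
  obtain x e where l: "l = (x, e)" by force
  have w: "w \<in> words_over X" and x: "x \<in> X" using Cons.prems by (auto simp: l words_over_def)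
  have r: "([(x, d)], [(x, d)]) \<in> presentation_rel X R" for d
    using x by (auto intro!: presentation_rel.refl simp: words_over_def)
  have "([(x, e)] @ (w @ word_inv w) @ [(x, \<not> e)], [(x, e)] @ [] @ [(x, \<not> e)])
          \<in> presentation_rel X R"
    by (intro presentation_rel.cong r Cons.IH[OF w])
  then have "([(x, e)] @ (w @ word_inv w) @ [(x, \<not> e)], []) \<in> presentation_rel X R"
    using presentation_rel.cancel[OF x, of e R] by (auto intro: presentation_rel.trans)
  then show ?case by (simp add: l word_inv_def)
qed

lemma words_over_append:
  "u @ v \<in> words_over X \<longleftrightarrow> u \<in> words_over X \<and> v \<in> words_over X"
  by (auto simp: words_over_def)

lemma Nil_words_over [simp]: "[] \<in> words_over X"
  by (simp add: words_over_def)

lemma letter_words_over [simp]: "[(x, e)] \<in> words_over X \<longleftrightarrow> x \<in> X"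
  by (simp add: words_over_def)

lemma presented_group_group: "group (presented_group X R)"
proof (rule groupI)
  fix a b c
  assume "a \<in> carrier (presented_group X R)" "b \<in> carrier (presented_group X R)"
    "c \<in> carrier (presented_group X R)"
  then obtain u v w where w: "u \<in> words_over X" "v \<in> words_over X" "w \<in> words_over X"
    and e: "a = word_class X R u" "b = word_class X R v" "c = word_class X R w"
    by (auto simp: presented_carrier)
  show "a \<otimes>\<^bsub>presented_group X R\<^esub> b \<in> carrier (presented_group X R)"
    using w by (simp add: e presented_mult) (simp add: presented_carrier words_over_append)
  show "a \<otimes>\<^bsub>presented_group X R\<^esub> b \<otimes>\<^bsub>presented_group X R\<^esub> c =
        a \<otimes>\<^bsub>presented_group X R\<^esub> (b \<otimes>\<^bsub>presented_group X R\<^esub> c)"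
    using w by (simp add: e presented_mult words_over_append)
  show "\<one>\<^bsub>presented_group X R\<^esub> \<otimes>\<^bsub>presented_group X R\<^esub> a = a"
    using w presented_mult[of "[]" X u R] by (simp add: e presented_one)
  have "word_class X R (word_inv u) \<otimes>\<^bsub>presented_group X R\<^esub> a = word_class X R (word_inv u @ u)"
    using w by (simp add: e presented_mult word_inv_words)
  also have "\<dots> = word_class X R []"
    using word_inv_cancel[OF word_inv_words[OF w(1)], of R] w
    by (subst word_class_eq_iff) (auto simp: word_inv_word_inv words_over_append word_inv_words)
  finally show "\<exists>y\<in>carrier (presented_group X R). y \<otimes>\<^bsub>presented_group X R\<^esub> a = \<one>\<^bsub>presented_group X R\<^esub>"
    using w by (auto simp: presented_one presented_carrier intro!: bexI word_inv_words)
qed (simp add: presented_carrier presented_one)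

lemma presented_gen_closed: "x \<in> X \<Longrightarrow> presented_gen X R x \<in> carrier (presented_group X R)"
  by (simp add: presented_gen_def presented_carrier)

lemma inv_presented_gen:
  assumes "x \<in> X"
  shows "inv\<^bsub>presented_group X R\<^esub> (presented_gen X R x) = word_class X R [(x, False)]"
proof (rule group.inv_equality[OF presented_group_group])
  have "([(x, False), (x, True)], []) \<in> presentation_rel X R"
    using presentation_rel.cancel[OF assms, of False R] by simp
  then have "word_class X R [(x, False), (x, True)] = word_class X R []"
    using assms by (subst word_class_eq_iff) (auto simp: words_over_def)
  then show "word_class X R [(x, False)] \<otimes>\<^bsub>presented_group X R\<^esub> presented_gen X R x
      = \<one>\<^bsub>presented_group X R\<^esub>"
    using assms by (simp add: presented_gen_def presented_mult presented_one)
qed (use assms in \<open>simp_all add: presented_gen_def presented_carrier\<close>)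

text \<open>A property whose instances form a subgroup need only be checked on generators. This rule serves
  for the uniqueness of homomorphisms and also for cocycle identities, which no homomorphism expresses.\<close>

lemma presented_induct [consumes 1, case_names one gen mult inv]:
  assumes "a \<in> carrier (presented_group X R)"
    and one: "P \<one>\<^bsub>presented_group X R\<^esub>"
    and gen: "\<And>x. x \<in> X \<Longrightarrow> P (presented_gen X R x)"
    and mult: "\<And>a b. \<lbrakk>a \<in> carrier (presented_group X R); b \<in> carrier (presented_group X R); P a; P b\<rbrakk>
      \<Longrightarrow> P (a \<otimes>\<^bsub>presented_group X R\<^esub> b)"
    and inv: "\<And>a. \<lbrakk>a \<in> carrier (presented_group X R); P a\<rbrakk>
      \<Longrightarrow> P (inv\<^bsub>presented_group X R\<^esub> a)"
  shows "P a"
proof -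
  obtain w where w: "w \<in> words_over X" and a: "a = word_class X R w"
    using assms(1) by (auto simp: presented_carrier)
  have "P (word_class X R w)" using w
  proof (induction w rule: rev_induct)
    case Nil
    then show ?case using one by (simp add: presented_one)
  next
    case (snoc l w)
    obtain x e where l: "l = (x, e)" by force
    have w: "w \<in> words_over X" and x: "x \<in> X" using snoc.prems
      by (auto simp: l words_over_append)
    have "word_class X R (w @ [(x, e)]) =
        word_class X R w \<otimes>\<^bsub>presented_group X R\<^esub> word_class X R [(x, e)]"
      using w x by (simp add: presented_mult)
    moreover have "P (word_class X R [(x, e)])"
      using gen[OF x] inv[OF presented_gen_closed[OF x] gen[OF x]]
      by (cases e) (simp_all add: inv_presented_gen[OF x], simp add: presented_gen_def)
    ultimately show ?case
      using mult[OF _ _ snoc.IH[OF w], of "word_class X R [(x, e)]"] w x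
      by (simp add: l presented_carrier)
  qed
  then show ?thesis by (simp add: a)
qed

fun word_eval :: "('h, 'm) monoid_scheme \<Rightarrow> ('x \<Rightarrow> 'h) \<Rightarrow> 'x word \<Rightarrow> 'h" where
  "word_eval H p [] = \<one>\<^bsub>H\<^esub>"
| "word_eval H p ((x, e) # w) = (if e then p x else inv\<^bsub>H\<^esub> (p x)) \<otimes>\<^bsub>H\<^esub> word_eval H p w"

lemma word_eval_two:
  assumes "group H" "p x \<in> carrier H" "p y \<in> carrier H"
  shows "word_eval H p [(x, True), (y, True)] = p x \<otimes>\<^bsub>H\<^esub> p y"
proof -
  interpret group H by fact
  show ?thesis using assms by simp
qed

context
  fixes H :: "('h, 'm) monoid_scheme" and X :: "'x set" and p :: "'x \<Rightarrow> 'h"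
  assumes H: "group H" and p: "\<And>x. x \<in> X \<Longrightarrow> p x \<in> carrier H"
begin

interpretation H: group H by (rule H)

lemma word_eval_closed: "w \<in> words_over X \<Longrightarrow> word_eval H p w \<in> carrier H"
  by (induction w) (auto simp: words_over_def p)

lemma word_eval_append:
  "\<lbrakk>u \<in> words_over X; v \<in> words_over X\<rbrakk>
    \<Longrightarrow> word_eval H p (u @ v) = word_eval H p u \<otimes>\<^bsub>H\<^esub> word_eval H p v"
proof (induction u)
  case (Cons l u)
  obtain x e where l: "l = (x, e)" by force
  have "x \<in> X" "u \<in> words_over X" using Cons.prems by (auto simp: l words_over_def)
  then show ?case using Cons.IH Cons.prems(2)
    by (simp add: l p word_eval_closed H.m_assoc)
qed (simp add: word_eval_closed)

lemma word_eval_respects: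
  assumes rel: "\<And>u v. \<lbrakk>(u, v) \<in> R; u \<in> words_over X; v \<in> words_over X\<rbrakk>
      \<Longrightarrow> word_eval H p u = word_eval H p v"
  shows "(u, v) \<in> presentation_rel X R \<Longrightarrow> word_eval H p u = word_eval H p v"
proof (induction rule: presentation_rel.induct)
  case (cong u u' v v')
  then show ?case using presentation_rel_words by (metis word_eval_append)
next
  case (cancel x e)
  then show ?case by (cases e) (simp_all add: p)
qed (auto intro: rel)

text \<open>The universal property of a presentation. An extensional extension is asked for, because the
  maps to be identified later are characterized as extensional functions.\<close>

lemma presented_lift:
  assumes rel: "\<And>u v. \<lbrakk>(u, v) \<in> R; u \<in> words_over X; v \<in> words_over X\<rbrakk>
      \<Longrightarrow> word_eval H p u = word_eval H p v"
  shows "\<exists>h. h \<in> extensional (carrier (presented_group X R)) \<and>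
    h \<in> hom (presented_group X R) H \<and> (\<forall>x\<in>X. h (presented_gen X R x) = p x)"
proof -
  define h where "h = (\<lambda>A\<in>carrier (presented_group X R). word_eval H p (SOME w. w \<in> A))"
  have h: "h (word_class X R w) = word_eval H p w" if "w \<in> words_over X" for w
  proof -
    have "w \<in> word_class X R w" using that by (auto intro: presentation_rel.refl)
    then have "(SOME v. v \<in> word_class X R w) \<in> word_class X R w" by (rule someI)
    then have "(w, SOME v. v \<in> word_class X R w) \<in> presentation_rel X R" by blast
    then have "word_eval H p w = word_eval H p (SOME v. v \<in> word_class X R w)"
      by (rule word_eval_respects[where R = R, rotated]) (rule rel)
    moreover have "word_class X R w \<in> carrier (presented_group X R)"
      using that by (simp add: presented_carrier)
    ultimately show ?thesis by (simp add: h_def)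
  qed
  show ?thesis
  proof (intro exI[of _ h] conjI ballI)
    show "h \<in> extensional (carrier (presented_group X R))" by (simp add: h_def)
    show "h \<in> hom (presented_group X R) H"
      by (auto simp: hom_def presented_carrier h presented_mult words_over_append word_eval_append
          word_eval_closed simp del: Image_singleton_iff)
    show "h (presented_gen X R x) = p x" if "x \<in> X" for x
      using that by (simp add: presented_gen_def h p)
  qed
qed

end

lemma presented_hom_eqI:
  assumes H: "group H" and h: "h \<in> hom (presented_group X R) H" and k: "k \<in> hom (presented_group X R) H"
    and eq: "\<And>x. x \<in> X \<Longrightarrow> h (presented_gen X R x) = k (presented_gen X R x)"
    and a: "a \<in> carrier (presented_group X R)"
  shows "h a = k a"
proof -
  interpret P: group "presented_group X R" by (rule presented_group_group)
  interpret h: group_hom "presented_group X R" H h by (intro group_hom.intro P.is_group H group_hom_axioms.intro h)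
  interpret k: group_hom "presented_group X R" H k by (intro group_hom.intro P.is_group H group_hom_axioms.intro k)
  show ?thesis using a
    by (induction rule: presented_induct) (simp_all add: presented_gen_closed eq)
qed

text \<open>Anti-homomorphisms, such as right actions, are homomorphisms into the opposite group, so that the
  universal property applies to them.\<close>

definition op_group :: "('h, 'm) monoid_scheme \<Rightarrow> 'h monoid" where
  "op_group H = \<lparr>carrier = carrier H, mult = \<lambda>a b. b \<otimes>\<^bsub>H\<^esub> a, one = \<one>\<^bsub>H\<^esub>\<rparr>"

lemma group_op_group: "group H \<Longrightarrow> group (op_group H)"
proof -
  assume "group H"
  then interpret group H .
  show ?thesis
    by (rule groupI) (auto simp: op_group_def m_assoc intro: r_inv inv_closed)
qed

lemma op_group_carrier [simp]: "carrier (op_group H) = carrier H"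
  by (simp add: op_group_def)

lemma op_group_mult [simp]: "a \<otimes>\<^bsub>op_group H\<^esub> b = b \<otimes>\<^bsub>H\<^esub> a"
  by (simp add: op_group_def)

lemma op_group_one [simp]: "\<one>\<^bsub>op_group H\<^esub> = \<one>\<^bsub>H\<^esub>"
  by (simp add: op_group_def)

text \<open>Intertwining relations pass to inverses: the derived group acts on \<open>X\<close> through the inverses of the
  rack translations.\<close>

lemma (in group) conjugation_inv:
  assumes "P \<otimes> q = q \<otimes> Q" "P \<in> carrier G" "Q \<in> carrier G" "q \<in> carrier G"
  shows "inv P \<otimes> q = q \<otimes> inv Q"
proof -
  have "P \<otimes> (q \<otimes> inv Q) = q \<otimes> Q \<otimes> inv Q" using assms by (simp flip: m_assoc)
  then have "P \<otimes> (q \<otimes> inv Q) = q" using assms(2-4) by (simp add: m_assoc)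
  then have "q \<otimes> inv Q = inv P \<otimes> q" using assms(2-4) by (simp add: inv_solve_left)
  then show ?thesis by simp
qed

section \<open>Groups of permutations\<close>

lemma BijGroup_carrier [simp]: "carrier (BijGroup X) = Bij X"
  by (simp add: BijGroup_def)

lemma Bij_closed [simp]: "\<lbrakk>h \<in> Bij X; x \<in> X\<rbrakk> \<Longrightarrow> h x \<in> X"
  using Bij_imp_funcset by blast

lemma BijGroup_mult_apply [simp]:
  "\<lbrakk>h \<in> Bij X; k \<in> Bij X; x \<in> X\<rbrakk> \<Longrightarrow> (h \<otimes>\<^bsub>BijGroup X\<^esub> k) x = h (k x)"
  by (simp add: BijGroup_def compose_def)

lemma BijGroup_one_apply [simp]: "x \<in> X \<Longrightarrow> \<one>\<^bsub>BijGroup X\<^esub> x = x"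
  by (simp add: BijGroup_def)

lemma BijGroup_inv_apply [simp]:
  assumes "h \<in> Bij X" "x \<in> X"
  shows "(inv\<^bsub>BijGroup X\<^esub> h) (h x) = x" "h ((inv\<^bsub>BijGroup X\<^esub> h) x) = x"
proof -
  interpret group "BijGroup X" by (rule group_BijGroup)
  have i: "inv\<^bsub>BijGroup X\<^esub> h \<in> Bij X" using inv_closed assms(1) by simp
  show "(inv\<^bsub>BijGroup X\<^esub> h) (h x) = x" "h ((inv\<^bsub>BijGroup X\<^esub> h) x) = x"
    using assms i l_inv[of h] r_inv[of h] by (simp_all flip: BijGroup_mult_apply)
qed

lemma BijGroup_closed [simp]:
  "\<lbrakk>h \<in> Bij X; k \<in> Bij X\<rbrakk> \<Longrightarrow> h \<otimes>\<^bsub>BijGroup X\<^esub> k \<in> Bij X"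
  "h \<in> Bij X \<Longrightarrow> inv\<^bsub>BijGroup X\<^esub> h \<in> Bij X"
  using monoid.m_closed[OF group.is_monoid[OF group_BijGroup[of X]]]
    group.inv_closed[OF group_BijGroup[of X]] by auto

lemma BijGroup_one_Bij [simp]: "\<one>\<^bsub>BijGroup X\<^esub> \<in> Bij X"
  using monoid.one_closed[OF group.is_monoid[OF group_BijGroup[of X]]] by simp

lemma Bij_eqI: "\<lbrakk>h \<in> Bij X; k \<in> Bij X; \<And>x. x \<in> X \<Longrightarrow> h x = k x\<rbrakk> \<Longrightarrow> h = k"
  by (auto intro: extensionalityI simp: Bij_def)

lemma BijI:
  assumes "h \<in> extensional X" "bij_betw h X X"
  shows "h \<in> Bij X"
  using assms by (simp add: Bij_def)

section \<open>Skew left braces and their semidirect product\<close>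

context skew_left_brace
begin

abbreviation star_mult (infixl \<open>\<star>\<close> 70) where "x \<star> y \<equiv> x \<otimes>\<^bsub>S\<^esub> y"
abbreviation dot_mult (infixl \<open>\<sqdot>\<close> 70) where "x \<sqdot> y \<equiv> x \<otimes>\<^bsub>D\<^esub> y"
abbreviation C where "C \<equiv> carrier S"
abbreviation lam where "lam \<equiv> brace_lambda S D"
abbreviation SD where "SD \<equiv> brace_semidirect S D"
abbreviation Theta where "Theta \<equiv> brace_Theta S D"

lemma dot_closed [simp]: "\<lbrakk>a \<in> C; b \<in> C\<rbrakk> \<Longrightarrow> a \<sqdot> b \<in> C"
  using dot.m_closed by (simp add: carrier_eq)

lemma dot_inv_closed [simp]: "a \<in> C \<Longrightarrow> inv\<^bsub>D\<^esub> a \<in> C"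
  using dot.inv_closed by (simp add: carrier_eq)

lemma ones_eq [simp]: "\<one>\<^bsub>D\<^esub> = \<one>\<^bsub>S\<^esub>"
proof -
  have c: "\<one>\<^bsub>D\<^esub> \<in> C" using dot.one_closed by (simp add: carrier_eq)
  have "inv\<^bsub>S\<^esub> \<one>\<^bsub>D\<^esub> = \<one>\<^bsub>S\<^esub>"
    using compat[of "\<one>\<^bsub>D\<^esub>" "\<one>\<^bsub>S\<^esub>" "\<one>\<^bsub>S\<^esub>"] c by (simp add: carrier_eq)
  then show ?thesis using c by (metis star.inv_inv star.inv_one)
qed

lemma dot_one [simp]: "a \<in> C \<Longrightarrow> \<one>\<^bsub>S\<^esub> \<sqdot> a = a" "a \<in> C \<Longrightarrow> a \<sqdot> \<one>\<^bsub>S\<^esub> = a"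
  using dot.l_one dot.r_one by (simp_all add: carrier_eq)

lemma dot_assoc: "\<lbrakk>a \<in> C; b \<in> C; c \<in> C\<rbrakk> \<Longrightarrow> a \<sqdot> b \<sqdot> c = a \<sqdot> (b \<sqdot> c)"
  using dot.m_assoc by (simp add: carrier_eq)

lemma dot_inv [simp]:
  "a \<in> C \<Longrightarrow> inv\<^bsub>D\<^esub> a \<sqdot> a = \<one>\<^bsub>S\<^esub>" "a \<in> C \<Longrightarrow> a \<sqdot> inv\<^bsub>D\<^esub> a = \<one>\<^bsub>S\<^esub>"
  using dot.l_inv dot.r_inv by (simp_all add: carrier_eq)

lemma dot_inv_cancel [simp]:
  assumes "a \<in> C" "b \<in> C"
  shows "inv\<^bsub>D\<^esub> a \<sqdot> (a \<sqdot> b) = b" "a \<sqdot> (inv\<^bsub>D\<^esub> a \<sqdot> b) = b"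
  using assms by (simp_all flip: dot_assoc)

lemma star_inv_cancel [simp]:
  assumes "a \<in> C" "b \<in> C"
  shows "inv\<^bsub>S\<^esub> a \<star> (a \<star> b) = b" "a \<star> (inv\<^bsub>S\<^esub> a \<star> b) = b"
  using assms by (simp_all flip: star.m_assoc)

lemma lam_eq: "b \<in> C \<Longrightarrow> lam a b = inv\<^bsub>S\<^esub> a \<star> (a \<sqdot> b)"
  by (simp add: brace_lambda_def)

lemma lam_closed [simp]: "\<lbrakk>a \<in> C; b \<in> C\<rbrakk> \<Longrightarrow> lam a b \<in> C"
  by (simp add: lam_eq)

lemma dot_lam: "\<lbrakk>a \<in> C; b \<in> C\<rbrakk> \<Longrightarrow> a \<sqdot> b = a \<star> lam a b"
  by (simp add: lam_eq)

lemma lam_star: "\<lbrakk>a \<in> C; b \<in> C; c \<in> C\<rbrakk> \<Longrightarrow> lam a (b \<star> c) = lam a b \<star> lam a c"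
  by (simp add: lam_eq compat star.m_assoc)

lemma lam_one [simp]: "b \<in> C \<Longrightarrow> lam \<one>\<^bsub>S\<^esub> b = b"
  by (simp add: lam_eq)

lemma lam_one_right [simp]: "a \<in> C \<Longrightarrow> lam a \<one>\<^bsub>S\<^esub> = \<one>\<^bsub>S\<^esub>"
  by (simp add: lam_eq)

lemma lam_dot:
  assumes "a \<in> C" "b \<in> C" "c \<in> C"
  shows "lam (a \<sqdot> b) c = lam a (lam b c)"
proof -
  have "(a \<sqdot> b) \<star> lam (a \<sqdot> b) c = a \<sqdot> (b \<star> lam b c)"
    using assms by (simp add: dot_assoc flip: dot_lam)
  also have "\<dots> = (a \<sqdot> b) \<star> lam a (lam b c)"
    using assms by (simp add: dot_lam[of a] lam_star star.m_assoc)
  finally show ?thesis using assms by simp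
qed

lemma lam_inv_cancel [simp]:
  assumes "a \<in> C" "b \<in> C"
  shows "lam (inv\<^bsub>D\<^esub> a) (lam a b) = b" "lam a (lam (inv\<^bsub>D\<^esub> a) b) = b"
  using assms by (simp_all flip: lam_dot)

lemma star_dot: "\<lbrakk>a \<in> C; b \<in> C\<rbrakk> \<Longrightarrow> a \<star> b = a \<sqdot> lam (inv\<^bsub>D\<^esub> a) b"
  by (simp add: dot_lam[of a])

lemma lam_star_inv: "\<lbrakk>a \<in> C; b \<in> C\<rbrakk> \<Longrightarrow> lam a (inv\<^bsub>S\<^esub> b) = inv\<^bsub>S\<^esub> (lam a b)"
  by (metis lam_closed lam_one_right lam_star star.inv_closed star.inv_equality star.l_inv)

lemma inv_into_lam: "\<lbrakk>a \<in> C; b \<in> C\<rbrakk> \<Longrightarrow> inv_into C (lam a) b = lam (inv\<^bsub>D\<^esub> a) b"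
  by (rule inv_into_f_eq) (auto intro!: inj_on_inverseI[where g = "lam (inv\<^bsub>D\<^esub> a)"])

lemma SD_carrier [simp]: "carrier SD = C \<times> C"
  by (simp add: brace_semidirect_def carrier_eq)

lemma SD_mult [simp]: "(a, b) \<otimes>\<^bsub>SD\<^esub> (a', b') = (a \<star> lam b a', b \<sqdot> b')"
  by (simp add: brace_semidirect_def)

lemma SD_one [simp]: "\<one>\<^bsub>SD\<^esub> = (\<one>\<^bsub>S\<^esub>, \<one>\<^bsub>S\<^esub>)"
  by (simp add: brace_semidirect_def)

lemma SD_group: "group SD"
proof (rule groupI)
  fix x assume "x \<in> carrier SD"
  then obtain a b where x: "x = (a, b)" "a \<in> C" "b \<in> C" by auto
  have "(lam (inv\<^bsub>D\<^esub> b) (inv\<^bsub>S\<^esub> a), inv\<^bsub>D\<^esub> b) \<otimes>\<^bsub>SD\<^esub> x = \<one>\<^bsub>SD\<^esub>"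
    using x by (simp add: lam_star_inv)
  then show "\<exists>y\<in>carrier SD. y \<otimes>\<^bsub>SD\<^esub> x = \<one>\<^bsub>SD\<^esub>"
    using x by (intro bexI[of _ "(lam (inv\<^bsub>D\<^esub> b) (inv\<^bsub>S\<^esub> a), inv\<^bsub>D\<^esub> b)"]) auto
qed (auto simp: star.m_assoc dot_assoc lam_star lam_dot)

text \<open>The diagonal is a copy of \<open>(B, \<sqdot>)\<close> inside the semidirect product, a second one besides the
  factor \<open>1 \<times> B\<close>. The two components of the solutions come from these two copies.\<close>

lemma SD_diagonal: "\<lbrakk>a \<in> C; b \<in> C\<rbrakk> \<Longrightarrow> (a, a) \<otimes>\<^bsub>SD\<^esub> (b, b) = (a \<sqdot> b, a \<sqdot> b)"
  by (simp flip: dot_lam)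

lemma SD_inv_diagonal: "a \<in> C \<Longrightarrow> inv\<^bsub>SD\<^esub> (a, a) = (inv\<^bsub>D\<^esub> a, inv\<^bsub>D\<^esub> a)"
  by (rule group.inv_equality[OF SD_group]) (simp_all add: SD_diagonal del: SD_mult)

lemma Theta_eq: "c \<in> C \<Longrightarrow> Theta (a, b) c = a \<star> lam b c \<star> inv\<^bsub>S\<^esub> a"
  by (simp add: brace_Theta_def)

lemma Theta_one: "c \<in> C \<Longrightarrow> b \<in> C \<Longrightarrow> Theta (\<one>\<^bsub>S\<^esub>, b) c = lam b c"
  by (simp add: Theta_eq)

lemma Theta_diagonal: "\<lbrakk>a \<in> C; c \<in> C\<rbrakk> \<Longrightarrow> Theta (a, a) c = a \<sqdot> c \<star> inv\<^bsub>S\<^esub> a"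
  by (simp add: Theta_eq flip: dot_lam)

lemma Theta_closed [simp]: "\<lbrakk>g \<in> C \<times> C; c \<in> C\<rbrakk> \<Longrightarrow> Theta g c \<in> C"
  by (cases g) (simp add: Theta_eq)

lemma Theta_comp:
  assumes "g \<in> C \<times> C" "h \<in> C \<times> C" "c \<in> C"
  shows "Theta (g \<otimes>\<^bsub>SD\<^esub> h) c = Theta g (Theta h c)"
proof -
  obtain a b a' b' where "g = (a, b)" "h = (a', b')" by force
  then show ?thesis using assms
    by (simp add: Theta_eq lam_star lam_dot lam_star_inv star.inv_mult_group star.m_assoc)
qed

end

text \<open>Bijectivity is automatic: the inverse group element acts as the inverse map.\<close>

lemma group_actionI:
  assumes G: "group G"
    and ext: "\<And>g. g \<in> carrier G \<Longrightarrow> act g \<in> extensional X"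
    and closed: "\<And>g x. \<lbrakk>g \<in> carrier G; x \<in> X\<rbrakk> \<Longrightarrow> act g x \<in> X"
    and one: "\<And>x. x \<in> X \<Longrightarrow> act \<one>\<^bsub>G\<^esub> x = x"
    and comp: "\<And>g h x. \<lbrakk>g \<in> carrier G; h \<in> carrier G; x \<in> X\<rbrakk> \<Longrightarrow> act (g \<otimes>\<^bsub>G\<^esub> h) x = act g (act h x)"
  shows "group_action G X act"
proof -
  interpret group G by (rule G)
  have bij: "act g \<in> Bij X" if g: "g \<in> carrier G" for g
  proof -
    have "bij_betw (act g) X X"
      by (rule bij_betwI[where g = "act (inv\<^bsub>G\<^esub> g)"])
        (use g in \<open>auto simp: closed one simp flip: comp\<close>)
    then show ?thesis using ext[OF g] by (simp add: Bij_def)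
  qed
  have "act \<in> hom G (BijGroup X)"
  proof (rule homI)
    fix g h assume gh: "g \<in> carrier G" "h \<in> carrier G"
    show "act (g \<otimes>\<^bsub>G\<^esub> h) = act g \<otimes>\<^bsub>BijGroup X\<^esub> act h"
      using gh by (intro extensionalityI[where A = X])
        (auto simp: BijGroup_def bij ext comp compose_def)
  qed (simp add: bij BijGroup_def)
  then show ?thesis
    by (intro group_action.intro group_hom.intro group_hom_axioms.intro G group_BijGroup)
qed

lemma (in skew_left_brace) Theta_action: "group_action SD C Theta"
proof (rule group_actionI[OF SD_group])
  show "Theta g \<in> extensional C" for g by (cases g) (simp add: brace_Theta_def)
  show "Theta (g \<otimes>\<^bsub>SD\<^esub> h) c = Theta g (Theta h c)"
    if "g \<in> carrier SD" "h \<in> carrier SD" "c \<in> C" for g h c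
    using that by (simp add: Theta_comp)
qed (simp_all add: Theta_one del: Theta_closed, auto)

section \<open>Equivariant maps into a brace and the solutions they induce\<close>

text \<open>The equation for \<open>r\<close> is required on \<open>X\<close> only and \<open>r\<close> is a parameter rather than a definition,
  so that a solution given in another way can be recognized as one induced by a brace.\<close>

locale brace_set = skew_left_brace S D
  for S D :: "'b monoid" +
  fixes X :: "'x set" and act :: "'b \<times> 'b \<Rightarrow> 'x \<Rightarrow> 'x" and p :: "'x \<Rightarrow> 'b"
    and r :: "'x \<times> 'x \<Rightarrow> 'x \<times> 'x"
  assumes nonempty: "X \<noteq> {}"
    and action: "group_action (brace_semidirect S D) X act"
    and p_closed [simp]: "x \<in> X \<Longrightarrow> p x \<in> carrier S"
    and p_act: "\<lbrakk>g \<in> carrier (brace_semidirect S D); x \<in> X\<rbrakk> \<Longrightarrow> p (act g x) = brace_Theta S D g (p x)"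
    and r_eq: "\<lbrakk>x \<in> X; y \<in> X\<rbrakk> \<Longrightarrow> r (x, y) =
      (let u = act (\<one>\<^bsub>S\<^esub>, p x) y in (u, act (inv\<^bsub>D\<^esub> (p u), inv\<^bsub>D\<^esub> (p u)) x))"
begin

abbreviation F where "F a x \<equiv> act (\<one>\<^bsub>S\<^esub>, a) x"
abbreviation E where "E a x \<equiv> act (a, a) x"

lemma act_closed [simp]: "\<lbrakk>g \<in> C \<times> C; x \<in> X\<rbrakk> \<Longrightarrow> act g x \<in> X"
  using group_action.element_image[OF action] by simp

lemma act_comp: "\<lbrakk>g \<in> C \<times> C; h \<in> C \<times> C; x \<in> X\<rbrakk> \<Longrightarrow> act (g \<otimes>\<^bsub>SD\<^esub> h) x = act g (act h x)"
  using group_action.composition_rule[OF action] by simp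

lemma act_one [simp]: "x \<in> X \<Longrightarrow> act (\<one>\<^bsub>S\<^esub>, \<one>\<^bsub>S\<^esub>) x = x"
  using group_action.id_eq_one[OF action] by (simp add: fun_eq_iff restrict_def) metis

lemma act_Bij: "g \<in> C \<times> C \<Longrightarrow> act g \<in> Bij X"
  using group_action.bij_prop0[OF action] by simp

lemma F_comp: "\<lbrakk>a \<in> C; b \<in> C; x \<in> X\<rbrakk> \<Longrightarrow> F (a \<sqdot> b) x = F a (F b x)"
  by (subst act_comp[symmetric]) auto

lemma E_comp: "\<lbrakk>a \<in> C; b \<in> C; x \<in> X\<rbrakk> \<Longrightarrow> E (a \<sqdot> b) x = E a (E b x)"
  by (subst act_comp[symmetric]) (auto simp: SD_diagonal simp del: SD_mult)

lemma E_inv_cancel [simp]: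
  assumes "a \<in> C" "x \<in> X"
  shows "E (inv\<^bsub>D\<^esub> a) (E a x) = x" "E a (E (inv\<^bsub>D\<^esub> a) x) = x"
  using assms by (simp_all flip: E_comp)

lemma F_inv_cancel [simp]:
  assumes "a \<in> C" "x \<in> X"
  shows "F (inv\<^bsub>D\<^esub> a) (F a x) = x" "F a (F (inv\<^bsub>D\<^esub> a) x) = x"
  using assms by (simp_all flip: F_comp)

text \<open>Both sides are the action of \<open>(1, a)(b, b) = (lam a b, a \<sqdot> b)\<close>.\<close>

lemma F_E: "\<lbrakk>a \<in> C; b \<in> C; x \<in> X\<rbrakk>
    \<Longrightarrow> F a (E b x) = E (lam a b) (F (inv\<^bsub>D\<^esub> (lam a b) \<sqdot> (a \<sqdot> b)) x)"
  by (subst (1 2) act_comp[symmetric]) auto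

lemma p_F: "\<lbrakk>a \<in> C; x \<in> X\<rbrakk> \<Longrightarrow> p (F a x) = lam a (p x)"
  by (simp add: p_act Theta_one)

lemma p_E_inv:
  assumes "a \<in> C" "x \<in> X"
  shows "a \<sqdot> p (E (inv\<^bsub>D\<^esub> a) x) = p x \<star> a"
proof -
  define y where "y = E (inv\<^bsub>D\<^esub> a) x"
  have y: "y \<in> X" using assms by (simp add: y_def)
  have "p x = p (E a y)" using assms by (simp add: y_def)
  also have "\<dots> = a \<sqdot> p y \<star> inv\<^bsub>S\<^esub> a" using assms y by (simp add: p_act Theta_diagonal)
  finally show ?thesis using assms y by (simp add: star.m_assoc flip: y_def)
qed

text \<open>On \<open>a = p y\<close> this is the second component of the solution; the definition makes sense for all \<open>a\<close>
  and gives an anti-homomorphism, which is how the maps \<open>g\<^sub>y\<close> turn out to be bijective and how \<open>g\<close>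
  extends to the structure group.\<close>

definition rho where "rho a = (\<lambda>x\<in>X. E (inv\<^bsub>D\<^esub> (lam (p x) a)) x)"

lemma rho_closed [simp]: "\<lbrakk>a \<in> C; x \<in> X\<rbrakk> \<Longrightarrow> rho a x \<in> X"
  by (simp add: rho_def)

lemma p_rho: "\<lbrakk>a \<in> C; x \<in> X\<rbrakk> \<Longrightarrow> lam (p x) a \<sqdot> p (rho a x) = p x \<sqdot> a"
  by (simp add: rho_def p_E_inv flip: dot_lam)

lemma rho_one [simp]: "x \<in> X \<Longrightarrow> rho \<one>\<^bsub>S\<^esub> x = x"
  using dot.inv_one by (simp add: rho_def)

text \<open>With \<open>x' = \<rho>\<^sub>a x\<close> the brace identity
  \<open>lam x (a \<sqdot> b) = lam x a \<sqdot> lam x' b\<close> holds (writing \<open>x\<close> for \<open>p x\<close>), since \<open>x \<sqdot> a = lam x a \<sqdot> x'\<close>.\<close>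

lemma rho_dot:
  assumes "a \<in> C" "b \<in> C" "x \<in> X"
  shows "rho (a \<sqdot> b) x = rho b (rho a x)"
proof -
  define l where "l = lam (p x) a"
  define k where "k = lam (p (rho a x)) b"
  have lk: "l \<in> C" "k \<in> C" using assms by (simp_all add: l_def k_def)
  have "l \<sqdot> k = l \<star> lam (l \<sqdot> p (rho a x)) b"
    using assms lk by (simp add: k_def lam_dot dot_lam[of l "lam (p (rho a x)) b"])
  also have "\<dots> = lam (p x) (a \<star> lam a b)"
    using assms by (simp add: l_def p_rho lam_dot lam_star)
  finally have "lam (p x) (a \<sqdot> b) = l \<sqdot> k" using assms by (simp add: dot_lam[of a b])
  then have "rho (a \<sqdot> b) x = E (inv\<^bsub>D\<^esub> k \<sqdot> inv\<^bsub>D\<^esub> l) x"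
    using assms lk by (simp add: rho_def dot.inv_mult_group carrier_eq)
  then show ?thesis using assms lk by (simp add: E_comp) (simp add: rho_def k_def l_def)
qed

lemma rho_Bij: assumes "a \<in> C" shows "rho a \<in> Bij X"
proof -
  have "bij_betw (rho a) X X"
    by (rule bij_betwI[where g = "rho (inv\<^bsub>D\<^esub> a)"])
      (use assms in \<open>auto simp flip: rho_dot\<close>)
  then show ?thesis by (simp add: Bij_def) (simp add: rho_def)
qed

lemma sol_f_eq: "\<lbrakk>x \<in> X; y \<in> X\<rbrakk> \<Longrightarrow> sol_f r x y = F (p x) y"
  by (simp add: sol_f_def r_eq Let_def)

lemma sol_g_eq: "\<lbrakk>x \<in> X; y \<in> X\<rbrakk> \<Longrightarrow> sol_g r y x = rho (p y) x"
  by (simp add: sol_g_def r_eq Let_def rho_def p_F)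

lemma r_rho: "\<lbrakk>x \<in> X; y \<in> X\<rbrakk> \<Longrightarrow> r (x, y) = (F (p x) y, rho (p y) x)"
  by (simp add: r_eq Let_def rho_def p_F)

lemma p_product: "\<lbrakk>x \<in> X; y \<in> X\<rbrakk> \<Longrightarrow> p (F (p x) y) \<sqdot> p (rho (p y) x) = p x \<sqdot> p y"
  by (simp add: p_F p_rho)

lemma F_rho:
  assumes "x \<in> X" "t \<in> X" "n \<in> X"
  shows "F (p x) (E (p t) n) = E (p (F (p x) t)) (F (p (rho (p t) x)) n)"
proof -
  have "inv\<^bsub>D\<^esub> (lam (p x) (p t)) \<sqdot> (p x \<sqdot> p t) = p (rho (p t) x)"
    using assms by (simp flip: p_rho)
  then show ?thesis using assms by (simp add: F_E p_F)
qed

text \<open>The first and third components agree because \<open>r\<close> preserves \<open>p x \<sqdot> p y\<close>, and \<open>F\<close> and \<open>\<rho>\<close> are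
  a homomorphism and an anti-homomorphism; the middle components agree by \<open>F_rho\<close>.\<close>

lemma yang_baxter:
  assumes "x \<in> X" "y \<in> X" "z \<in> X"
  shows "yb_left r (yb_right r (yb_left r (x, y, z))) = yb_right r (yb_left r (yb_right r (x, y, z)))"
proof -
  \<comment> \<open>One side is \<open>(x, y, z) \<mapsto> (u, v, z) \<mapsto> (u, s, \<rho>\<^sub>z v) \<mapsto> (w, \<rho>\<^sub>s u, \<rho>\<^sub>z v)\<close>, the other
    \<open>(x, y, z) \<mapsto> (x, t, n) \<mapsto> (w, m, n) \<mapsto> (w, F\<^sub>m n, \<rho>\<^sub>n m)\<close>.\<close>
  define u where "u = F (p x) y"
  define v where "v = rho (p y) x"
  define t where "t = F (p y) z"
  define n where "n = rho (p z) y"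
  define w where "w = F (p x) t"
  define m where "m = rho (p t) x"
  define s where "s = F (p v) z"
  note defs = u_def v_def t_def n_def w_def m_def s_def
  have X: "u \<in> X" "v \<in> X" "t \<in> X" "n \<in> X" "w \<in> X" "m \<in> X" "s \<in> X"
    using assms by (simp_all add: defs)
  have 1: "F (p u) s = w"
    using assms X p_product[OF assms(1,2)]
    by (simp add: s_def w_def t_def u_def v_def flip: F_comp)
  have pw: "lam (p u) (p s) = p w" using X by (simp flip: 1 p_F)
  have "y = E (p t) n" using assms X by (simp add: n_def rho_def t_def p_F)
  then have "u = E (p w) (F (p m) n)" using assms X F_rho[of x t n] by (simp add: u_def w_def m_def)
  then have 2: "rho (p s) u = F (p m) n"
    using X pw by (simp add: rho_def)
  have 3: "rho (p z) v = rho (p n) m"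
    using assms X p_product[of y z] by (simp add: v_def m_def n_def t_def flip: rho_dot)
  show ?thesis using assms X 1 2 3
    by (simp add: yb_left_def yb_right_def r_rho flip: u_def v_def t_def n_def w_def m_def s_def)
qed

lemma r_bij: "bij_betw r (X \<times> X) (X \<times> X)"
proof (rule bij_betwI[where g = "\<lambda>(u, v). (E (p u) v, F (inv\<^bsub>D\<^esub> (p (E (p u) v))) u)"])
  fix q assume "q \<in> X \<times> X"
  then obtain x y where q: "q = (x, y)" "x \<in> X" "y \<in> X" by auto
  show "(\<lambda>(u, v). (E (p u) v, F (inv\<^bsub>D\<^esub> (p (E (p u) v))) u)) (r q) = q"
    using q by (simp add: r_eq Let_def)
  show "r ((\<lambda>(u, v). (E (p u) v, F (inv\<^bsub>D\<^esub> (p (E (p u) v))) u)) q) = q"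
    using q by (simp add: r_eq Let_def)
qed (auto simp: r_rho)

theorem induced_nondegenerate: "nondegenerate_solution X r"
proof -
  have f: "bij_betw (sol_f r x) X X" if "x \<in> X" for x
    using act_Bij[of "(\<one>\<^bsub>S\<^esub>, p x)"] that
    by (simp add: Bij_def sol_f_eq cong: bij_betw_cong)
  have g: "bij_betw (sol_g r y) X X" if "y \<in> X" for y
    using rho_Bij[of "p y"] that by (simp add: Bij_def sol_g_eq cong: bij_betw_cong)
  show ?thesis
    using nonempty r_bij yang_baxter f g
    by (auto simp: nondegenerate_solution_def yb_solution_def)
qed

end

section \<open>Skew left braces from bijective cocycles\<close>

text \<open>In a brace the identity is a bijective cocycle from \<open>(B, \<cdot>)\<close> to \<open>(B, \<star>)\<close>. Conversely such a
  cocycle makes its domain a brace: the compatibility axiom is the cocycle law together with the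
  additivity of \<open>L\<close>.\<close>

locale bijective_cocycle = dot: group D + add: group A
  for D :: "'b monoid" and A :: "'c monoid" +
  fixes L :: "'b \<Rightarrow> 'c \<Rightarrow> 'c" and \<phi> :: "'b \<Rightarrow> 'c"
  assumes L: "L \<in> hom D (AutoGroup A)"
    and bij: "bij_betw \<phi> (carrier D) (carrier A)"
    and cocycle: "\<lbrakk>a \<in> carrier D; b \<in> carrier D\<rbrakk> \<Longrightarrow> \<phi> (a \<otimes>\<^bsub>D\<^esub> b) = \<phi> a \<otimes>\<^bsub>A\<^esub> L a (\<phi> b)"
begin

definition transported where
  "transported = \<lparr>carrier = carrier D,
     mult = \<lambda>a b. inv_into (carrier D) \<phi> (\<phi> a \<otimes>\<^bsub>A\<^esub> \<phi> b),
     one = inv_into (carrier D) \<phi> \<one>\<^bsub>A\<^esub>\<rparr>"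

lemma transported_carrier [simp]: "carrier transported = carrier D"
  by (simp add: transported_def)

lemma phi_closed [simp]: "a \<in> carrier D \<Longrightarrow> \<phi> a \<in> carrier A"
  using bij by (auto simp: bij_betw_def)

lemma phi_eqD: "\<lbrakk>\<phi> a = \<phi> b; a \<in> carrier D; b \<in> carrier D\<rbrakk> \<Longrightarrow> a = b"
  using bij by (auto simp: bij_betw_def inj_on_def)

lemma inv_phi: "c \<in> carrier A \<Longrightarrow> inv_into (carrier D) \<phi> c \<in> carrier D"
  "c \<in> carrier A \<Longrightarrow> \<phi> (inv_into (carrier D) \<phi> c) = c"
  using bij by (auto simp: bij_betw_def inv_into_into f_inv_into_f)

lemma phi_transported:
  "\<lbrakk>a \<in> carrier D; b \<in> carrier D\<rbrakk> \<Longrightarrow> \<phi> (a \<otimes>\<^bsub>transported\<^esub> b) = \<phi> a \<otimes>\<^bsub>A\<^esub> \<phi> b"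
  by (simp add: transported_def inv_phi)

lemma transported_closed:
  "\<lbrakk>a \<in> carrier D; b \<in> carrier D\<rbrakk> \<Longrightarrow> a \<otimes>\<^bsub>transported\<^esub> b \<in> carrier D"
  by (simp add: transported_def inv_phi)

lemma transported_one: "\<one>\<^bsub>transported\<^esub> \<in> carrier D" "\<phi> \<one>\<^bsub>transported\<^esub> = \<one>\<^bsub>A\<^esub>"
  by (simp_all add: transported_def inv_phi)

lemma transported_group: "group transported"
proof (rule groupI)
  fix a assume a: "a \<in> carrier transported"
  show "\<exists>b\<in>carrier transported. b \<otimes>\<^bsub>transported\<^esub> a = \<one>\<^bsub>transported\<^esub>"
    using a by (intro bexI[of _ "inv_into (carrier D) \<phi> (inv\<^bsub>A\<^esub> (\<phi> a))"] phi_eqD)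
      (simp_all add: transported_closed transported_one phi_transported inv_phi)
qed (auto intro!: phi_eqD simp: transported_closed transported_one phi_transported add.m_assoc)

lemma phi_inv: "a \<in> carrier D \<Longrightarrow> \<phi> (inv\<^bsub>transported\<^esub> a) = inv\<^bsub>A\<^esub> (\<phi> a)"
proof -
  assume a: "a \<in> carrier D"
  interpret T: group transported by (rule transported_group)
  have i: "inv\<^bsub>transported\<^esub> a \<in> carrier D" using T.inv_closed a by simp
  show ?thesis
    using T.l_inv[of a] a i transported_one
    by (intro add.inv_equality[symmetric]) (auto simp flip: phi_transported)
qed

lemma L_auto: "a \<in> carrier D \<Longrightarrow> L a \<in> auto A"
  using L by (auto simp: hom_def AutoGroup_def)

lemma L_closed [simp]: "\<lbrakk>a \<in> carrier D; c \<in> carrier A\<rbrakk> \<Longrightarrow> L a c \<in> carrier A"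
  using L_auto by (auto simp: auto_def hom_def)

lemma L_mult: "\<lbrakk>a \<in> carrier D; c \<in> carrier A; d \<in> carrier A\<rbrakk> \<Longrightarrow> L a (c \<otimes>\<^bsub>A\<^esub> d) = L a c \<otimes>\<^bsub>A\<^esub> L a d"
  using L_auto by (auto simp: auto_def hom_def)

lemma transported_brace: "skew_left_brace transported D"
proof -
  interpret T: group transported by (rule transported_group)
  have i: "inv\<^bsub>transported\<^esub> a \<in> carrier D" if "a \<in> carrier D" for a using T.inv_closed that by simp
  show ?thesis
  proof (intro skew_left_brace.intro skew_left_brace_axioms.intro)
    fix a b c assume "a \<in> carrier transported" "b \<in> carrier transported" "c \<in> carrier transported"
    then have abc: "a \<in> carrier D" "b \<in> carrier D" "c \<in> carrier D" by simp_all
    have "\<phi> (a \<otimes>\<^bsub>D\<^esub> (b \<otimes>\<^bsub>transported\<^esub> c)) = \<phi> a \<otimes>\<^bsub>A\<^esub> (L a (\<phi> b) \<otimes>\<^bsub>A\<^esub> L a (\<phi> c))"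
      using abc by (simp add: cocycle phi_transported transported_closed L_mult)
    also have "\<dots> = \<phi> (a \<otimes>\<^bsub>D\<^esub> b) \<otimes>\<^bsub>A\<^esub> inv\<^bsub>A\<^esub> (\<phi> a) \<otimes>\<^bsub>A\<^esub> \<phi> (a \<otimes>\<^bsub>D\<^esub> c)"
      using abc by (simp add: cocycle add.m_assoc) (simp flip: add.m_assoc)
    also have "\<dots> = \<phi> ((a \<otimes>\<^bsub>D\<^esub> b) \<otimes>\<^bsub>transported\<^esub> inv\<^bsub>transported\<^esub> a \<otimes>\<^bsub>transported\<^esub> (a \<otimes>\<^bsub>D\<^esub> c))"
      using abc i by (simp add: phi_transported transported_closed phi_inv)
    finally show "a \<otimes>\<^bsub>D\<^esub> (b \<otimes>\<^bsub>transported\<^esub> c) =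
        (a \<otimes>\<^bsub>D\<^esub> b) \<otimes>\<^bsub>transported\<^esub> inv\<^bsub>transported\<^esub> a \<otimes>\<^bsub>transported\<^esub> (a \<otimes>\<^bsub>D\<^esub> c)"
      by (rule phi_eqD) (use abc i in \<open>simp_all add: transported_closed\<close>)
  qed (simp_all add: transported_group dot.is_group)
qed

lemma phi_brace_lambda:
  assumes "a \<in> carrier D" "b \<in> carrier D"
  shows "\<phi> (brace_lambda transported D a b) = L a (\<phi> b)"
proof -
  interpret T: group transported by (rule transported_group)
  have i: "inv\<^bsub>transported\<^esub> a \<in> carrier D" using T.inv_closed assms by simp
  show ?thesis using assms i
    by (simp add: brace_lambda_def phi_transported phi_inv cocycle flip: add.m_assoc)
qed

end

section \<open>The derived rack of a non-degenerate solution\<close>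

locale nondegenerate_yang_baxter =
  fixes X :: "'x set" and r :: "'x \<times> 'x \<Rightarrow> 'x \<times> 'x"
  assumes nondegenerate: "nondegenerate_solution X r"
begin

abbreviation f where "f \<equiv> sol_f r"
abbreviation g where "g \<equiv> sol_g r"

lemma r_eq: "r (x, y) = (f x y, g y x)"
  by (simp add: sol_f_def sol_g_def)

lemma r_bij: "bij_betw r (X \<times> X) (X \<times> X)"
  using nondegenerate by (simp add: nondegenerate_solution_def yb_solution_def)

lemma f_bij: "x \<in> X \<Longrightarrow> bij_betw (f x) X X"
  using nondegenerate by (simp add: nondegenerate_solution_def)

lemma g_bij: "x \<in> X \<Longrightarrow> bij_betw (g x) X X"
  using nondegenerate by (simp add: nondegenerate_solution_def)

lemma f_closed [simp]: "\<lbrakk>x \<in> X; y \<in> X\<rbrakk> \<Longrightarrow> f x y \<in> X"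
  using f_bij by (auto simp: bij_betw_def)

lemma g_closed [simp]: "\<lbrakk>x \<in> X; y \<in> X\<rbrakk> \<Longrightarrow> g x y \<in> X"
  using g_bij by (auto simp: bij_betw_def)

lemma f_eqD: "\<lbrakk>f x y = f x z; x \<in> X; y \<in> X; z \<in> X\<rbrakk> \<Longrightarrow> y = z"
  using f_bij[of x] by (auto simp: bij_betw_def inj_on_def)

lemma g_eqD: "\<lbrakk>g x y = g x z; x \<in> X; y \<in> X; z \<in> X\<rbrakk> \<Longrightarrow> y = z"
  using g_bij[of x] by (auto simp: bij_betw_def inj_on_def)

definition f_inv where "f_inv x y = inv_into X (f x) y"

lemma f_inv [simp]: "\<lbrakk>x \<in> X; y \<in> X\<rbrakk> \<Longrightarrow> f_inv x y \<in> X" "\<lbrakk>x \<in> X; y \<in> X\<rbrakk> \<Longrightarrow> f x (f_inv x y) = y"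
  "\<lbrakk>x \<in> X; y \<in> X\<rbrakk> \<Longrightarrow> f_inv x (f x y) = y"
  using f_bij[of x] by (auto simp: bij_betw_def f_inv_def inv_into_into f_inv_into_f)

lemma braid:
  assumes "x \<in> X" "y \<in> X" "z \<in> X"
  shows "f x (f y z) = f (f x y) (f (g y x) z)"
    and "g (f (g y x) z) (f x y) = f (g (f y z) x) (g z y)"
    and "g z (g y x) = g (g z y) (g (f y z) x)"
proof -
  have "yb_left r (yb_right r (yb_left r (x, y, z))) = yb_right r (yb_left r (yb_right r (x, y, z)))"
    using nondegenerate assms by (simp add: nondegenerate_solution_def yb_solution_def)
  then show "f x (f y z) = f (f x y) (f (g y x) z)"
    and "g (f (g y x) z) (f x y) = f (g (f y z) x) (g z y)"
    and "g z (g y x) = g (g z y) (g (f y z) x)"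
    by (simp_all add: yb_left_def yb_right_def r_eq)
qed

text \<open>In the derived group \<open>x \<star> z = z \<star> s z x\<close>, so \<open>s z\<close> stands for conjugation by \<open>z\<close>.
  Here \<open>x\<close> and \<open>z\<close> are arbitrary: \<open>z = f x y\<close> for \<open>y = f_inv x z\<close>.\<close>

definition s where "s z x = f z (g (f_inv x z) x)"

lemma s_closed [simp]: "\<lbrakk>x \<in> X; z \<in> X\<rbrakk> \<Longrightarrow> s z x \<in> X"
  by (simp add: s_def)

lemma s_f: "\<lbrakk>x \<in> X; y \<in> X\<rbrakk> \<Longrightarrow> s (f x y) x = f (f x y) (g y x)"
  by (simp add: s_def)

text \<open>For fixed first component \<open>z\<close> of a value of \<open>r\<close>, the second component ranges bijectively over \<open>X\<close>
  and so does the argument \<open>x\<close>: given \<open>x\<close>, the other argument is \<open>f_inv x z\<close>. Hence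
  \<open>x \<mapsto> g (f_inv x z) x\<close> is a bijection.\<close>

lemma s_bij:
  assumes z: "z \<in> X"
  shows "bij_betw (s z) X X"
proof -
  have "bij_betw (\<lambda>x. g (f_inv x z) x) X X"
    unfolding bij_betw_def
  proof (intro conjI inj_onI)
    fix x y assume xy: "x \<in> X" "y \<in> X" and "g (f_inv x z) x = g (f_inv y z) y"
    then have "r (x, f_inv x z) = r (y, f_inv y z)" using z by (simp add: r_eq)
    then have "(x, f_inv x z) = (y, f_inv y z)"
      by (rule inj_onD[OF bij_betw_imp_inj_on[OF r_bij]]) (use xy z in simp_all)
    then show "x = y" by simp
  next
    have "\<exists>x\<in>X. g (f_inv x z) x = v" if v: "v \<in> X" for v
    proof -
      have "(z, v) \<in> r ` (X \<times> X)" using bij_betw_imp_surj_on[OF r_bij] v z by simp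
      then obtain q where q: "(z, v) = r q" "q \<in> X \<times> X" by (rule imageE)
      define x where "x = fst q"
      define y where "y = snd q"
      have xy: "x \<in> X" "y \<in> X" "r (x, y) = (z, v)" using q by (auto simp: x_def y_def)
      then have "g (f_inv x z) x = v" by (auto simp: r_eq)
      then show ?thesis using xy by blast
    qed
    then show "(\<lambda>x. g (f_inv x z) x) ` X = X" using z by fastforce
  qed
  from bij_betw_trans[OF this f_bij[OF z]] show ?thesis
    by (simp add: comp_def s_def[abs_def])
qed

text \<open>The maps \<open>f w\<close> are automorphisms of the derived rack. This is the middle component of the braid
  relation for \<open>(w, x, y)\<close>.\<close>

lemma f_s:
  assumes "w \<in> X" "z \<in> X" "x \<in> X"
  shows "f w (s z x) = s (f w z) (f w x)"
proof -
  define y where "y = f_inv x z"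
  have y: "y \<in> X" "z = f x y" using assms by (simp_all add: y_def)
  have "f w z = f (f w x) (f (g x w) y)" using braid(1)[of w x y] assms y by simp
  then have "s (f w z) (f w x) = f (f w z) (g (f (g x w) y) (f w x))" using assms y by (simp add: s_def)
  also have "\<dots> = f (f w z) (f (g z w) (g y x))" using braid(2)[of w x y] assms y by simp
  also have "\<dots> = f w (f z (g y x))" using braid(1)[of w z "g y x"] assms y(1) by simp
  finally show ?thesis using assms by (simp add: s_def y_def)
qed

text \<open>Self-distributivity. By \<open>f_s\<close> it suffices that \<open>x \<mapsto> g (f_inv x z) x\<close> is compatible with \<open>s\<close>
  as well; this uses all three components of the braid relation for \<open>(x, t, c)\<close> and the first two for
  \<open>(y, v, c)\<close>, where \<open>c\<close> is chosen such that \<open>f x (f t c) = z\<close>.\<close>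

lemma s_s:
  assumes "z \<in> X" "y \<in> X" "x \<in> X"
  shows "s z (s y x) = s (s z y) (s z x)"
proof -
  define t where "t = f_inv x y"
  define v where "v = g t x"
  define c where "c = f_inv v (f_inv y z)"
  define h where "h = f_inv x z"
  have X: "t \<in> X" "v \<in> X" "c \<in> X" "h \<in> X" using assms by (simp_all add: t_def v_def c_def h_def)
  have fc: "f v c = f_inv y z" "f x t = y" "f x h = z" using assms X by (simp_all add: c_def t_def h_def)
  define y' where "y' = g (f_inv y z) y"
  define x' where "x' = g h x"
  have X': "y' \<in> X" "x' \<in> X" using assms X by (simp_all add: y'_def x'_def)
  have "f x (f t c) = z" using braid(1)[OF assms(3) X(1) X(3)] assms fc by (simp add: v_def)
  then have tc: "f t c = h" using assms X by (metis f_inv(3) h_def f_closed)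
  have "f (f y v) (f (g v y) c) = z" using braid(1)[of y v c] assms X fc by simp
  then have "f_inv (f y v) z = f (g v y) c" using assms X f_inv(3)[of "f y v" "f (g v y) c"] by simp
  then have "g (f_inv (s y x) z) (s y x) = g (f (g v y) c) (f y v)"
    by (simp add: s_def v_def t_def)
  also have "\<dots> = f y' (g c v)" using braid(2)[of y v c] assms X by (simp add: fc y'_def)
  also have "g c v = g (g c t) x'" using braid(3)[of x t c] assms X by (simp add: v_def tc x'_def)
  also have "f x' (g c t) = y'"
    using assms X braid(2)[of x t c] fc by (simp add: tc x'_def y'_def v_def)
  then have "f y' (g (g c t) x') = s y' x'" using X X' f_inv(3)[of x' "g c t"] by (simp add: s_def)
  finally have "s z (s y x) = f z (s y' x')" by (simp add: s_def)
  then show ?thesis using assms X' f_s[of z y' x'] by (simp add: s_def y'_def x'_def h_def)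
qed

text \<open>The next two lemmas say that \<open>y \<mapsto> f\<^sub>y\<inverse> y\<close> is a bijection of \<open>X\<close>. In a brace this map is
  \<open>y \<mapsto> (y\<inverse>)\<^sup>\<star>\<close>. It is injective because \<open>f y x = y\<close> determines \<open>g x y\<close>: the braid
  relation for \<open>(y, x, c)\<close> with \<open>f x c = x\<close> gives \<open>g x y = s x x\<close>, and \<open>g x\<close> is injective.\<close>

lemma diagonal_unique:
  assumes "x \<in> X" "y \<in> X" "f y x = y" "z \<in> X" "f z x = z"
  shows "y = z"
proof -
  have "g x y = s x x" if y: "y \<in> X" "f y x = y" for y
  proof -
    define c where "c = f_inv x x"
    have c: "c \<in> X" "f x c = x" using assms by (simp_all add: c_def)
    have fv: "f x d = f (g x y) d" if d: "d \<in> X" for d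
    proof (rule f_eqD)
      show "f y (f x d) = f y (f (g x y) d)" using braid(1)[of y x d] assms(1) y d by simp
    qed (use assms(1) y d in simp_all)
    have "g x y = f (g x y) (g c x)"
      using braid(2)[of y x c] assms(1) y c fv[of c] by simp
    also have "\<dots> = f x (g c x)" using assms(1) y c fv[of "g c x"] by simp
    finally show ?thesis by (simp add: s_def c_def)
  qed
  then have "g x y = g x z" using assms by simp
  then show ?thesis by (rule g_eqD) (use assms in simp_all)
qed

text \<open>If \<open>g x w = x\<close>, the first component of the braid relation shows that \<open>f w\<close> and \<open>f (f w x)\<close> are the
  same map, so \<open>y = f w x\<close> is a solution of \<open>f y x = y\<close>.\<close>

lemma diagonal_ex:
  assumes "x \<in> X"
  shows "\<exists>y\<in>X. f y x = y"
proof -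
  have "x \<in> g x ` X" using bij_betw_imp_surj_on[OF g_bij[OF assms]] assms by simp
  then obtain w where "x = g x w" and w: "w \<in> X" by (rule imageE)
  then have gw: "g x w = x" by simp
  have "f w d = f (f w x) d" if d: "d \<in> X" for d
    using braid(1)[of w x "f_inv x d"] assms w gw d by simp
  from this[OF assms] show ?thesis using assms w by (intro bexI[of _ "f w x"] sym) simp_all
qed

end

section \<open>The structure group of a solution as a skew left brace\<close>

context nondegenerate_yang_baxter
begin

abbreviation G where "G \<equiv> structure_group X r"
abbreviation A where "A \<equiv> derived_group X r"
abbreviation iG where "iG \<equiv> gen_G X r"
abbreviation iA where "iA \<equiv> gen_A X r"

sublocale G: group "structure_group X r"
  unfolding structure_group_def by (rule presented_group_group)

sublocale A: group "derived_group X r"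
  unfolding derived_group_def by (rule presented_group_group)

sublocale SymX: group "BijGroup X"
  by (rule group_BijGroup)

lemma iG_closed [simp]: "x \<in> X \<Longrightarrow> iG x \<in> carrier G"
  by (simp add: gen_G_def structure_group_def presented_gen_closed)

lemma iA_closed [simp]: "x \<in> X \<Longrightarrow> iA x \<in> carrier A"
  by (simp add: gen_A_def derived_group_def presented_gen_closed)

lemma iG_relation:
  assumes "x \<in> X" "y \<in> X"
  shows "iG x \<otimes>\<^bsub>G\<^esub> iG y = iG (f x y) \<otimes>\<^bsub>G\<^esub> iG (g y x)"
proof -
  have "([(x, True), (y, True)], [(f x y, True), (g y x, True)]) \<in> structure_rels X r"
    using assms unfolding structure_rels_def by blast
  then have "word_class X (structure_rels X r) [(x, True), (y, True)] =
      word_class X (structure_rels X r) [(f x y, True), (g y x, True)]"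
    by (rule presented_relation) (use assms in \<open>auto simp: words_over_def\<close>)
  then show ?thesis
    using assms by (simp add: gen_G_def structure_group_def presented_gen_def presented_mult)
qed

lemma iA_relation:
  assumes "x \<in> X" "z \<in> X"
  shows "iA x \<otimes>\<^bsub>A\<^esub> iA z = iA z \<otimes>\<^bsub>A\<^esub> iA (s z x)"
proof -
  have "([(x, True), (f x (f_inv x z), True)],
      [(f x (f_inv x z), True), (f (f x (f_inv x z)) (g (f_inv x z) x), True)]) \<in> derived_rels X r"
    unfolding derived_rels_def using assms f_inv(1) by blast
  then have "([(x, True), (z, True)], [(z, True), (s z x, True)]) \<in> derived_rels X r"
    using assms by (simp add: s_def)
  then have "word_class X (derived_rels X r) [(x, True), (z, True)] =
      word_class X (derived_rels X r) [(z, True), (s z x, True)]"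
    by (rule presented_relation) (use assms in \<open>auto simp: words_over_def\<close>)
  then show ?thesis
    using assms by (simp add: gen_A_def derived_group_def presented_gen_def presented_mult)
qed

lemma structure_lift:
  assumes H: "group H" and p: "\<And>x. x \<in> X \<Longrightarrow> p x \<in> carrier H"
    and rel: "\<And>x y. \<lbrakk>x \<in> X; y \<in> X\<rbrakk> \<Longrightarrow> p x \<otimes>\<^bsub>H\<^esub> p y = p (f x y) \<otimes>\<^bsub>H\<^esub> p (g y x)"
  shows "\<exists>h. h \<in> extensional (carrier G) \<and> h \<in> hom G H \<and> (\<forall>x\<in>X. h (iG x) = p x)"
proof -
  have "word_eval H p u = word_eval H p v" if uv: "(u, v) \<in> structure_rels X r" for u v
  proof -
    obtain x y where x: "x \<in> X" "y \<in> X" and e: "u = [(x, True), (y, True)]"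
      "v = [(f x y, True), (g y x, True)]"
      using uv by (auto simp: structure_rels_def)
    show ?thesis unfolding e using x rel[OF x] by (simp only: word_eval_two[OF H] p f_closed g_closed)
  qed
  from presented_lift[OF H p this] show ?thesis
    unfolding structure_group_def gen_G_def .
qed

lemma derived_lift:
  assumes H: "group H" and p: "\<And>x. x \<in> X \<Longrightarrow> p x \<in> carrier H"
    and rel: "\<And>x z. \<lbrakk>x \<in> X; z \<in> X\<rbrakk> \<Longrightarrow> p x \<otimes>\<^bsub>H\<^esub> p z = p z \<otimes>\<^bsub>H\<^esub> p (s z x)"
  shows "\<exists>h. h \<in> extensional (carrier A) \<and> h \<in> hom A H \<and> (\<forall>x\<in>X. h (iA x) = p x)"
proof -
  have "word_eval H p u = word_eval H p v" if uv: "(u, v) \<in> derived_rels X r" for u v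
  proof -
    obtain x y where x: "x \<in> X" "y \<in> X" and e: "u = [(x, True), (f x y, True)]"
      "v = [(f x y, True), (f (f x y) (g y x), True)]"
      using uv by (auto simp: derived_rels_def)
    show ?thesis unfolding e using x rel[of x "f x y"]
      by (simp only: word_eval_two[OF H] p f_closed g_closed s_f)
  qed
  from presented_lift[OF H p this] show ?thesis
    unfolding derived_group_def gen_A_def .
qed

lemmas G_induct [consumes 1, case_names one gen mult inv] =
  presented_induct[of _ X "structure_rels X r", folded structure_group_def gen_G_def]

lemmas A_induct [consumes 1, case_names one gen mult inv] =
  presented_induct[of _ X "derived_rels X r", folded derived_group_def gen_A_def]

lemmas G_hom_eqI = presented_hom_eqI[of _ _ X "structure_rels X r", folded structure_group_def gen_G_def]

lemmas A_hom_eqI = presented_hom_eqI[of _ _ X "derived_rels X r", folded derived_group_def gen_A_def]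

abbreviation fr where "fr x \<equiv> restrict (f x) X"

lemma fr_Bij [simp]: "x \<in> X \<Longrightarrow> fr x \<in> Bij X"
  using f_bij by (simp add: Bij_def cong: bij_betw_cong)

text \<open>The first component of the braid relation says that \<open>x \<mapsto> f x\<close> respects the relations of the
  structure group.\<close>

lemma f_ext_characterization:
  "f_ext X r \<in> extensional (carrier G) \<and> f_ext X r \<in> hom G (BijGroup X) \<and>
    (\<forall>x\<in>X. f_ext X r (iG x) = fr x)"
proof -
  have "\<exists>h. h \<in> extensional (carrier G) \<and> h \<in> hom G (BijGroup X) \<and> (\<forall>x\<in>X. h (iG x) = fr x)"
  proof (rule structure_lift[OF SymX.is_group, where p = fr])
    show "fr x \<otimes>\<^bsub>BijGroup X\<^esub> fr y = fr (f x y) \<otimes>\<^bsub>BijGroup X\<^esub> fr (g y x)" if "x \<in> X" "y \<in> X" for x y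
      using that by (intro Bij_eqI[where X = X]) (simp_all add: fr_Bij braid(1)[OF that])
  qed (simp_all add: fr_Bij)
  then obtain h where h: "h \<in> extensional (carrier G)" "h \<in> hom G (BijGroup X)" "\<forall>x\<in>X. h (iG x) = fr x"
    by blast
  show ?thesis
    unfolding f_ext_def
  proof (rule theI[where a = h])
    fix k assume k: "k \<in> extensional (carrier G) \<and> k \<in> hom G (BijGroup X) \<and> (\<forall>x\<in>X. k (iG x) = fr x)"
    show "k = h"
    proof (rule extensionalityI)
      show "k a = h a" if "a \<in> carrier G" for a
        by (rule G_hom_eqI[OF SymX.is_group _ _ _ that]) (use k h in auto)
    qed (use k h in auto)
  qed (use h in blast)
qed

lemma f_ext_hom: "f_ext X r \<in> hom G (BijGroup X)"
  using f_ext_characterization by blast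

lemma f_ext_gen [simp]: "x \<in> X \<Longrightarrow> f_ext X r (iG x) = fr x"
  using f_ext_characterization by blast

lemma f_ext_Bij [simp]: "a \<in> carrier G \<Longrightarrow> f_ext X r a \<in> Bij X"
  using f_ext_hom by (auto simp: hom_def)

lemma f_ext_mult:
  "\<lbrakk>a \<in> carrier G; b \<in> carrier G\<rbrakk> \<Longrightarrow> f_ext X r (a \<otimes>\<^bsub>G\<^esub> b) = f_ext X r a \<otimes>\<^bsub>BijGroup X\<^esub> f_ext X r b"
  using f_ext_hom by (auto simp: hom_def)

lemma f_ext_one: "f_ext X r \<one>\<^bsub>G\<^esub> = \<one>\<^bsub>BijGroup X\<^esub>"
  using f_ext_hom G.is_group SymX.is_group by (intro hom_one)

lemma f_ext_inv: "a \<in> carrier G \<Longrightarrow> f_ext X r (inv\<^bsub>G\<^esub> a) = inv\<^bsub>BijGroup X\<^esub> (f_ext X r a)"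
  using group_hom.hom_inv[OF group_hom.intro[OF G.is_group SymX.is_group group_hom_axioms.intro[OF f_ext_hom]]] .

lemma f_ext_inv_cancel [simp]:
  assumes "a \<in> carrier G" "x \<in> X"
  shows "f_ext X r (inv\<^bsub>G\<^esub> a) (f_ext X r a x) = x" "f_ext X r a (f_ext X r (inv\<^bsub>G\<^esub> a) x) = x"
  using assms by (simp_all add: f_ext_inv)

text \<open>Permutations of \<open>X\<close> that preserve the derived rack permute the relations of the derived group.\<close>

definition rack_automorphisms where
  "rack_automorphisms = {\<pi> \<in> Bij X. \<forall>z\<in>X. \<forall>x\<in>X. \<pi> (s z x) = s (\<pi> z) (\<pi> x)}"

lemma rack_automorphismsI:
  "\<lbrakk>\<pi> \<in> Bij X; \<And>z x. \<lbrakk>z \<in> X; x \<in> X\<rbrakk> \<Longrightarrow> \<pi> (s z x) = s (\<pi> z) (\<pi> x)\<rbrakk> \<Longrightarrow> \<pi> \<in> rack_automorphisms"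
  by (simp add: rack_automorphisms_def)

lemma rack_automorphismsD:
  "\<pi> \<in> rack_automorphisms \<Longrightarrow> \<pi> \<in> Bij X"
  "\<lbrakk>\<pi> \<in> rack_automorphisms; z \<in> X; x \<in> X\<rbrakk> \<Longrightarrow> \<pi> (s z x) = s (\<pi> z) (\<pi> x)"
  by (auto simp: rack_automorphisms_def)

lemma f_ext_rack_automorphism: "a \<in> carrier G \<Longrightarrow> f_ext X r a \<in> rack_automorphisms"
proof (induction rule: G_induct)
  case one
  then show ?case by (simp add: f_ext_one rack_automorphisms_def)
next
  case (gen x)
  show ?case unfolding f_ext_gen[OF gen]
    by (rule rack_automorphismsI[OF fr_Bij[OF gen]]) (simp add: gen f_s)
next
  case (mult a b)
  then show ?case by (simp add: rack_automorphisms_def f_ext_mult)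
next
  case (inv a)
  have "(inv\<^bsub>BijGroup X\<^esub> \<pi>) (s z x) = s ((inv\<^bsub>BijGroup X\<^esub> \<pi>) z) ((inv\<^bsub>BijGroup X\<^esub> \<pi>) x)"
    if \<pi>: "\<pi> \<in> rack_automorphisms" and "z \<in> X" "x \<in> X" for \<pi> z x
  proof -
    let ?i = "inv\<^bsub>BijGroup X\<^esub> \<pi>"
    have "?i (s z x) = ?i (\<pi> (s (?i z) (?i x)))"
      using that rack_automorphismsD(1)[OF \<pi>] by (simp add: rack_automorphismsD(2)[OF \<pi>])
    then show ?thesis using that rack_automorphismsD(1)[OF \<pi>] by simp
  qed
  then show ?case using inv by (simp add: f_ext_inv rack_automorphisms_def)
qed

text \<open>The derived group is functorial in the derived rack; composing with \<open>f\<close> gives the action \<open>\<lambda>\<close> of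
  the structure group.\<close>

definition A_map where
  "A_map \<pi> = (SOME h. h \<in> extensional (carrier A) \<and> h \<in> hom A A \<and> (\<forall>y\<in>X. h (iA y) = iA (\<pi> y)))"

lemma A_map:
  assumes "\<pi> \<in> rack_automorphisms"
  shows "A_map \<pi> \<in> extensional (carrier A) \<and> A_map \<pi> \<in> hom A A \<and> (\<forall>y\<in>X. A_map \<pi> (iA y) = iA (\<pi> y))"
proof -
  note \<pi> = rack_automorphismsD[OF assms]
  have cl: "iA (\<pi> x) \<in> carrier A" if "x \<in> X" for x using \<pi>(1) that by simp
  have rel: "iA (\<pi> x) \<otimes>\<^bsub>A\<^esub> iA (\<pi> z) = iA (\<pi> z) \<otimes>\<^bsub>A\<^esub> iA (\<pi> (s z x))" if "x \<in> X" "z \<in> X" for x z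
    using iA_relation[of "\<pi> x" "\<pi> z"] \<pi>(1) that by (simp add: \<pi>(2))
  show ?thesis unfolding A_map_def
    by (rule someI_ex[OF derived_lift[OF A.is_group, where p = "\<lambda>y. iA (\<pi> y)", OF cl rel]])
qed

lemma A_map_closed [simp]:
  "\<lbrakk>\<pi> \<in> rack_automorphisms; c \<in> carrier A\<rbrakk> \<Longrightarrow> A_map \<pi> c \<in> carrier A"
  using A_map hom_in_carrier by metis

lemma A_map_f_ext_mult:
  assumes "a \<in> carrier G" "b \<in> carrier G" "c \<in> carrier A"
  shows "A_map (f_ext X r (a \<otimes>\<^bsub>G\<^esub> b)) c = A_map (f_ext X r a) (A_map (f_ext X r b) c)"
proof -
  note a = A_map[OF f_ext_rack_automorphism[OF assms(1)]]
  note b = A_map[OF f_ext_rack_automorphism[OF assms(2)]]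
  note ab = A_map[OF f_ext_rack_automorphism[OF G.m_closed[OF assms(1,2)]]]
  have "A_map (f_ext X r (a \<otimes>\<^bsub>G\<^esub> b)) c = (A_map (f_ext X r a) \<circ> A_map (f_ext X r b)) c"
  proof (rule A_hom_eqI[OF A.is_group _ _ _ assms(3)])
    show "A_map (f_ext X r a) \<circ> A_map (f_ext X r b) \<in> hom A A"
      using a b by (intro hom_compose[of _ A A]) auto
  qed (use ab a b assms in \<open>auto simp: f_ext_mult\<close>)
  then show ?thesis by simp
qed

lemma A_map_f_ext_one:
  assumes "c \<in> carrier A"
  shows "A_map (f_ext X r \<one>\<^bsub>G\<^esub>) c = c"
proof -
  note one = A_map[OF f_ext_rack_automorphism[OF G.one_closed]]
  have "A_map (f_ext X r \<one>\<^bsub>G\<^esub>) c = id c"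
  proof (rule A_hom_eqI[OF A.is_group _ _ _ assms])
    show "id \<in> hom A A" by (rule homI) simp_all
  qed (use one in \<open>auto simp: f_ext_one\<close>)
  then show ?thesis by simp
qed

lemma AutoGroup_carrier [simp]: "carrier (AutoGroup K) = auto K"
  by (simp add: AutoGroup_def)

lemma lambda_exists:
  "(\<lambda>a\<in>carrier G. A_map (f_ext X r a)) \<in> hom G (AutoGroup A)"
proof -
  let ?L = "\<lambda>a\<in>carrier G. A_map (f_ext X r a)"
  have "group_action G (carrier A) ?L"
    by (rule group_actionI[OF G.is_group])
      (use A_map f_ext_rack_automorphism in \<open>auto simp: A_map_f_ext_mult A_map_f_ext_one\<close>)
  then have "?L \<in> hom G (BijGroup (carrier A))"
    by (simp add: group_action_def group_hom_def group_hom_axioms_def)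
  moreover have "?L a \<in> hom A A" if "a \<in> carrier G" for a
    using A_map[OF f_ext_rack_automorphism[OF that]] that by simp
  ultimately show ?thesis by (auto simp: hom_def AutoGroup_def auto_def Pi_iff)
qed

lemma auto_eqI:
  assumes "h \<in> auto A" "k \<in> auto A" "\<And>y. y \<in> X \<Longrightarrow> h (iA y) = k (iA y)"
  shows "h = k"
proof (rule extensionalityI)
  fix c assume "c \<in> carrier A"
  then show "h c = k c"
    by (rule A_hom_eqI[OF A.is_group, rotated 3]) (use assms in \<open>auto simp: auto_def\<close>)
qed (use assms in \<open>auto simp: auto_def Bij_def\<close>)

abbreviation L where "L \<equiv> lambda_GA X r"

lemma lambda_unique:
  assumes h: "h \<in> hom G (AutoGroup A)" "\<forall>x\<in>X. \<forall>y\<in>X. h (iG x) (iA y) = iA (f x y)"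
    and k: "k \<in> hom G (AutoGroup A)" "\<forall>x\<in>X. \<forall>y\<in>X. k (iG x) (iA y) = iA (f x y)"
    and a: "a \<in> carrier G"
  shows "h a = k a"
proof (rule G_hom_eqI[OF A.AutoGroup h(1) k(1) _ a])
  fix x assume x: "x \<in> X"
  have "h (iG x) \<in> auto A" "k (iG x) \<in> auto A"
    using hom_in_carrier[OF h(1) iG_closed[OF x]] hom_in_carrier[OF k(1) iG_closed[OF x]] by simp_all
  then show "h (iG x) = k (iG x)" by (rule auto_eqI) (use h(2) k(2) x in simp)
qed

lemma lambda_exists_gen:
  "\<forall>x\<in>X. \<forall>y\<in>X. (\<lambda>a\<in>carrier G. A_map (f_ext X r a)) (iG x) (iA y) = iA (f x y)"
  using A_map[OF f_ext_rack_automorphism[OF iG_closed]] by simp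

lemma lambda_characterization:
  "L \<in> extensional (carrier G) \<and> L \<in> hom G (AutoGroup A) \<and>
    (\<forall>x\<in>X. \<forall>y\<in>X. L (iG x) (iA y) = iA (f x y))"
  unfolding lambda_GA_def
proof (rule theI[where a = "\<lambda>a\<in>carrier G. A_map (f_ext X r a)"])
  show ext: "(\<lambda>a\<in>carrier G. A_map (f_ext X r a)) \<in> extensional (carrier G) \<and>
    (\<lambda>a\<in>carrier G. A_map (f_ext X r a)) \<in> hom G (AutoGroup A) \<and>
    (\<forall>x\<in>X. \<forall>y\<in>X. (\<lambda>a\<in>carrier G. A_map (f_ext X r a)) (iG x) (iA y) = iA (f x y))"
    using lambda_exists lambda_exists_gen by simp
  fix k assume k: "k \<in> extensional (carrier G) \<and> k \<in> hom G (AutoGroup A) \<and>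
    (\<forall>x\<in>X. \<forall>y\<in>X. k (iG x) (iA y) = iA (f x y))"
  show "k = (\<lambda>a\<in>carrier G. A_map (f_ext X r a))"
  proof (rule extensionalityI)
    fix a assume a: "a \<in> carrier G"
    show "k a = (\<lambda>a\<in>carrier G. A_map (f_ext X r a)) a"
      by (rule lambda_unique[OF _ _ _ _ a]) (use k ext in blast)+
  qed (use k in auto)
qed

lemma lambda_eq: "a \<in> carrier G \<Longrightarrow> L a = A_map (f_ext X r a)"
  using lambda_unique[OF _ _ lambda_exists lambda_exists_gen, of L a] lambda_characterization by simp

lemma L_hom: "L \<in> hom G (AutoGroup A)"
  using lambda_characterization by blast

lemma L_iA: "\<lbrakk>a \<in> carrier G; y \<in> X\<rbrakk> \<Longrightarrow> L a (iA y) = iA (f_ext X r a y)"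
  by (simp add: lambda_eq A_map f_ext_rack_automorphism)

lemma L_auto: "a \<in> carrier G \<Longrightarrow> L a \<in> auto A"
  using L_hom by (auto simp: hom_def)

lemma L_closed [simp]: "\<lbrakk>a \<in> carrier G; c \<in> carrier A\<rbrakk> \<Longrightarrow> L a c \<in> carrier A"
  using L_auto by (auto simp: auto_def hom_def)

lemma L_add: "\<lbrakk>a \<in> carrier G; c \<in> carrier A; d \<in> carrier A\<rbrakk> \<Longrightarrow> L a (c \<otimes>\<^bsub>A\<^esub> d) = L a c \<otimes>\<^bsub>A\<^esub> L a d"
  using L_auto by (auto simp: auto_def hom_def)

lemma L_one [simp]: "c \<in> carrier A \<Longrightarrow> L \<one>\<^bsub>G\<^esub> c = c"
  by (simp add: lambda_eq A_map_f_ext_one)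

lemma L_mult: "\<lbrakk>a \<in> carrier G; b \<in> carrier G; c \<in> carrier A\<rbrakk> \<Longrightarrow> L (a \<otimes>\<^bsub>G\<^esub> b) c = L a (L b c)"
  by (simp add: lambda_eq A_map_f_ext_mult)

lemma L_inv_cancel [simp]:
  assumes "a \<in> carrier G" "c \<in> carrier A"
  shows "L (inv\<^bsub>G\<^esub> a) (L a c) = c" "L a (L (inv\<^bsub>G\<^esub> a) c) = c"
  using assms by (simp_all flip: L_mult)

lemma L_a_one [simp]: "a \<in> carrier G \<Longrightarrow> L a \<one>\<^bsub>A\<^esub> = \<one>\<^bsub>A\<^esub>"
  using L_auto[of a] by (intro hom_one[OF _ A.is_group A.is_group]) (auto simp: auto_def)

section \<open>The bijective cocycle of a solution\<close>

text \<open>A cocycle is not a homomorphism, so the universal property of \<open>G\<close> does not provide it directly.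
  It does provide the action of \<open>G\<close> on the set \<open>A\<close> by the affine maps \<open>c \<mapsto> \<phi>(a) \<star> \<lambda>\<^sub>a(c)\<close>, and the
  cocycle is the orbit map of the identity.\<close>

definition affine where
  "affine x = (\<lambda>c\<in>carrier A. iA x \<otimes>\<^bsub>A\<^esub> L (iG x) c)"

lemma affine_Bij: assumes "x \<in> X" shows "affine x \<in> Bij (carrier A)"
proof (rule BijI)
  show "bij_betw (affine x) (carrier A) (carrier A)"
    by (rule bij_betwI[where g = "\<lambda>c. L (inv\<^bsub>G\<^esub> (iG x)) (inv\<^bsub>A\<^esub> (iA x) \<otimes>\<^bsub>A\<^esub> c)"])
      (use assms in \<open>auto simp: affine_def simp flip: A.m_assoc\<close>)
qed (simp add: affine_def)

lemma affine_ex: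
  "\<exists>h. h \<in> extensional (carrier G) \<and> h \<in> hom G (BijGroup (carrier A)) \<and> (\<forall>x\<in>X. h (iG x) = affine x)"
proof (rule structure_lift[OF group_BijGroup])
  fix x y assume xy: "x \<in> X" "y \<in> X"
  have "iA x \<otimes>\<^bsub>A\<^esub> iA (f x y) = iA (f x y) \<otimes>\<^bsub>A\<^esub> iA (f (f x y) (g y x))"
    using iA_relation[of x "f x y"] xy by (simp add: s_f)
  then have "iA x \<otimes>\<^bsub>A\<^esub> (iA (f x y) \<otimes>\<^bsub>A\<^esub> d) = iA (f x y) \<otimes>\<^bsub>A\<^esub> (iA (f (f x y) (g y x)) \<otimes>\<^bsub>A\<^esub> d)"
    if "d \<in> carrier A" for d
    using xy that by (simp flip: A.m_assoc)
  moreover have "L (iG x) (L (iG y) c) = L (iG (f x y)) (L (iG (g y x)) c)" if "c \<in> carrier A" for c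
    using xy that iG_relation[OF xy] by (simp flip: L_mult)
  ultimately show "affine x \<otimes>\<^bsub>BijGroup (carrier A)\<^esub> affine y =
      affine (f x y) \<otimes>\<^bsub>BijGroup (carrier A)\<^esub> affine (g y x)"
    using xy by (intro Bij_eqI[where X = "carrier A"])
      (simp_all add: affine_Bij, simp add: affine_def L_add L_iA)
qed (simp add: affine_Bij)

definition affine_ext where
  "affine_ext = (SOME h. h \<in> extensional (carrier G) \<and> h \<in> hom G (BijGroup (carrier A)) \<and>
    (\<forall>x\<in>X. h (iG x) = affine x))"

lemma affine_ext:
  "affine_ext \<in> hom G (BijGroup (carrier A))" "x \<in> X \<Longrightarrow> affine_ext (iG x) = affine x"
  using someI_ex[OF affine_ex] by (simp_all add: affine_ext_def)

lemma affine_ext_action: "group_action G (carrier A) affine_ext"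
  by (intro group_action.intro group_hom.intro group_hom_axioms.intro
      G.is_group group_BijGroup affine_ext(1))

definition cocycle_phi where "cocycle_phi = (\<lambda>a\<in>carrier G. affine_ext a \<one>\<^bsub>A\<^esub>)"

lemma affine_ext_closed [simp]: "\<lbrakk>a \<in> carrier G; c \<in> carrier A\<rbrakk> \<Longrightarrow> affine_ext a c \<in> carrier A"
  using group_action.element_image[OF affine_ext_action] by simp

lemma affine_ext_mult: "\<lbrakk>a \<in> carrier G; b \<in> carrier G; c \<in> carrier A\<rbrakk>
    \<Longrightarrow> affine_ext (a \<otimes>\<^bsub>G\<^esub> b) c = affine_ext a (affine_ext b c)"
  using group_action.composition_rule[OF affine_ext_action] by simp

lemma affine_ext_one: "c \<in> carrier A \<Longrightarrow> affine_ext \<one>\<^bsub>G\<^esub> c = c"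
  using group_action.id_eq_one[OF affine_ext_action] by (simp add: fun_eq_iff restrict_def) metis

lemma cocycle_phi_closed [simp]: "a \<in> carrier G \<Longrightarrow> cocycle_phi a \<in> carrier A"
  by (simp add: cocycle_phi_def)

lemma affine_ext_eq:
  "a \<in> carrier G \<Longrightarrow> \<forall>c\<in>carrier A. affine_ext a c = cocycle_phi a \<otimes>\<^bsub>A\<^esub> L a c"
proof (induction rule: G_induct)
  case one
  then show ?case by (simp add: affine_ext_one cocycle_phi_def)
next
  case (gen x)
  then show ?case by (simp add: affine_ext cocycle_phi_def affine_def)
next
  case (mult a b)
  have "cocycle_phi (a \<otimes>\<^bsub>G\<^esub> b) = affine_ext a (cocycle_phi b)"
    using mult.hyps by (simp add: cocycle_phi_def affine_ext_mult)
  then show ?case using mult by (simp add: affine_ext_mult L_add L_mult A.m_assoc)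
next
  case (inv a)
  have *: "affine_ext (inv\<^bsub>G\<^esub> a) c = L (inv\<^bsub>G\<^esub> a) (inv\<^bsub>A\<^esub> (cocycle_phi a) \<otimes>\<^bsub>A\<^esub> c)" if c: "c \<in> carrier A" for c
  proof -
    let ?d = "L (inv\<^bsub>G\<^esub> a) (inv\<^bsub>A\<^esub> (cocycle_phi a) \<otimes>\<^bsub>A\<^esub> c)"
    have "affine_ext a ?d = c" using inv c by (simp flip: A.m_assoc)
    then have "affine_ext (inv\<^bsub>G\<^esub> a) c = affine_ext (inv\<^bsub>G\<^esub> a \<otimes>\<^bsub>G\<^esub> a) ?d"
      using inv c by (simp only: affine_ext_mult G.inv_closed L_closed A.m_closed A.inv_closed cocycle_phi_closed)
    then show ?thesis using inv c by (simp add: affine_ext_one)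
  qed
  have "cocycle_phi (inv\<^bsub>G\<^esub> a) = L (inv\<^bsub>G\<^esub> a) (inv\<^bsub>A\<^esub> (cocycle_phi a))"
    using inv.hyps *[of "\<one>\<^bsub>A\<^esub>"] by (subst cocycle_phi_def) simp
  then show ?case using inv.hyps by (simp add: * L_add)
qed

lemma cocycle_phi_cocycle:
  "\<lbrakk>a \<in> carrier G; b \<in> carrier G\<rbrakk> \<Longrightarrow> cocycle_phi (a \<otimes>\<^bsub>G\<^esub> b) = cocycle_phi a \<otimes>\<^bsub>A\<^esub> L a (cocycle_phi b)"
proof -
  assume ab: "a \<in> carrier G" "b \<in> carrier G"
  have "cocycle_phi (a \<otimes>\<^bsub>G\<^esub> b) = affine_ext a (cocycle_phi b)"
    using ab by (simp add: cocycle_phi_def affine_ext_mult)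
  then show ?thesis using affine_ext_eq[OF ab(1)] ab by simp
qed

lemma cocycle_phi_gen: "x \<in> X \<Longrightarrow> cocycle_phi (iG x) = iA x"
  by (simp add: cocycle_phi_def affine_ext affine_def)

text \<open>Stated for any \<open>h\<close>, since the uniqueness of \<open>phi\<close> needs it for a second cocycle.\<close>

lemma cocycle_one:
  assumes "h \<one>\<^bsub>G\<^esub> \<in> carrier A" "h (\<one>\<^bsub>G\<^esub> \<otimes>\<^bsub>G\<^esub> \<one>\<^bsub>G\<^esub>) = h \<one>\<^bsub>G\<^esub> \<otimes>\<^bsub>A\<^esub> L \<one>\<^bsub>G\<^esub> (h \<one>\<^bsub>G\<^esub>)"
  shows "h \<one>\<^bsub>G\<^esub> = \<one>\<^bsub>A\<^esub>"
  using assms by simp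

lemma cocycle_phi_one: "cocycle_phi \<one>\<^bsub>G\<^esub> = \<one>\<^bsub>A\<^esub>"
  by (rule cocycle_one) (simp_all only: cocycle_phi_cocycle G.one_closed cocycle_phi_closed)

text \<open>For the inverse of the cocycle let \<open>A\<close> act on the set \<open>G\<close> from the right, the generator \<open>x\<close> by
  \<open>w \<mapsto> w \<star> x = w \<cdot> \<lambda>\<^sub>w\<inverse>(x)\<close>.\<close>

definition rmul where
  "rmul x = (\<lambda>w\<in>carrier G. w \<otimes>\<^bsub>G\<^esub> iG (f_ext X r (inv\<^bsub>G\<^esub> w) x))"

text \<open>Let \<open>v = rmul x w\<close>. Then \<open>w = v \<cdot> y\<inverse>\<close> for \<open>y = \<lambda>\<^sub>w\<inverse>(x)\<close>, which satisfies \<open>f y x' = y\<close>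
  for \<open>x' = \<lambda>\<^sub>v\<inverse>(x)\<close>. So for given \<open>v\<close> there is exactly one \<open>w\<close>, by the bijectivity of the
  diagonal map.\<close>

lemma rmul_Bij:
  assumes x: "x \<in> X"
  shows "rmul x \<in> Bij (carrier G)"
proof (rule BijI)
  have eq: "w = v \<otimes>\<^bsub>G\<^esub> inv\<^bsub>G\<^esub> (iG y) \<and> f y (f_ext X r (inv\<^bsub>G\<^esub> v) x) = y"
    if w: "w \<in> carrier G" and v: "v = rmul x w" and y: "y = f_ext X r (inv\<^bsub>G\<^esub> w) x" for v w y
  proof -
    have yX: "y \<in> X" using w x y by simp
    have vw: "v = w \<otimes>\<^bsub>G\<^esub> iG y" using v w y by (simp add: rmul_def)
    have "f_ext X r (inv\<^bsub>G\<^esub> v) x = f_ext X r (inv\<^bsub>G\<^esub> (iG y)) y"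
      using w yX x by (simp add: vw G.inv_mult_group f_ext_mult y)
    then have "f_ext X r (iG y) (f_ext X r (inv\<^bsub>G\<^esub> v) x) = y"
      using yX by (simp del: f_ext_gen)
    then show ?thesis using w vw yX x by (simp add: G.m_assoc)
  qed
  have "inj_on (rmul x) (carrier G)"
  proof (rule inj_onI)
    fix w w' assume w: "w \<in> carrier G" "w' \<in> carrier G" and e: "rmul x w = rmul x w'"
    define y where "y = f_ext X r (inv\<^bsub>G\<^esub> w) x"
    define y' where "y' = f_ext X r (inv\<^bsub>G\<^esub> w') x"
    note 1 = eq[OF w(1) HOL.refl y_def] and 2 = eq[OF w(2) HOL.refl y'_def]
    have v: "rmul x w \<in> carrier G" using w x by (simp add: rmul_def)
    have "y = y'"
      by (rule diagonal_unique[of "f_ext X r (inv\<^bsub>G\<^esub> (rmul x w)) x"])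
        (use 1 2 e w x v in \<open>simp_all add: y_def y'_def\<close>)
    then show "w = w'" using 1 2 e by metis
  qed
  moreover have "\<exists>w\<in>carrier G. rmul x w = v" if v: "v \<in> carrier G" for v
  proof -
    have "f_ext X r (inv\<^bsub>G\<^esub> v) x \<in> X" using v x by simp
    from diagonal_ex[OF this] obtain y where y: "y \<in> X" "f y (f_ext X r (inv\<^bsub>G\<^esub> v) x) = y" by blast
    define w where "w = v \<otimes>\<^bsub>G\<^esub> inv\<^bsub>G\<^esub> (iG y)"
    have "f_ext X r (inv\<^bsub>G\<^esub> w) x = y" using v y x by (simp add: w_def G.inv_mult_group f_ext_mult)
    then have "rmul x w = v" using v y by (simp add: rmul_def w_def G.m_assoc)
    then show ?thesis using v y by (intro bexI[of _ w]) (simp_all add: w_def)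
  qed
  moreover have "rmul x w \<in> carrier G" if "w \<in> carrier G" for w using that x by (simp add: rmul_def)
  ultimately show "bij_betw (rmul x) (carrier G) (carrier G)"
    unfolding bij_betw_def by blast
qed (simp add: rmul_def)

text \<open>With \<open>x1\<close> and \<open>z1\<close> the translates of \<open>x\<close> and \<open>z\<close> by \<open>w\<inverse>\<close> and \<open>z1 = f x1 y1\<close>, the two sides are
  \<open>w \<cdot> x1 \<cdot> y1\<close> and \<open>w \<cdot> f x1 y1 \<cdot> g y1 x1\<close>.\<close>

lemma rmul_rmul:
  assumes x: "x \<in> X" and z: "z \<in> X" and w: "w \<in> carrier G"
  shows "rmul z (rmul x w) = rmul (s z x) (rmul z w)"
proof -
  define x1 where "x1 = f_ext X r (inv\<^bsub>G\<^esub> w) x"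
  define z1 where "z1 = f_ext X r (inv\<^bsub>G\<^esub> w) z"
  define y1 where "y1 = f_inv x1 z1"
  have X: "x1 \<in> X" "z1 \<in> X" "y1 \<in> X" using assms by (simp_all add: x1_def z1_def y1_def)
  have inv_gen: "f_ext X r (inv\<^bsub>G\<^esub> (iG u)) v = f_inv u v" if "u \<in> X" "v \<in> X" for u v
    using f_ext_inv_cancel(1)[of "iG u" "f_inv u v"] that by simp
  have s1: "f_ext X r (inv\<^bsub>G\<^esub> w) (s z x) = s z1 x1"
    using rack_automorphismsD(2)[OF f_ext_rack_automorphism, of "inv\<^bsub>G\<^esub> w" z x] assms
    by (simp add: x1_def z1_def)
  have "s z1 x1 = f z1 (g y1 x1)" using X by (simp add: s_def y1_def)
  then have s2: "f_inv z1 (s z1 x1) = g y1 x1" using X by simp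
  have "rmul z (rmul x w) = w \<otimes>\<^bsub>G\<^esub> iG x1 \<otimes>\<^bsub>G\<^esub> iG y1"
    using assms X
    by (simp add: rmul_def G.inv_mult_group f_ext_mult inv_gen y1_def flip: x1_def z1_def)
  also have "\<dots> = w \<otimes>\<^bsub>G\<^esub> (iG (f x1 y1) \<otimes>\<^bsub>G\<^esub> iG (g y1 x1))"
    using w X iG_relation[of x1 y1] by (simp add: G.m_assoc)
  also have "\<dots> = w \<otimes>\<^bsub>G\<^esub> iG z1 \<otimes>\<^bsub>G\<^esub> iG (f_inv z1 (s z1 x1))"
    using w X by (simp add: G.m_assoc s2) (simp add: y1_def)
  also have "\<dots> = rmul (s z x) (rmul z w)"
    using assms X
    by (simp add: rmul_def G.inv_mult_group f_ext_mult inv_gen s1 flip: z1_def)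
  finally show ?thesis .
qed

lemma rmul_ex:
  "\<exists>h. h \<in> extensional (carrier A) \<and> h \<in> hom A (op_group (BijGroup (carrier G))) \<and>
    (\<forall>x\<in>X. h (iA x) = rmul x)"
proof (rule derived_lift[OF group_op_group[OF group_BijGroup]])
  fix x z assume xz: "x \<in> X" "z \<in> X"
  have "rmul z \<otimes>\<^bsub>BijGroup (carrier G)\<^esub> rmul x = rmul (s z x) \<otimes>\<^bsub>BijGroup (carrier G)\<^esub> rmul z"
    by (rule Bij_eqI[where X = "carrier G"])
      (use xz in \<open>simp_all add: rmul_Bij rmul_rmul[OF xz]\<close>)
  then show "rmul x \<otimes>\<^bsub>op_group (BijGroup (carrier G))\<^esub> rmul z =
      rmul z \<otimes>\<^bsub>op_group (BijGroup (carrier G))\<^esub> rmul (s z x)"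
    by simp
qed (simp add: rmul_Bij)

definition rmul_ext where
  "rmul_ext = (SOME h. h \<in> extensional (carrier A) \<and> h \<in> hom A (op_group (BijGroup (carrier G))) \<and>
    (\<forall>x\<in>X. h (iA x) = rmul x))"

lemma rmul_ext:
  "rmul_ext \<in> hom A (op_group (BijGroup (carrier G)))" "x \<in> X \<Longrightarrow> rmul_ext (iA x) = rmul x"
  using someI_ex[OF rmul_ex] by (simp_all add: rmul_ext_def)

lemma rmul_ext_Bij [simp]: "c \<in> carrier A \<Longrightarrow> rmul_ext c \<in> Bij (carrier G)"
  using hom_in_carrier[OF rmul_ext(1)] by simp

lemma rmul_ext_mult: "\<lbrakk>c \<in> carrier A; d \<in> carrier A; w \<in> carrier G\<rbrakk>
    \<Longrightarrow> rmul_ext (c \<otimes>\<^bsub>A\<^esub> d) w = rmul_ext d (rmul_ext c w)"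
  using hom_mult[OF rmul_ext(1)] by simp

lemma rmul_ext_one: "w \<in> carrier G \<Longrightarrow> rmul_ext \<one>\<^bsub>A\<^esub> w = w"
  using hom_one[OF rmul_ext(1) A.is_group group_op_group[OF group_BijGroup]] by simp

lemma rmul_ext_inv_cancel:
  "\<lbrakk>c \<in> carrier A; w \<in> carrier G\<rbrakk> \<Longrightarrow> rmul_ext c (rmul_ext (inv\<^bsub>A\<^esub> c) w) = w"
  "\<lbrakk>c \<in> carrier A; w \<in> carrier G\<rbrakk> \<Longrightarrow> rmul_ext (inv\<^bsub>A\<^esub> c) (rmul_ext c w) = w"
  by (simp_all add: rmul_ext_one flip: rmul_ext_mult)

lemma cocycle_phi_rmul_ext:
  "c \<in> carrier A \<Longrightarrow> \<forall>w\<in>carrier G. cocycle_phi (rmul_ext c w) = cocycle_phi w \<otimes>\<^bsub>A\<^esub> c"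
proof (induction rule: A_induct)
  case one
  then show ?case by (simp add: rmul_ext_one)
next
  case (gen x)
  then show ?case by (simp add: rmul_ext rmul_def cocycle_phi_cocycle cocycle_phi_gen L_iA)
next
  case (mult c d)
  then show ?case by (simp add: rmul_ext_mult A.m_assoc)
next
  case (inv c)
  show ?case
  proof
    fix w assume w: "w \<in> carrier G"
    let ?v = "rmul_ext (inv\<^bsub>A\<^esub> c) w"
    have "cocycle_phi (rmul_ext c ?v) = cocycle_phi ?v \<otimes>\<^bsub>A\<^esub> c" using inv w by simp
    then show "cocycle_phi ?v = cocycle_phi w \<otimes>\<^bsub>A\<^esub> inv\<^bsub>A\<^esub> c"
      using inv w by (simp add: rmul_ext_inv_cancel A.m_assoc)
  qed
qed

text \<open>In brace notation, \<open>v \<star> \<lambda>\<^sub>v(w) = v \<cdot> w\<close>. The identity is stated for every \<open>v\<close> so that the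
  induction passes to products; \<open>v = 1\<close> says that the cocycle has a left inverse.\<close>

lemma rmul_ext_cocycle_phi:
  "w \<in> carrier G \<Longrightarrow> \<forall>v\<in>carrier G. rmul_ext (L v (cocycle_phi w)) v = v \<otimes>\<^bsub>G\<^esub> w"
proof (induction rule: G_induct)
  case one
  then show ?case by (simp add: cocycle_phi_one rmul_ext_one)
next
  case (gen x)
  then show ?case by (simp add: cocycle_phi_gen L_iA rmul_ext rmul_def)
next
  case (mult a b)
  show ?case
  proof
    fix v assume v: "v \<in> carrier G"
    have "rmul_ext (L v (cocycle_phi (a \<otimes>\<^bsub>G\<^esub> b))) v = rmul_ext (L (v \<otimes>\<^bsub>G\<^esub> a) (cocycle_phi b)) (v \<otimes>\<^bsub>G\<^esub> a)"
      using mult v by (simp add: cocycle_phi_cocycle L_add L_mult rmul_ext_mult)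
    then show "rmul_ext (L v (cocycle_phi (a \<otimes>\<^bsub>G\<^esub> b))) v = v \<otimes>\<^bsub>G\<^esub> (a \<otimes>\<^bsub>G\<^esub> b)"
      using mult v by (simp add: G.m_assoc)
  qed
next
  case (inv a)
  show ?case
  proof
    fix v assume v: "v \<in> carrier G"
    let ?u = "v \<otimes>\<^bsub>G\<^esub> inv\<^bsub>G\<^esub> a"
    have "L ?u (cocycle_phi a) \<otimes>\<^bsub>A\<^esub> L v (cocycle_phi (inv\<^bsub>G\<^esub> a)) = \<one>\<^bsub>A\<^esub>" (is "?c \<otimes>\<^bsub>A\<^esub> ?d = _")
    proof -
      have "L ?u (cocycle_phi (a \<otimes>\<^bsub>G\<^esub> inv\<^bsub>G\<^esub> a)) = L ?u (cocycle_phi a) \<otimes>\<^bsub>A\<^esub> L (?u \<otimes>\<^bsub>G\<^esub> a) (cocycle_phi (inv\<^bsub>G\<^esub> a))"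
        using inv v by (simp only: cocycle_phi_cocycle L_add L_mult G.m_closed G.inv_closed cocycle_phi_closed L_closed)
      then show ?thesis using inv v by (simp add: cocycle_phi_one G.m_assoc)
    qed
    moreover have "rmul_ext ?c ?u = v" using inv v by (simp add: G.m_assoc)
    ultimately show "rmul_ext (L v (cocycle_phi (inv\<^bsub>G\<^esub> a))) v = v \<otimes>\<^bsub>G\<^esub> inv\<^bsub>G\<^esub> a"
      using inv v rmul_ext_mult[of ?c ?d ?u] by (simp add: rmul_ext_one)
  qed
qed

lemma cocycle_phi_bij: "bij_betw cocycle_phi (carrier G) (carrier A)"
proof (rule bij_betwI[where g = "\<lambda>c. rmul_ext c \<one>\<^bsub>G\<^esub>"])
  show "rmul_ext (cocycle_phi a) \<one>\<^bsub>G\<^esub> = a" if "a \<in> carrier G" for a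
    using bspec[OF rmul_ext_cocycle_phi[OF that] G.one_closed] that by simp
  show "cocycle_phi (rmul_ext c \<one>\<^bsub>G\<^esub>) = c" if "c \<in> carrier A" for c
    using cocycle_phi_rmul_ext[OF that] that by (simp add: cocycle_phi_one)
qed auto

abbreviation phi where "phi \<equiv> phi_GA X r"

lemma phi_eq: "phi = cocycle_phi"
  unfolding phi_GA_def
proof (rule the_equality)
  show "cocycle_phi \<in> extensional (carrier G) \<and> bij_betw cocycle_phi (carrier G) (carrier A) \<and>
    (\<forall>x\<in>X. cocycle_phi (iG x) = iA x) \<and>
    (\<forall>a\<in>carrier G. \<forall>b\<in>carrier G. cocycle_phi (a \<otimes>\<^bsub>G\<^esub> b) = cocycle_phi a \<otimes>\<^bsub>A\<^esub> L a (cocycle_phi b))"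
    by (simp add: cocycle_phi_bij cocycle_phi_gen cocycle_phi_cocycle) (simp add: cocycle_phi_def)
  fix h assume h: "h \<in> extensional (carrier G) \<and> bij_betw h (carrier G) (carrier A) \<and>
    (\<forall>x\<in>X. h (iG x) = iA x) \<and>
    (\<forall>a\<in>carrier G. \<forall>b\<in>carrier G. h (a \<otimes>\<^bsub>G\<^esub> b) = h a \<otimes>\<^bsub>A\<^esub> L a (h b))"
  then have hc: "h a \<in> carrier A" if "a \<in> carrier G" for a using that by (auto simp: bij_betw_def)
  have h_mult: "h (a \<otimes>\<^bsub>G\<^esub> b) = h a \<otimes>\<^bsub>A\<^esub> L a (h b)" if "a \<in> carrier G" "b \<in> carrier G" for a b
    using h that by blast
  have h1: "h \<one>\<^bsub>G\<^esub> = \<one>\<^bsub>A\<^esub>" by (rule cocycle_one) (simp_all only: hc h_mult G.one_closed)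
  have cocycle_inv: "k (inv\<^bsub>G\<^esub> a) = L (inv\<^bsub>G\<^esub> a) (inv\<^bsub>A\<^esub> (k a))"
    if k: "\<And>a. a \<in> carrier G \<Longrightarrow> k a \<in> carrier A" "k \<one>\<^bsub>G\<^esub> = \<one>\<^bsub>A\<^esub>"
      "\<And>a b. \<lbrakk>a \<in> carrier G; b \<in> carrier G\<rbrakk> \<Longrightarrow> k (a \<otimes>\<^bsub>G\<^esub> b) = k a \<otimes>\<^bsub>A\<^esub> L a (k b)"
      and a: "a \<in> carrier G" for k a
  proof -
    have "k a \<otimes>\<^bsub>A\<^esub> L a (k (inv\<^bsub>G\<^esub> a)) = \<one>\<^bsub>A\<^esub>" using k(3)[of a "inv\<^bsub>G\<^esub> a"] a k(2) by simp
    then have "inv\<^bsub>A\<^esub> (k a) = L a (k (inv\<^bsub>G\<^esub> a))" using k(1) a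
      by (intro A.inv_equality[OF A.inv_comm]) simp_all
    then show ?thesis using k(1) a by simp
  qed
  show "h = cocycle_phi"
  proof (rule extensionalityI)
    fix a assume "a \<in> carrier G"
    then show "h a = cocycle_phi a"
    proof (induction rule: G_induct)
      case (inv a)
      then show ?case
        using cocycle_inv[of h a] cocycle_inv[of cocycle_phi a] by (simp add: hc h1 h_mult cocycle_phi_one cocycle_phi_cocycle)
    qed (use h cocycle_phi_gen h1 cocycle_phi_one cocycle_phi_cocycle in simp_all)
  qed (use h in \<open>simp_all add: cocycle_phi_def\<close>)
qed

section \<open>The action of the structure brace\<close>

abbreviation GS where "GS \<equiv> structure_star X r"

sublocale cocycle: bijective_cocycle "structure_group X r" "derived_group X r" "lambda_GA X r" "phi_GA X r"
  by unfold_locales (simp_all add: L_hom phi_eq cocycle_phi_bij cocycle_phi_cocycle)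

lemma GS_eq: "GS = cocycle.transported"
  by (simp add: structure_star_def cocycle.transported_def)

lemma structure_brace: "skew_left_brace GS G"
  unfolding GS_eq by (rule cocycle.transported_brace)

lemma GS_carrier [simp]: "carrier GS = carrier G"
  by (simp add: GS_eq)

lemma phi_gen [simp]: "x \<in> X \<Longrightarrow> phi (iG x) = iA x"
  by (simp add: phi_eq cocycle_phi_gen)

lemmas phi_GS = cocycle.phi_transported[folded GS_eq]
  and phi_GS_one = cocycle.transported_one[folded GS_eq]
  and phi_GS_inv = cocycle.phi_inv[folded GS_eq]
  and phi_lambda = cocycle.phi_brace_lambda[folded GS_eq]

abbreviation sr where "sr x \<equiv> restrict (s x) X"

lemma sr_Bij [simp]: "x \<in> X \<Longrightarrow> sr x \<in> Bij X"
  using s_bij by (simp add: Bij_def cong: bij_betw_cong)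

text \<open>The inverses turn the right action \<open>z \<mapsto> s z\<close>, which imitates \<open>x \<mapsto> z\<^sup>\<star> \<star> x \<star> z\<close>, into a left action.\<close>

lemma A_act_ex:
  "\<exists>h. h \<in> extensional (carrier A) \<and> h \<in> hom A (BijGroup X) \<and>
    (\<forall>x\<in>X. h (iA x) = inv\<^bsub>BijGroup X\<^esub> (sr x))"
proof (rule derived_lift[OF SymX.is_group])
  fix x z assume xz: "x \<in> X" "z \<in> X"
  have "sr z \<otimes>\<^bsub>BijGroup X\<^esub> sr x = sr (s z x) \<otimes>\<^bsub>BijGroup X\<^esub> sr z"
    by (rule Bij_eqI[where X = X]) (use xz s_s[OF xz(2,1)] in simp_all)
  then have "inv\<^bsub>BijGroup X\<^esub> (sr z \<otimes>\<^bsub>BijGroup X\<^esub> sr x) =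
      inv\<^bsub>BijGroup X\<^esub> (sr (s z x) \<otimes>\<^bsub>BijGroup X\<^esub> sr z)"
    by simp
  then show "inv\<^bsub>BijGroup X\<^esub> (sr x) \<otimes>\<^bsub>BijGroup X\<^esub> inv\<^bsub>BijGroup X\<^esub> (sr z) =
      inv\<^bsub>BijGroup X\<^esub> (sr z) \<otimes>\<^bsub>BijGroup X\<^esub> inv\<^bsub>BijGroup X\<^esub> (sr (s z x))"
    using xz by (simp only: SymX.inv_mult_group sr_Bij BijGroup_carrier s_closed)
qed simp

definition A_act where
  "A_act = (SOME h. h \<in> extensional (carrier A) \<and> h \<in> hom A (BijGroup X) \<and>
    (\<forall>x\<in>X. h (iA x) = inv\<^bsub>BijGroup X\<^esub> (sr x)))"

lemma A_act_hom: "A_act \<in> hom A (BijGroup X)"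
  and A_act_gen: "x \<in> X \<Longrightarrow> A_act (iA x) = inv\<^bsub>BijGroup X\<^esub> (sr x)"
  using someI_ex[OF A_act_ex, folded A_act_def] by blast+

lemma A_act_Bij [simp]: "c \<in> carrier A \<Longrightarrow> A_act c \<in> Bij X"
  using hom_in_carrier[OF A_act_hom] by simp

lemma A_act_mult: "\<lbrakk>c \<in> carrier A; d \<in> carrier A\<rbrakk>
    \<Longrightarrow> A_act (c \<otimes>\<^bsub>A\<^esub> d) = A_act c \<otimes>\<^bsub>BijGroup X\<^esub> A_act d"
  using hom_mult[OF A_act_hom] by simp

lemma A_act_one: "A_act \<one>\<^bsub>A\<^esub> = \<one>\<^bsub>BijGroup X\<^esub>"
  using hom_one[OF A_act_hom A.is_group SymX.is_group] .

lemma A_act_inv: "c \<in> carrier A \<Longrightarrow> A_act (inv\<^bsub>A\<^esub> c) = inv\<^bsub>BijGroup X\<^esub> (A_act c)"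
  using group_hom.hom_inv[OF group_hom.intro[OF A.is_group SymX.is_group group_hom_axioms.intro[OF A_act_hom]]] .

lemma L_A_inv: "\<lbrakk>a \<in> carrier G; c \<in> carrier A\<rbrakk> \<Longrightarrow> L a (inv\<^bsub>A\<^esub> c) = inv\<^bsub>A\<^esub> (L a c)"
  by (rule A.inv_equality[symmetric]) (simp_all flip: L_add)

text \<open>This is what makes the actions of \<open>A\<close> and \<open>G\<close> on \<open>X\<close> combine to an action of the semidirect
  product. On generators it says that \<open>f\<close> acts by rack automorphisms.\<close>

lemma A_act_L:
  assumes b: "b \<in> carrier G" and c: "c \<in> carrier A"
  shows "A_act (L b c) \<otimes>\<^bsub>BijGroup X\<^esub> f_ext X r b = f_ext X r b \<otimes>\<^bsub>BijGroup X\<^esub> A_act c"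
  using c
proof (induction rule: A_induct)
  case one
  then show ?case using b by (simp add: A_act_one)
next
  case (gen x)
  have "sr (f_ext X r b x) \<otimes>\<^bsub>BijGroup X\<^esub> f_ext X r b = f_ext X r b \<otimes>\<^bsub>BijGroup X\<^esub> sr x"
    by (rule Bij_eqI[where X = X])
      (use b gen in \<open>simp_all add: rack_automorphismsD(2)[OF f_ext_rack_automorphism]\<close>)
  from SymX.conjugation_inv[OF this] show ?case using b gen by (simp add: L_iA A_act_gen)
next
  case (mult c d)
  have "A_act (L b (c \<otimes>\<^bsub>A\<^esub> d)) \<otimes>\<^bsub>BijGroup X\<^esub> f_ext X r b =
      A_act (L b c) \<otimes>\<^bsub>BijGroup X\<^esub> (f_ext X r b \<otimes>\<^bsub>BijGroup X\<^esub> A_act d)"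
    using mult b by (simp add: L_add A_act_mult SymX.m_assoc)
  also have "\<dots> = (f_ext X r b \<otimes>\<^bsub>BijGroup X\<^esub> A_act c) \<otimes>\<^bsub>BijGroup X\<^esub> A_act d"
    using mult b by (simp flip: SymX.m_assoc)
  finally show ?case using mult b by (simp add: A_act_mult SymX.m_assoc)
next
  case (inv c)
  from SymX.conjugation_inv[OF inv.IH] show ?case using b inv.hyps by (simp add: L_A_inv A_act_inv)
qed

text \<open>On a generator \<open>z\<close> this is the defining relation of \<open>A\<close> for \<open>x\<close> with \<open>s z x = y\<close>.\<close>

lemma iA_A_act:
  "c \<in> carrier A \<Longrightarrow> \<forall>y\<in>X. iA (A_act c y) = c \<otimes>\<^bsub>A\<^esub> iA y \<otimes>\<^bsub>A\<^esub> inv\<^bsub>A\<^esub> c"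
proof (induction rule: A_induct)
  case one
  then show ?case by (simp add: A_act_one)
next
  case (gen z)
  show ?case
  proof
    fix y assume y: "y \<in> X"
    define x where "x = A_act (iA z) y"
    have x: "x \<in> X" "s z x = y" using gen y BijGroup_inv_apply(2)[of "sr z" X y]
      by (simp_all add: x_def A_act_gen)
    then have "iA x \<otimes>\<^bsub>A\<^esub> iA z \<otimes>\<^bsub>A\<^esub> inv\<^bsub>A\<^esub> (iA z) = iA z \<otimes>\<^bsub>A\<^esub> iA y \<otimes>\<^bsub>A\<^esub> inv\<^bsub>A\<^esub> (iA z)"
      using iA_relation[of x z] gen by simp
    then show "iA (A_act (iA z) y) = iA z \<otimes>\<^bsub>A\<^esub> iA y \<otimes>\<^bsub>A\<^esub> inv\<^bsub>A\<^esub> (iA z)"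
      using x gen by (simp add: A.m_assoc flip: x_def)
  qed
next
  case (mult c d)
  then show ?case by (simp add: A_act_mult A.m_assoc A.inv_mult_group)
next
  case (inv c)
  show ?case
  proof
    fix y assume y: "y \<in> X"
    define x where "x = A_act (inv\<^bsub>A\<^esub> c) y"
    have x: "x \<in> X" "A_act c x = y" using inv.hyps y by (simp_all add: x_def A_act_inv)
    then have "iA y = c \<otimes>\<^bsub>A\<^esub> iA x \<otimes>\<^bsub>A\<^esub> inv\<^bsub>A\<^esub> c" using inv.IH by auto
    then have "inv\<^bsub>A\<^esub> c \<otimes>\<^bsub>A\<^esub> iA y \<otimes>\<^bsub>A\<^esub> c = iA x"
      using x inv.hyps by (simp add: A.m_assoc) (simp flip: A.m_assoc)
    then show "iA (A_act (inv\<^bsub>A\<^esub> c) y) = inv\<^bsub>A\<^esub> c \<otimes>\<^bsub>A\<^esub> iA y \<otimes>\<^bsub>A\<^esub> inv\<^bsub>A\<^esub> (inv\<^bsub>A\<^esub> c)"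
      using inv.hyps by (simp add: x_def)
  qed
qed

definition structure_act where
  "structure_act = (\<lambda>(a, b). A_act (phi a) \<otimes>\<^bsub>BijGroup X\<^esub> f_ext X r b)"

lemma structure_act_Bij [simp]:
  "\<lbrakk>a \<in> carrier G; b \<in> carrier G\<rbrakk> \<Longrightarrow> structure_act (a, b) \<in> Bij X"
  by (simp add: structure_act_def)

lemma structure_action: "group_action (brace_semidirect GS G) X structure_act"
proof -
  interpret B: skew_left_brace GS G by (rule structure_brace)
  have "structure_act \<in> hom (brace_semidirect GS G) (BijGroup X)"
  proof (rule homI)
    fix g h assume "g \<in> carrier (brace_semidirect GS G)" "h \<in> carrier (brace_semidirect GS G)"
    then obtain a b a' b' where gh: "g = (a, b)" "h = (a', b')"
      and c: "a \<in> carrier G" "b \<in> carrier G" "a' \<in> carrier G" "b' \<in> carrier G"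
      by auto
    have l: "brace_lambda GS G b a' \<in> carrier G" using B.lam_closed[of b a'] c by simp
    have "structure_act (g \<otimes>\<^bsub>brace_semidirect GS G\<^esub> h) =
        A_act (phi a) \<otimes>\<^bsub>BijGroup X\<^esub> (A_act (L b (phi a')) \<otimes>\<^bsub>BijGroup X\<^esub> f_ext X r b)
          \<otimes>\<^bsub>BijGroup X\<^esub> f_ext X r b'"
      using c l by (simp add: gh structure_act_def phi_GS phi_lambda A_act_mult f_ext_mult SymX.m_assoc)
    also have "\<dots> = structure_act g \<otimes>\<^bsub>BijGroup X\<^esub> structure_act h"
      using c by (simp add: A_act_L) (simp add: gh structure_act_def SymX.m_assoc)
    finally show "structure_act (g \<otimes>\<^bsub>brace_semidirect GS G\<^esub> h) =
        structure_act g \<otimes>\<^bsub>BijGroup X\<^esub> structure_act h" .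
  qed auto
  then show ?thesis
    by (intro group_action.intro group_hom.intro group_hom_axioms.intro B.SD_group SymX.is_group)
qed

lemma structure_act_one: "b \<in> carrier G \<Longrightarrow> structure_act (\<one>\<^bsub>GS\<^esub>, b) = f_ext X r b"
  by (simp add: structure_act_def phi_GS_one A_act_one)

lemma iG_structure_act:
  assumes "a \<in> carrier G" "b \<in> carrier G" "x \<in> X"
  shows "iG (structure_act (a, b) x) = brace_Theta GS G (a, b) (iG x)"
proof -
  interpret B: skew_left_brace GS G by (rule structure_brace)
  have l: "brace_lambda GS G b (iG x) \<in> carrier G" using B.lam_closed[of b "iG x"] assms by simp
  have i: "inv\<^bsub>GS\<^esub> a \<in> carrier G" using B.star.inv_closed assms by simp
  have al: "a \<otimes>\<^bsub>GS\<^esub> brace_lambda GS G b (iG x) \<in> carrier G" using B.star.m_closed[of a] assms l by simp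
  have "phi (iG (structure_act (a, b) x)) = phi a \<otimes>\<^bsub>A\<^esub> L b (iA x) \<otimes>\<^bsub>A\<^esub> inv\<^bsub>A\<^esub> (phi a)"
    using assms by (simp add: structure_act_def iA_A_act L_iA)
  also have "\<dots> = phi (brace_Theta GS G (a, b) (iG x))"
    using assms l i al by (simp add: B.Theta_eq phi_GS phi_GS_inv phi_lambda)
  finally show ?thesis
    by (rule cocycle.phi_eqD) (use assms B.Theta_closed[of "(a, b)" "iG x"] in simp_all)
qed

text \<open>The second component of \<open>r\<close> comes out right because \<open>s u x = f u (g y x)\<close> for \<open>u = f x y\<close>, so that
  \<open>(u, u)\<close>, acting as the inverse of \<open>s u\<close> after \<open>f u\<close>, sends \<open>g y x\<close> to \<open>x\<close>.\<close>

theorem structure_brace_set: "brace_set GS G X structure_act iG r"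
proof (intro brace_set.intro brace_set_axioms.intro structure_brace structure_action)
  interpret B: skew_left_brace GS G by (rule structure_brace)
  show "X \<noteq> {}" using nondegenerate by (simp add: nondegenerate_solution_def yb_solution_def)
  show "iG (structure_act g x) = brace_Theta GS G g (iG x)"
    if "g \<in> carrier (brace_semidirect GS G)" "x \<in> X" for g x
    using that by (cases g) (simp add: iG_structure_act)
  fix x y assume xy: "x \<in> X" "y \<in> X"
  let ?u = "f x y"
  have "structure_act (iG ?u, iG ?u) (g y x) = x"
    using xy by (simp add: structure_act_def A_act_gen flip: s_f)
      (metis BijGroup_inv_apply(1) f_closed restrict_apply' sr_Bij)
  then have "structure_act (inv\<^bsub>G\<^esub> (iG ?u), inv\<^bsub>G\<^esub> (iG ?u)) x = g y x"
    using group_action.orbit_sym_aux[OF structure_action, of "(iG ?u, iG ?u)" "g y x" x] xy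
    by (simp add: B.SD_inv_diagonal)
  then show "r (x, y) = (let u = structure_act (\<one>\<^bsub>GS\<^esub>, iG x) y in
      (u, structure_act (inv\<^bsub>G\<^esub> (iG u), inv\<^bsub>G\<^esub> (iG u)) x))"
    using xy by (simp add: structure_act_one r_eq)
qed simp

lemma g_ext_eq: "a \<in> carrier G \<Longrightarrow> g_ext X r a = brace_set.rho GS G X structure_act iG a"
proof -
  assume a: "a \<in> carrier G"
  interpret T: brace_set GS G X structure_act iG r by (rule structure_brace_set)
  have gen: "T.rho (iG x) = restrict (g x) X" if "x \<in> X" for x
    by (rule extensionalityI[where A = X])
      (use that in \<open>auto simp: T.sol_g_eq, simp add: T.rho_def\<close>)
  have op: "group (op_group (BijGroup X))" by (rule group_op_group[OF group_BijGroup])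
  have rho: "(\<lambda>a\<in>carrier G. T.rho a) \<in> hom G (op_group (BijGroup X))"
    by (rule homI) (use T.rho_Bij in \<open>auto intro!: Bij_eqI[where X = X] simp: T.rho_dot\<close>)
  have "g_ext X r = (\<lambda>a\<in>carrier G. T.rho a)"
    unfolding g_ext_def
  proof (rule the_equality)
    show "(\<lambda>a\<in>carrier G. T.rho a) \<in> carrier G \<rightarrow>\<^sub>E carrier (BijGroup X) \<and>
      (\<forall>a\<in>carrier G. \<forall>b\<in>carrier G. (\<lambda>a\<in>carrier G. T.rho a) (a \<otimes>\<^bsub>G\<^esub> b) =
        (\<lambda>a\<in>carrier G. T.rho a) b \<otimes>\<^bsub>BijGroup X\<^esub> (\<lambda>a\<in>carrier G. T.rho a) a) \<and>
      (\<forall>x\<in>X. (\<lambda>a\<in>carrier G. T.rho a) (iG x) = restrict (g x) X)"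
      using rho T.rho_Bij by (simp add: gen hom_def)
    fix h assume h: "h \<in> carrier G \<rightarrow>\<^sub>E carrier (BijGroup X) \<and>
      (\<forall>a\<in>carrier G. \<forall>b\<in>carrier G. h (a \<otimes>\<^bsub>G\<^esub> b) = h b \<otimes>\<^bsub>BijGroup X\<^esub> h a) \<and>
      (\<forall>x\<in>X. h (iG x) = restrict (g x) X)"
    have hh: "h \<in> hom G (op_group (BijGroup X))" by (rule homI) (use h in auto)
    show "h = (\<lambda>a\<in>carrier G. T.rho a)"
    proof (rule extensionalityI)
      show "h a = (\<lambda>a\<in>carrier G. T.rho a) a" if "a \<in> carrier G" for a
        by (rule G_hom_eqI[OF op hh rho _ that]) (use h gen in simp)
    qed (use h in \<open>auto simp: PiE_def\<close>)
  qed
  then show ?thesis using a by simp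
qed

text \<open>By \<open>g_ext_eq\<close> one has \<open>g\<^sub>c x = (b, b)\<inverse> x\<close> with \<open>b = \<lambda>\<^sub>x c\<close>, so the map \<open>g_tilde\<close> of \<open>a\<close>, in which
  \<open>\<lambda>\<^sub>x\<close> is undone first, is simply the action of \<open>(a, a)\<inverse>\<close>.\<close>

lemma perm_map_eq:
  assumes a: "a \<in> carrier G"
  shows "perm_map X r a = (structure_act (\<one>\<^bsub>GS\<^esub>, a), structure_act (a, a))"
proof -
  interpret T: brace_set GS G X structure_act iG r by (rule structure_brace_set)
  let ?i = "inv\<^bsub>G\<^esub> a"
  have i: "?i \<in> carrier G" using a by simp
  have "g_tilde X r a = structure_act (?i, ?i)"
  proof (rule extensionalityI[where A = X])
    fix x assume x: "x \<in> X"
    have l: "brace_lambda GS G (inv\<^bsub>G\<^esub> (iG x)) a \<in> carrier G" using T.lam_closed x a by simp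
    have "g_tilde X r a x = T.rho (brace_lambda GS G (inv\<^bsub>G\<^esub> (iG x)) a) x"
      using T.inv_into_lam[of "iG x" a] x a l by (simp add: g_tilde_def g_ext_eq)
    then show "g_tilde X r a x = structure_act (?i, ?i) x"
      using x a by (simp add: T.rho_def)
  qed (use structure_act_Bij[OF i i] in \<open>auto simp: g_tilde_def Bij_def\<close>)
  then have "inv\<^bsub>BijGroup X\<^esub> (g_tilde X r a) = structure_act (a, a)"
    using group_hom.hom_inv[OF group_action.group_hom[OF structure_action], of "(?i, ?i)"] a
      T.SD_inv_diagonal[of ?i] by simp
  then show ?thesis using a by (simp add: perm_map_def structure_act_one)
qed

end

section \<open>The permutation brace\<close>

context nondegenerate_yang_baxter
begin

abbreviation pm where "pm \<equiv> perm_map X r"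

lemma structure_act_hom: "structure_act \<in> hom (brace_semidirect GS G) (BijGroup X)"
  using group_hom.homh[OF group_action.group_hom[OF structure_action]] .

lemma pm_mult:
  assumes "a \<in> carrier G" "b \<in> carrier G"
  shows "pm (a \<otimes>\<^bsub>G\<^esub> b) = pm a \<otimes>\<^bsub>permutation_dot X r\<^esub> pm b"
proof -
  interpret B: skew_left_brace GS G by (rule structure_brace)
  have "structure_act (a \<otimes>\<^bsub>G\<^esub> b, a \<otimes>\<^bsub>G\<^esub> b) =
      structure_act (a, a) \<otimes>\<^bsub>BijGroup X\<^esub> structure_act (b, b)"
    using hom_mult[OF structure_act_hom, of "(a, a)" "(b, b)"] assms
    by (simp add: B.SD_diagonal del: B.SD_mult)
  then show ?thesis using assms
    by (simp add: perm_map_eq structure_act_one f_ext_mult permutation_dot_def DirProd_def)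
qed

lemma permutation_dot_carrier: "carrier (permutation_dot X r) = pm ` carrier G"
  by (simp add: permutation_dot_def)

lemma permutation_star_carrier: "carrier (permutation_star X r) = pm ` carrier G"
  by (simp add: permutation_star_def)

lemma pm_cancel:
  assumes "a \<in> carrier G" "b \<in> carrier G"
  shows "pm a = pm b \<longleftrightarrow> pm (inv\<^bsub>G\<^esub> a \<otimes>\<^bsub>G\<^esub> b) = pm \<one>\<^bsub>G\<^esub>"
proof
  assume "pm a = pm b"
  then have "pm (inv\<^bsub>G\<^esub> a \<otimes>\<^bsub>G\<^esub> b) = pm (inv\<^bsub>G\<^esub> a \<otimes>\<^bsub>G\<^esub> a)"
    using assms by (simp only: pm_mult G.inv_closed)
  then show "pm (inv\<^bsub>G\<^esub> a \<otimes>\<^bsub>G\<^esub> b) = pm \<one>\<^bsub>G\<^esub>" using assms by simp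
next
  assume e: "pm (inv\<^bsub>G\<^esub> a \<otimes>\<^bsub>G\<^esub> b) = pm \<one>\<^bsub>G\<^esub>"
  have "pm b = pm (a \<otimes>\<^bsub>G\<^esub> (inv\<^bsub>G\<^esub> a \<otimes>\<^bsub>G\<^esub> b))" using assms by (simp flip: G.m_assoc)
  also have "\<dots> = pm (a \<otimes>\<^bsub>G\<^esub> \<one>\<^bsub>G\<^esub>)"
    using assms e by (simp only: pm_mult G.inv_closed G.m_closed G.one_closed)
  finally show "pm a = pm b" using assms by simp
qed

text \<open>The kernel of \<open>perm_map\<close> lies in the socle of the structure brace: its elements act
  trivially by \<open>\<lambda>\<close> and are central for \<open>\<star>\<close>, because both can be tested on the generators, where
  they are fixed-point statements about \<open>X\<close>.\<close>

lemma kernel_socle: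
  assumes n: "n \<in> carrier G" and k: "pm n = pm \<one>\<^bsub>G\<^esub>"
  shows "c \<in> carrier A \<Longrightarrow> L n c = c"
    and "c \<in> carrier A \<Longrightarrow> phi n \<otimes>\<^bsub>A\<^esub> c = c \<otimes>\<^bsub>A\<^esub> phi n"
proof -
  have f: "f_ext X r n = \<one>\<^bsub>BijGroup X\<^esub>" and "structure_act (n, n) = structure_act (\<one>\<^bsub>G\<^esub>, \<one>\<^bsub>G\<^esub>)"
    using k n by (simp_all add: perm_map_eq structure_act_one f_ext_one)
  then have "A_act (phi n) = \<one>\<^bsub>BijGroup X\<^esub>"
    using n by (simp add: structure_act_def f_ext_one phi_eq cocycle_phi_one A_act_one)
  then have fixed: "phi n \<otimes>\<^bsub>A\<^esub> iA y \<otimes>\<^bsub>A\<^esub> inv\<^bsub>A\<^esub> (phi n) = iA y" if "y \<in> X" for y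
    using bspec[OF iA_A_act[of "phi n"] that] that n by simp
  show "L n c = c" if "c \<in> carrier A"
    using that n f by (simp add: lambda_eq) (simp add: A_map_f_ext_one flip: f_ext_one)
  show "phi n \<otimes>\<^bsub>A\<^esub> c = c \<otimes>\<^bsub>A\<^esub> phi n" if "c \<in> carrier A"
    using that
  proof (induction rule: A_induct)
    case one
    then show ?case using n by simp
  next
    case (gen y)
    have "phi n \<otimes>\<^bsub>A\<^esub> iA y \<otimes>\<^bsub>A\<^esub> inv\<^bsub>A\<^esub> (phi n) \<otimes>\<^bsub>A\<^esub> phi n = iA y \<otimes>\<^bsub>A\<^esub> phi n"
      using fixed[OF gen] by simp
    then show ?case using n gen by (simp add: A.m_assoc)
  next
    case (mult c d)
    then show ?case using n by (metis A.m_assoc cocycle.phi_closed)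
  next
    case (inv c)
    from A.conjugation_inv[OF inv.IH[symmetric]] show ?case using n inv.hyps by simp
  qed
qed

text \<open>The socle is an ideal: for \<open>n\<close> in it \<open>\<lambda>\<^sub>b n = b \<cdot> n \<cdot> b\<inverse>\<close>, because \<open>n\<close> acts trivially and \<open>\<lambda>\<^sub>b n\<close> is
  central. So the kernel, normal for \<open>\<cdot>\<close>, is stable under \<open>\<lambda>\<close>.\<close>

lemma kernel_lambda:
  assumes n: "n \<in> carrier G" "pm n = pm \<one>\<^bsub>G\<^esub>" and b: "b \<in> carrier G"
  shows "brace_lambda GS G b n \<in> carrier G" "pm (brace_lambda GS G b n) = pm \<one>\<^bsub>G\<^esub>"
proof -
  interpret B: skew_left_brace GS G by (rule structure_brace)
  show l: "brace_lambda GS G b n \<in> carrier G" using B.lam_closed[of b n] n b by simp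
  have central: "L b (phi n) \<otimes>\<^bsub>A\<^esub> c = c \<otimes>\<^bsub>A\<^esub> L b (phi n)" if c: "c \<in> carrier A" for c
  proof -
    define d where "d = L (inv\<^bsub>G\<^esub> b) c"
    have d: "d \<in> carrier A" "c = L b d" using c b by (simp_all add: d_def)
    show ?thesis using d n b kernel_socle(2)[OF n d(1)] by (simp flip: L_add)
  qed
  have "phi (b \<otimes>\<^bsub>G\<^esub> n \<otimes>\<^bsub>G\<^esub> inv\<^bsub>G\<^esub> b) = phi b \<otimes>\<^bsub>A\<^esub> (L b (phi n) \<otimes>\<^bsub>A\<^esub> L b (phi (inv\<^bsub>G\<^esub> b)))"
    using n b by (simp add: G.m_assoc cocycle.cocycle kernel_socle(1) L_add)
  also have "\<dots> = phi b \<otimes>\<^bsub>A\<^esub> L b (phi (inv\<^bsub>G\<^esub> b)) \<otimes>\<^bsub>A\<^esub> L b (phi n)"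
    using n b by (simp add: central A.m_assoc)
  also have "phi b \<otimes>\<^bsub>A\<^esub> L b (phi (inv\<^bsub>G\<^esub> b)) = \<one>\<^bsub>A\<^esub>"
    using cocycle.cocycle[of b "inv\<^bsub>G\<^esub> b"] b by (simp add: phi_GS_one)
  finally have "phi (brace_lambda GS G b n) = phi (b \<otimes>\<^bsub>G\<^esub> n \<otimes>\<^bsub>G\<^esub> inv\<^bsub>G\<^esub> b)"
    using n b by (simp add: phi_lambda)
  then have "brace_lambda GS G b n = b \<otimes>\<^bsub>G\<^esub> n \<otimes>\<^bsub>G\<^esub> inv\<^bsub>G\<^esub> b"
    by (rule cocycle.phi_eqD) (use l n b in simp_all)
  then have "pm (brace_lambda GS G b n) = pm (b \<otimes>\<^bsub>G\<^esub> \<one>\<^bsub>G\<^esub> \<otimes>\<^bsub>G\<^esub> inv\<^bsub>G\<^esub> b)"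
    using n b by (simp only: pm_mult G.m_closed G.inv_closed G.one_closed)
  then show "pm (brace_lambda GS G b n) = pm \<one>\<^bsub>G\<^esub>" using b by simp
qed

lemma GS_closed [simp]: "\<lbrakk>a \<in> carrier G; b \<in> carrier G\<rbrakk> \<Longrightarrow> a \<otimes>\<^bsub>GS\<^esub> b \<in> carrier G"
  using cocycle.transported_closed by (simp add: GS_eq)

lemma pm_star_kernel:
  assumes c: "c \<in> carrier G" and n: "n \<in> carrier G" "pm n = pm \<one>\<^bsub>G\<^esub>"
  shows "pm (c \<otimes>\<^bsub>GS\<^esub> n) = pm c"
proof -
  interpret B: skew_left_brace GS G by (rule structure_brace)
  have "c \<otimes>\<^bsub>GS\<^esub> n = c \<otimes>\<^bsub>G\<^esub> brace_lambda GS G (inv\<^bsub>G\<^esub> c) n" using B.star_dot[of c n] c n by simp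
  then have "pm (c \<otimes>\<^bsub>GS\<^esub> n) = pm (c \<otimes>\<^bsub>G\<^esub> \<one>\<^bsub>G\<^esub>)"
    using c kernel_lambda[OF n G.inv_closed[OF c]] by (simp only: pm_mult G.one_closed)
  then show ?thesis using c by simp
qed

text \<open>Two elements with the same image differ by \<open>\<star>\<close>-multiplication with an element of the kernel, and
  such elements are central.\<close>

lemma pm_star_cong:
  assumes c: "a \<in> carrier G" "a' \<in> carrier G" "b \<in> carrier G" "b' \<in> carrier G"
    and e: "pm a = pm a'" "pm b = pm b'"
  shows "pm (a \<otimes>\<^bsub>GS\<^esub> b) = pm (a' \<otimes>\<^bsub>GS\<^esub> b')"
proof -
  interpret B: skew_left_brace GS G by (rule structure_brace)
  have split: "\<exists>n. n \<in> carrier G \<and> pm n = pm \<one>\<^bsub>G\<^esub> \<and> a' = a \<otimes>\<^bsub>GS\<^esub> n"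
    if "a \<in> carrier G" "a' \<in> carrier G" "pm a = pm a'" for a a'
  proof -
    define m where "m = inv\<^bsub>G\<^esub> a \<otimes>\<^bsub>G\<^esub> a'"
    have m: "m \<in> carrier G" "pm m = pm \<one>\<^bsub>G\<^esub>" using that pm_cancel[of a a'] by (simp_all add: m_def)
    have "a' = a \<otimes>\<^bsub>G\<^esub> m" using that by (simp add: m_def flip: G.m_assoc)
    also have "\<dots> = a \<otimes>\<^bsub>GS\<^esub> brace_lambda GS G a m" using B.dot_lam[of a m] that m by simp
    finally show ?thesis using kernel_lambda[OF m that(1)] by blast
  qed
  obtain n where n: "n \<in> carrier G" "pm n = pm \<one>\<^bsub>G\<^esub>" "a' = a \<otimes>\<^bsub>GS\<^esub> n" using split[OF c(1,2) e(1)] by blast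
  obtain m where m: "m \<in> carrier G" "pm m = pm \<one>\<^bsub>G\<^esub>" "b' = b \<otimes>\<^bsub>GS\<^esub> m" using split[OF c(3,4) e(2)] by blast
  have nb: "n \<otimes>\<^bsub>GS\<^esub> b = b \<otimes>\<^bsub>GS\<^esub> n"
    by (rule cocycle.phi_eqD) (use n c kernel_socle(2)[OF n(1,2), of "phi b"] in \<open>simp_all add: phi_GS\<close>)
  have "a' \<otimes>\<^bsub>GS\<^esub> b' = a \<otimes>\<^bsub>GS\<^esub> (n \<otimes>\<^bsub>GS\<^esub> b) \<otimes>\<^bsub>GS\<^esub> m"
    using n m c by (simp add: B.star.m_assoc)
  also have "\<dots> = a \<otimes>\<^bsub>GS\<^esub> b \<otimes>\<^bsub>GS\<^esub> n \<otimes>\<^bsub>GS\<^esub> m"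
    using n m c by (simp add: nb B.star.m_assoc)
  finally have "pm (a' \<otimes>\<^bsub>GS\<^esub> b') = pm (a \<otimes>\<^bsub>GS\<^esub> b \<otimes>\<^bsub>GS\<^esub> n \<otimes>\<^bsub>GS\<^esub> m)" by simp
  then show ?thesis using n m c by (simp add: pm_star_kernel)
qed

lemma pm_star:
  assumes "a \<in> carrier G" "b \<in> carrier G"
  shows "pm (a \<otimes>\<^bsub>GS\<^esub> b) = pm a \<otimes>\<^bsub>permutation_star X r\<^esub> pm b"
proof -
  have "{pm (a' \<otimes>\<^bsub>GS\<^esub> b') |a' b'. a' \<in> carrier G \<and> b' \<in> carrier G \<and> pm a' = pm a \<and> pm b' = pm b}
      = {pm (a \<otimes>\<^bsub>GS\<^esub> b)}"
    using assms pm_star_cong by blast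
  then show ?thesis by (simp add: permutation_star_def)
qed

text \<open>The action depends only on the images in the permutation group since
  \<open>(a, b) = (a, a)(1, a\<inverse> \<cdot> b)\<close>.\<close>

lemma structure_act_pm:
  assumes "a \<in> carrier G" "b \<in> carrier G"
  shows "structure_act (a, b) =
    snd (pm a) \<otimes>\<^bsub>BijGroup X\<^esub> (inv\<^bsub>BijGroup X\<^esub> (fst (pm a)) \<otimes>\<^bsub>BijGroup X\<^esub> fst (pm b))"
proof -
  interpret B: skew_left_brace GS G by (rule structure_brace)
  have "(a, b) = (a, a) \<otimes>\<^bsub>brace_semidirect GS G\<^esub> (\<one>\<^bsub>GS\<^esub>, inv\<^bsub>G\<^esub> a \<otimes>\<^bsub>G\<^esub> b)"
    using assms B.star.r_one[of a] B.lam_one_right[of a] by (simp flip: G.m_assoc)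
  then have "structure_act (a, b) = structure_act (a, a) \<otimes>\<^bsub>BijGroup X\<^esub> structure_act (\<one>\<^bsub>GS\<^esub>, inv\<^bsub>G\<^esub> a \<otimes>\<^bsub>G\<^esub> b)"
    using hom_mult[OF structure_act_hom, of "(a, a)" "(\<one>\<^bsub>GS\<^esub>, inv\<^bsub>G\<^esub> a \<otimes>\<^bsub>G\<^esub> b)"] assms B.star.one_closed
    by (simp del: B.SD_mult)
  then show ?thesis using assms by (simp add: perm_map_eq structure_act_one f_ext_mult f_ext_inv)
qed

end

context brace_set
begin

lemma act_mult: "\<lbrakk>g \<in> C \<times> C; h \<in> C \<times> C\<rbrakk> \<Longrightarrow> act (g \<otimes>\<^bsub>SD\<^esub> h) = act g \<otimes>\<^bsub>BijGroup X\<^esub> act h"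
  using group_hom.hom_mult[OF group_action.group_hom[OF action]] by simp

lemma act_Bij' [simp]: "\<lbrakk>a \<in> C; b \<in> C\<rbrakk> \<Longrightarrow> act (a, b) \<in> Bij X"
  by (simp add: act_Bij)

text \<open>The relations of the structure group hold for the points \<open>p x\<close> in \<open>(B, \<cdot>)\<close> and those of the derived
  group hold in \<open>(B, \<star>)\<close>. The two resulting homomorphisms correspond to each other under the cocycle
  because both intertwine \<open>\<lambda>\<close>, so \<open>\<pi>\<close> respects both operations.\<close>

theorem structure_brace_hom:
  "\<exists>\<pi>. \<pi> \<in> hom (structure_star X r) S \<and> \<pi> \<in> hom (structure_group X r) D \<and>
    (\<forall>x\<in>X. \<pi> (gen_G X r x) = p x) \<and>
    (\<forall>a\<in>carrier (structure_group X r). perm_map X r a = (act (\<one>\<^bsub>S\<^esub>, \<pi> a), act (\<pi> a, \<pi> a)))"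
proof -
  interpret N: nondegenerate_yang_baxter X r by (rule nondegenerate_yang_baxter.intro[OF induced_nondegenerate])
  interpret T: brace_set N.GS N.G X N.structure_act N.iG r by (rule N.structure_brace_set)
  have "\<exists>h. h \<in> extensional (carrier N.G) \<and> h \<in> hom N.G D \<and> (\<forall>x\<in>X. h (N.iG x) = p x)"
    by (rule N.structure_lift[OF dot.is_group])
      (simp_all add: carrier_eq sol_f_eq sol_g_eq p_product)
  then obtain \<pi> where \<pi>: "\<pi> \<in> hom N.G D" and gen: "\<And>x. x \<in> X \<Longrightarrow> \<pi> (N.iG x) = p x" by blast
  have \<pi>c [simp]: "\<pi> a \<in> C" if "a \<in> carrier N.G" for a
    using hom_in_carrier[OF \<pi> that] by (simp add: carrier_eq)
  have \<pi>m: "\<pi> (a \<otimes>\<^bsub>N.G\<^esub> b) = \<pi> a \<otimes>\<^bsub>D\<^esub> \<pi> b" if "a \<in> carrier N.G" "b \<in> carrier N.G" for a b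
    using hom_mult[OF \<pi> that] .
  have F: "act (\<one>\<^bsub>S\<^esub>, \<pi> a) = f_ext X r a" if a: "a \<in> carrier N.G" for a
  proof (rule N.G_hom_eqI[OF group_BijGroup _ N.f_ext_hom _ a])
    show "(\<lambda>a. act (\<one>\<^bsub>S\<^esub>, \<pi> a)) \<in> hom N.G (BijGroup X)"
      by (rule homI) (simp_all add: \<pi>m flip: act_mult)
    show "act (\<one>\<^bsub>S\<^esub>, \<pi> (N.iG x)) = f_ext X r (N.iG x)" if "x \<in> X" for x
      by (rule Bij_eqI[where X = X]) (use that in \<open>simp_all add: gen sol_f_eq\<close>)
  qed
  have E: "act (\<pi> a, \<pi> a) = N.structure_act (a, a)" if a: "a \<in> carrier N.G" for a
  proof (rule N.G_hom_eqI[OF group_BijGroup _ _ _ a])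
    show "(\<lambda>a. act (\<pi> a, \<pi> a)) \<in> hom N.G (BijGroup X)"
      by (rule homI) (simp_all add: \<pi>m SD_diagonal del: SD_mult flip: act_mult)
    show "(\<lambda>a. N.structure_act (a, a)) \<in> hom N.G (BijGroup X)"
      by (rule homI) (simp_all add: T.SD_diagonal del: T.SD_mult flip: T.act_mult)
    fix u assume u: "u \<in> X"
    have "act (p u, p u) w = N.structure_act (N.iG u, N.iG u) w" if w: "w \<in> X" for w
    proof -
      define x where "x = N.structure_act (N.iG u, N.iG u) w"
      have x: "x \<in> X" using u w by (simp add: x_def)
      define y where "y = N.f_inv x u"
      have y: "y \<in> X" "N.f x y = u" using x u by (simp_all add: y_def)
      have "act (inv\<^bsub>D\<^esub> (p u), inv\<^bsub>D\<^esub> (p u)) x = N.g y x"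
        using r_eq[OF x y(1)] sol_f_eq[OF x y(1)] y by (simp add: N.r_eq Let_def)
      also have "\<dots> = w"
        using T.r_eq[OF x y(1)] T.sol_f_eq[OF x y(1)] y u w by (simp add: N.r_eq Let_def x_def)
      finally have "act (p u, p u) w = x" using u x E_inv_cancel(2)[of "p u" x] by simp
      then show ?thesis by (simp add: x_def)
    qed
    then show "act (\<pi> (N.iG u), \<pi> (N.iG u)) = N.structure_act (N.iG u, N.iG u)"
      using u by (intro Bij_eqI[where X = X]) (simp_all add: gen)
  qed
  have "\<exists>h. h \<in> extensional (carrier N.A) \<and> h \<in> hom N.A S \<and> (\<forall>x\<in>X. h (N.iA x) = p x)"
  proof (rule N.derived_lift[OF star.is_group])
    fix x z assume xz: "x \<in> X" "z \<in> X"
    define y where "y = N.f_inv x z"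
    have y: "y \<in> X" "F (p x) y = z" using xz by (simp_all add: y_def flip: sol_f_eq)
    have "p z \<otimes>\<^bsub>S\<^esub> p (N.s z x) = p z \<otimes>\<^bsub>D\<^esub> p (rho (p y) x)"
      using xz y by (simp add: N.s_def sol_f_eq sol_g_eq p_F dot_lam flip: y_def)
    also have "\<dots> = p x \<otimes>\<^bsub>D\<^esub> p y" using p_product[of x y] xz y by simp
    also have "\<dots> = p x \<otimes>\<^bsub>S\<^esub> p z" using p_F[of "p x" y] xz y by (simp add: dot_lam)
    finally show "p x \<otimes>\<^bsub>S\<^esub> p z = p z \<otimes>\<^bsub>S\<^esub> p (N.s z x)" by simp
  qed simp
  then obtain \<alpha> where \<alpha>: "\<alpha> \<in> hom N.A S" and \<alpha>gen: "\<And>x. x \<in> X \<Longrightarrow> \<alpha> (N.iA x) = p x" by blast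
  have \<alpha>c [simp]: "\<alpha> c \<in> C" if "c \<in> carrier N.A" for c using hom_in_carrier[OF \<alpha> that] .
  have \<alpha>L: "\<alpha> (N.L a c) = lam (\<pi> a) (\<alpha> c)" if a: "a \<in> carrier N.G" and c: "c \<in> carrier N.A" for a c
  proof -
    have "(\<alpha> \<circ> N.L a) c = (\<lambda>c. lam (\<pi> a) (\<alpha> c)) c"
    proof (rule N.A_hom_eqI[OF star.is_group _ _ _ c])
      show "\<alpha> \<circ> N.L a \<in> hom N.A S"
        using N.L_auto[OF a] \<alpha> by (intro hom_compose[of _ N.A N.A]) (simp_all add: auto_def)
      show "(\<lambda>c. lam (\<pi> a) (\<alpha> c)) \<in> hom N.A S"
        by (rule homI) (use a in \<open>simp_all add: hom_mult[OF \<alpha>] lam_star\<close>)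
      show "(\<alpha> \<circ> N.L a) (N.iA x) = lam (\<pi> a) (\<alpha> (N.iA x))" if "x \<in> X" for x
        using that a by (simp add: N.L_iA \<alpha>gen p_F flip: F)
    qed
    then show ?thesis by simp
  qed
  have \<alpha>phi: "\<alpha> (N.phi a) = \<pi> a" if "a \<in> carrier N.G" for a
    using that
  proof (induction rule: N.G_induct)
    case one
    then show ?case
      using hom_one[OF \<alpha> N.A.is_group star.is_group] hom_one[OF \<pi> N.G.is_group dot.is_group]
      by (simp add: N.phi_GS_one)
  next
    case (gen x)
    then show ?case by (simp add: \<alpha>gen \<open>\<And>x. x \<in> X \<Longrightarrow> \<pi> (N.iG x) = p x\<close>)
  next
    case (mult a b)
    then show ?case by (simp add: N.cocycle.cocycle hom_mult[OF \<alpha>] \<alpha>L \<pi>m dot_lam)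
  next
    case (inv a)
    have 1: "\<pi> (inv\<^bsub>N.G\<^esub> a) = inv\<^bsub>D\<^esub> (\<pi> a)"
      using group_hom.hom_inv[OF group_hom.intro[OF N.G.is_group dot.is_group group_hom_axioms.intro[OF \<pi>]]] inv.hyps .
    have "\<alpha> (N.phi (a \<otimes>\<^bsub>N.G\<^esub> inv\<^bsub>N.G\<^esub> a)) = \<one>\<^bsub>S\<^esub>"
      using inv.hyps hom_one[OF \<alpha> N.A.is_group star.is_group] by (simp add: N.phi_GS_one)
    moreover have "\<alpha> (N.phi (a \<otimes>\<^bsub>N.G\<^esub> inv\<^bsub>N.G\<^esub> a)) = \<pi> a \<otimes>\<^bsub>S\<^esub> lam (\<pi> a) (\<alpha> (N.phi (inv\<^bsub>N.G\<^esub> a)))"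
      using inv by (simp only: N.cocycle.cocycle hom_mult[OF \<alpha>] \<alpha>L N.G.inv_closed N.cocycle.phi_closed N.L_closed)
    ultimately have "\<pi> a \<otimes>\<^bsub>D\<^esub> \<alpha> (N.phi (inv\<^bsub>N.G\<^esub> a)) = \<one>\<^bsub>S\<^esub>"
      using inv.hyps by (simp add: dot_lam)
    then have "inv\<^bsub>D\<^esub> (\<pi> a) \<otimes>\<^bsub>D\<^esub> (\<pi> a \<otimes>\<^bsub>D\<^esub> \<alpha> (N.phi (inv\<^bsub>N.G\<^esub> a))) = inv\<^bsub>D\<^esub> (\<pi> a)"
      using inv.hyps by simp
    then show ?case using inv.hyps 1 by simp
  qed
  have "\<pi> \<in> hom N.GS S"
  proof (rule homI)
    show "\<pi> (a \<otimes>\<^bsub>N.GS\<^esub> b) = \<pi> a \<otimes>\<^bsub>S\<^esub> \<pi> b" if "a \<in> carrier N.GS" "b \<in> carrier N.GS" for a b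
      using that by (simp add: N.phi_GS hom_mult[OF \<alpha>] flip: \<alpha>phi)
  qed simp
  then show ?thesis
    using \<pi> gen by (intro exI[of _ \<pi>]) (simp add: N.perm_map_eq F E N.structure_act_one)
qed

text \<open>The morphism \<open>\<pi>\<close> of \<open>structure_brace_hom\<close> is onto because \<open>p X\<close> generates, and it has the same
  kernel as \<open>perm_map\<close> because of faithfulness.\<close>

theorem permutation_brace_isomorphic:
  assumes generating: "generate S (p ` X) = carrier S"
    and faithful: "\<And>b. \<lbrakk>b \<in> carrier S; \<forall>x\<in>X. act (\<one>\<^bsub>S\<^esub>, b) x = x; \<forall>x\<in>X. act (b, b) x = x\<rbrakk> \<Longrightarrow> b = \<one>\<^bsub>S\<^esub>"
  shows "brace_isomorphic (permutation_star X r) (permutation_dot X r) S D"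
proof -
  interpret N: nondegenerate_yang_baxter X r by (rule nondegenerate_yang_baxter.intro[OF induced_nondegenerate])
  interpret T: brace_set N.GS N.G X N.structure_act N.iG r by (rule N.structure_brace_set)
  obtain \<pi> where \<pi>S: "\<pi> \<in> hom N.GS S" and \<pi>D: "\<pi> \<in> hom N.G D" and gen: "\<forall>x\<in>X. \<pi> (N.iG x) = p x"
    and pm: "\<forall>a\<in>carrier N.G. N.pm a = (act (\<one>\<^bsub>S\<^esub>, \<pi> a), act (\<pi> a, \<pi> a))"
    using structure_brace_hom by blast
  have \<pi>c [simp]: "\<pi> a \<in> C" if "a \<in> carrier N.G" for a
    using hom_in_carrier[OF \<pi>S] that by simp
  have inj: "\<pi> a = \<pi> b" if c: "a \<in> carrier N.G" "b \<in> carrier N.G" and e: "N.pm a = N.pm b" for a b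
  proof -
    define c where "c = inv\<^bsub>D\<^esub> (\<pi> a) \<otimes>\<^bsub>D\<^esub> \<pi> b"
    have cC: "c \<in> C" using c by (simp add: c_def)
    have "act (\<one>\<^bsub>S\<^esub>, \<pi> a) = act (\<one>\<^bsub>S\<^esub>, \<pi> b)" "act (\<pi> a, \<pi> a) = act (\<pi> b, \<pi> b)"
      using e pm c by simp_all
    then have "\<forall>x\<in>X. act (\<one>\<^bsub>S\<^esub>, c) x = x" "\<forall>x\<in>X. act (c, c) x = x"
      using c by (simp_all add: c_def F_comp E_comp flip: \<open>act (\<one>\<^bsub>S\<^esub>, \<pi> a) = _\<close> \<open>act (\<pi> a, \<pi> a) = _\<close>)
    then have "c = \<one>\<^bsub>S\<^esub>" by (rule faithful[OF cC])
    then have "\<pi> a \<otimes>\<^bsub>D\<^esub> c = \<pi> a" using c by simp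
    then show ?thesis using c by (simp add: c_def)
  qed
  have surj: "\<pi> ` carrier N.G = C"
  proof
    have "subgroup (\<pi> ` carrier N.GS) S"
      using group_hom.img_is_subgroup[OF group_hom.intro[OF T.star.is_group star.is_group group_hom_axioms.intro[OF \<pi>S]]] .
    moreover have "p ` X \<subseteq> \<pi> ` carrier N.GS"
    proof (rule image_subsetI)
      show "p x \<in> \<pi> ` carrier N.GS" if "x \<in> X" for x
        using gen that by (intro image_eqI[of _ _ "N.iG x"]) simp_all
    qed
    ultimately show "C \<subseteq> \<pi> ` carrier N.G"
      using star.generate_subgroup_incl[of "p ` X" "\<pi> ` carrier N.GS"] by (simp add: generating)
  qed auto
  define h where "h q = \<pi> (SOME a. a \<in> carrier N.G \<and> N.pm a = q)" for q
  have h: "h (N.pm a) = \<pi> a" if a: "a \<in> carrier N.G" for a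
  proof -
    have "\<exists>b. b \<in> carrier N.G \<and> N.pm b = N.pm a" using a by blast
    from someI_ex[OF this] show ?thesis unfolding h_def using inj a by blast
  qed
  have bij: "bij_betw h (N.pm ` carrier N.G) C"
  proof (rule bij_betw_imageI)
    show "inj_on h (N.pm ` carrier N.G)" 
    proof (rule inj_onI)
      fix q q' assume "q \<in> N.pm ` carrier N.G" "q' \<in> N.pm ` carrier N.G" and e: "h q = h q'"
      then obtain a b where ab: "a \<in> carrier N.G" "b \<in> carrier N.G" and q: "q = N.pm a" "q' = N.pm b"
        by blast
      have "\<pi> a = \<pi> b" using e ab by (simp add: q h)
      then have "N.pm a = N.pm b" using bspec[OF pm ab(1)] bspec[OF pm ab(2)] by simp
      then show "q = q'" by (simp add: q)
    qed
    show "h ` N.pm ` carrier N.G = C" using surj by (simp add: image_image h)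
  qed
  have "h \<in> hom (permutation_star X r) S"
    by (rule homI) (auto simp: N.permutation_star_carrier h hom_mult[OF \<pi>S] simp flip: N.pm_star)
  moreover have "h \<in> hom (permutation_dot X r) D"
    by (rule homI) (auto simp: N.permutation_dot_carrier carrier_eq h hom_mult[OF \<pi>D] simp flip: N.pm_mult)
  ultimately show ?thesis
    unfolding brace_isomorphic_def iso_def using bij
    by (auto simp: N.permutation_star_carrier N.permutation_dot_carrier carrier_eq)
qed

end

context nondegenerate_yang_baxter
begin

text \<open>An isomorphism with the permutation brace gives a brace morphism \<open>\<pi>\<close> from the structure brace onto
  \<open>B\<close> with the same kernel as \<open>perm_map\<close>. By \<open>structure_act_pm\<close> the action of the structure
  brace on \<open>X\<close> is constant on the fibres of \<open>\<pi>\<close> and descends to \<open>B\<close>.\<close>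

theorem permutation_brace_set:
  assumes "skew_left_brace S D"
    and "brace_isomorphic (permutation_star X r) (permutation_dot X r) S D"
  shows "\<exists>act p. brace_set S D X act p r \<and> generate S (p ` X) = carrier S \<and>
    (\<forall>b\<in>carrier S. (\<forall>x\<in>X. act (\<one>\<^bsub>S\<^esub>, b) x = x) \<and> (\<forall>x\<in>X. act (b, b) x = x) \<longrightarrow> b = \<one>\<^bsub>S\<^esub>)"
proof -
  interpret T: brace_set GS G X structure_act iG r by (rule structure_brace_set)
  interpret B: skew_left_brace S D by fact
  obtain h where hS: "h \<in> iso (permutation_star X r) S" and hD: "h \<in> iso (permutation_dot X r) D"
    using assms(2) by (auto simp: brace_isomorphic_def)
  define \<pi> where "\<pi> a = h (pm a)" for a
  have hbij: "bij_betw h (pm ` carrier G) (carrier S)"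
    using hS by (simp add: iso_def permutation_star_carrier)
  have \<pi>S: "\<pi> \<in> hom GS S"
  proof (rule homI)
    show "\<pi> (a \<otimes>\<^bsub>GS\<^esub> b) = \<pi> a \<otimes>\<^bsub>S\<^esub> \<pi> b" if "a \<in> carrier GS" "b \<in> carrier GS" for a b
      using that hS by (auto simp: iso_def hom_def \<pi>_def pm_star permutation_star_carrier)
  qed (use hbij in \<open>auto simp: \<pi>_def bij_betw_def\<close>)
  have \<pi>D: "\<pi> \<in> hom G D"
  proof (rule homI)
    show "\<pi> (a \<otimes>\<^bsub>G\<^esub> b) = \<pi> a \<otimes>\<^bsub>D\<^esub> \<pi> b" if "a \<in> carrier G" "b \<in> carrier G" for a b
      using that hD by (auto simp: iso_def hom_def \<pi>_def pm_mult permutation_dot_carrier)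
  qed (use hbij in \<open>auto simp: \<pi>_def bij_betw_def B.carrier_eq\<close>)
  have \<pi>c [simp]: "\<pi> a \<in> carrier S" if "a \<in> carrier G" for a
    using hom_in_carrier[OF \<pi>S] that by simp
  have \<pi>m: "\<pi> (a \<otimes>\<^bsub>GS\<^esub> b) = \<pi> a \<otimes>\<^bsub>S\<^esub> \<pi> b" "\<pi> (a \<otimes>\<^bsub>G\<^esub> b) = \<pi> a \<otimes>\<^bsub>D\<^esub> \<pi> b"
    if "a \<in> carrier G" "b \<in> carrier G" for a b
    using hom_mult[OF \<pi>S] hom_mult[OF \<pi>D] that by simp_all
  have \<pi>1: "\<pi> \<one>\<^bsub>GS\<^esub> = \<one>\<^bsub>S\<^esub>" using hom_one[OF \<pi>S T.star.is_group B.star.is_group] .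
  have \<pi>i: "\<pi> (inv\<^bsub>GS\<^esub> a) = inv\<^bsub>S\<^esub> (\<pi> a)" "\<pi> (inv\<^bsub>G\<^esub> a) = inv\<^bsub>D\<^esub> (\<pi> a)" if "a \<in> carrier G" for a
    using group_hom.hom_inv[OF group_hom.intro[OF T.star.is_group B.star.is_group group_hom_axioms.intro[OF \<pi>S]]]
      group_hom.hom_inv[OF group_hom.intro[OF G.is_group B.dot.is_group group_hom_axioms.intro[OF \<pi>D]]]
      that by simp_all
  have ic: "inv\<^bsub>GS\<^esub> a \<in> carrier G" if "a \<in> carrier G" for a using T.star.inv_closed that by simp
  have lc: "brace_lambda GS G a b \<in> carrier G" if "a \<in> carrier G" "b \<in> carrier G" for a b
    using T.lam_closed that by simp
  have \<pi>l: "\<pi> (brace_lambda GS G a b) = brace_lambda S D (\<pi> a) (\<pi> b)"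
    if "a \<in> carrier G" "b \<in> carrier G" for a b
    using that by (simp add: T.lam_eq B.lam_eq \<pi>m \<pi>i ic)
  have \<pi>_eq: "\<pi> a = \<pi> b \<longleftrightarrow> pm a = pm b" if "a \<in> carrier G" "b \<in> carrier G" for a b
    using hbij that by (auto simp: \<pi>_def bij_betw_def inj_on_eq_iff)
  have surj: "\<exists>a\<in>carrier G. b = \<pi> a" if "b \<in> carrier S" for b
    using hbij that by (auto simp: bij_betw_def \<pi>_def)
  have surj_pair: "\<exists>a b. g = (\<pi> a, \<pi> b) \<and> a \<in> carrier G \<and> b \<in> carrier G"
    if g: "g \<in> carrier (brace_semidirect S D)" for g
  proof -
    obtain u v where uv: "g = (u, v)" "u \<in> carrier S" "v \<in> carrier S" using g by auto
    then show ?thesis using surj[OF uv(2)] surj[OF uv(3)] by blast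
  qed
  define \<sigma> where "\<sigma> b = (SOME a. a \<in> carrier G \<and> b = \<pi> a)" for b
  have \<sigma>: "\<sigma> b \<in> carrier G" "\<pi> (\<sigma> b) = b" if "b \<in> carrier S" for b
  proof -
    have "\<exists>a. a \<in> carrier G \<and> b = \<pi> a" using surj[OF that] by blast
    from someI_ex[OF this] show "\<sigma> b \<in> carrier G" "\<pi> (\<sigma> b) = b" by (simp_all add: \<sigma>_def)
  qed
  define act where "act = (\<lambda>(a, b). structure_act (\<sigma> a, \<sigma> b))"
  have act: "act (\<pi> a, \<pi> b) = structure_act (a, b)" if "a \<in> carrier G" "b \<in> carrier G" for a b
  proof -
    have "pm (\<sigma> (\<pi> a)) = pm a" "pm (\<sigma> (\<pi> b)) = pm b" using that \<sigma> by (simp_all flip: \<pi>_eq)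
    then show ?thesis using that \<sigma> by (simp add: act_def structure_act_pm)
  qed
  have act_hom: "act \<in> hom (brace_semidirect S D) (BijGroup X)"
  proof (rule homI)
    fix g k assume gk: "g \<in> carrier (brace_semidirect S D)" "k \<in> carrier (brace_semidirect S D)"
    obtain a b a' b' where e: "g = (\<pi> a, \<pi> b)" "k = (\<pi> a', \<pi> b')"
      and c: "a \<in> carrier G" "b \<in> carrier G" "a' \<in> carrier G" "b' \<in> carrier G"
      using surj_pair[OF gk(1)] surj_pair[OF gk(2)] by blast
    have "g \<otimes>\<^bsub>brace_semidirect S D\<^esub> k = (\<pi> (a \<otimes>\<^bsub>GS\<^esub> brace_lambda GS G b a'), \<pi> (b \<otimes>\<^bsub>G\<^esub> b'))"
      using c lc by (simp add: e \<pi>m \<pi>l)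
    then have "act (g \<otimes>\<^bsub>brace_semidirect S D\<^esub> k) =
        structure_act ((a, b) \<otimes>\<^bsub>brace_semidirect GS G\<^esub> (a', b'))"
      using c lc by (simp add: act)
    then show "act (g \<otimes>\<^bsub>brace_semidirect S D\<^esub> k) = act g \<otimes>\<^bsub>BijGroup X\<^esub> act k"
      using c by (simp add: T.act_mult e act del: T.SD_mult)
  qed (auto simp: act_def \<sigma>)
  have bs: "brace_set S D X act (\<lambda>x. \<pi> (iG x)) r"
  proof (intro brace_set.intro brace_set_axioms.intro assms(1))
    show "X \<noteq> {}" by (rule T.nonempty)
    show "group_action (brace_semidirect S D) X act"
      by (intro group_action.intro group_hom.intro group_hom_axioms.intro B.SD_group SymX.is_group act_hom)
    show "\<pi> (iG x) \<in> carrier S" if "x \<in> X" for x using that by simp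
    show "\<pi> (iG (act g x)) = brace_Theta S D g (\<pi> (iG x))"
      if g: "g \<in> carrier (brace_semidirect S D)" and x: "x \<in> X" for g x
    proof -
      obtain a b where e: "g = (\<pi> a, \<pi> b)" and c: "a \<in> carrier G" "b \<in> carrier G"
        using surj_pair[OF g] by blast
      show ?thesis using c x lc
        by (simp add: e act iG_structure_act T.Theta_eq B.Theta_eq \<pi>m \<pi>i \<pi>l ic)
    qed
    fix x y assume xy: "x \<in> X" "y \<in> X"
    have "act (\<one>\<^bsub>S\<^esub>, \<pi> (iG x)) = structure_act (\<one>\<^bsub>GS\<^esub>, iG x)"
      using act[of "\<one>\<^bsub>GS\<^esub>" "iG x"] xy T.star.one_closed by (simp add: \<pi>1)
    moreover have "act (inv\<^bsub>D\<^esub> (\<pi> (iG u)), inv\<^bsub>D\<^esub> (\<pi> (iG u))) = structure_act (inv\<^bsub>G\<^esub> (iG u), inv\<^bsub>G\<^esub> (iG u))"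
      if "u \<in> X" for u
      using act[of "inv\<^bsub>G\<^esub> (iG u)" "inv\<^bsub>G\<^esub> (iG u)"] that by (simp add: \<pi>i)
    ultimately show "r (x, y) = (let u = act (\<one>\<^bsub>S\<^esub>, \<pi> (iG x)) y in
        (u, act (inv\<^bsub>D\<^esub> (\<pi> (iG u)), inv\<^bsub>D\<^esub> (\<pi> (iG u))) x))"
      using xy T.r_eq[OF xy] by (simp add: Let_def structure_act_one)
  qed
  \<comment> \<open>Generation is proved in the group \<open>A\<close>, where \<open>\<star>\<close> is the operation and \<open>X\<close> generates.\<close>
  have "\<pi> (inv_into (carrier G) phi c) \<in> generate S ((\<lambda>x. \<pi> (iG x)) ` X)" (is "_ \<in> ?gen")
    if "c \<in> carrier A" for c
    using that
  proof (induction rule: A_induct)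
    case one
    have "inv_into (carrier G) phi \<one>\<^bsub>A\<^esub> = \<one>\<^bsub>GS\<^esub>" by (simp add: structure_star_def)
    then show ?case using generate.one[of S] by (simp add: \<pi>1)
  next
    case (gen x)
    have "inv_into (carrier G) phi (iA x) = iG x"
      using inv_into_f_f[OF bij_betw_imp_inj_on[OF cocycle.bij], of "iG x"] gen by simp
    then show ?case using gen by (auto intro: generate.incl)
  next
    case (mult c d)
    have "inv_into (carrier G) phi (c \<otimes>\<^bsub>A\<^esub> d) = inv_into (carrier G) phi c \<otimes>\<^bsub>GS\<^esub> inv_into (carrier G) phi d"
      using mult.hyps by (simp add: structure_star_def cocycle.inv_phi)
    then show ?case using mult generate.eng[OF mult.IH] by (simp add: \<pi>m cocycle.inv_phi)
  next
    case (inv c)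
    have "inv_into (carrier G) phi (inv\<^bsub>A\<^esub> c) = inv\<^bsub>GS\<^esub> (inv_into (carrier G) phi c)"
      by (rule cocycle.phi_eqD) (use inv.hyps in \<open>simp_all add: cocycle.inv_phi phi_GS_inv ic\<close>)
    then show ?case
      using inv B.star.generate_m_inv_closed[OF _ inv.IH] by (simp add: \<pi>i cocycle.inv_phi image_subset_iff)
  qed
  then have in_gen: "\<pi> a \<in> ?gen" if "a \<in> carrier G" for a
    using that inv_into_f_f[OF bij_betw_imp_inj_on[OF cocycle.bij], of a] cocycle.phi_closed[of a] by metis
  have "?gen = carrier S"
  proof
    show "?gen \<subseteq> carrier S" by (rule B.star.generate_incl) auto
    show "carrier S \<subseteq> ?gen" using in_gen surj by blast
  qed
  moreover have "b = \<one>\<^bsub>S\<^esub>"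
    if b: "b \<in> carrier S" and "\<forall>x\<in>X. act (\<one>\<^bsub>S\<^esub>, b) x = x" "\<forall>x\<in>X. act (b, b) x = x" for b
  proof -
    obtain a where a: "a \<in> carrier G" "b = \<pi> a" using surj[OF b] by blast
    have o: "\<one>\<^bsub>GS\<^esub> \<in> carrier G" using T.star.one_closed by simp
    have "act (\<one>\<^bsub>S\<^esub>, b) = structure_act (\<one>\<^bsub>GS\<^esub>, a)" "act (b, b) = structure_act (a, a)"
      using act[of "\<one>\<^bsub>GS\<^esub>" a] act[of a a] a o by (simp_all add: \<pi>1)
    then have "structure_act (\<one>\<^bsub>GS\<^esub>, a) = structure_act (\<one>\<^bsub>GS\<^esub>, \<one>\<^bsub>GS\<^esub>)" "structure_act (a, a) = structure_act (\<one>\<^bsub>GS\<^esub>, \<one>\<^bsub>GS\<^esub>)"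
      using that a o by (auto intro!: Bij_eqI[where X = X])
    then have "pm a = pm \<one>\<^bsub>GS\<^esub>" using a o by (simp add: perm_map_eq)
    then show ?thesis using a o \<pi>_eq[of a "\<one>\<^bsub>GS\<^esub>"] \<pi>1 by simp
  qed
  ultimately show ?thesis using bs by blast
qed

end

section \<open>Coset spaces\<close>

lemma (in group) group_core_iff:
  assumes "subgroup H G"
  shows "x \<in> group_core G H \<longleftrightarrow> x \<in> carrier G \<and> (\<forall>g\<in>carrier G. inv g \<otimes> x \<otimes> g \<in> H)"
proof -
  have H: "H \<subseteq> carrier G" using assms by (rule subgroup.subset)
  have "x \<in> (g <# H) #> inv g \<longleftrightarrow> x \<in> carrier G \<and> inv g \<otimes> x \<otimes> g \<in> H" if g: "g \<in> carrier G" for g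
  proof
    assume "x \<in> (g <# H) #> inv g"
    then obtain k where k: "k \<in> H" "x = g \<otimes> k \<otimes> inv g" by (auto simp: l_coset_def r_coset_def)
    have kc: "k \<in> carrier G" using k H by blast
    have "inv g \<otimes> x \<otimes> g = k" using g kc by (simp add: k(2) m_assoc) (simp flip: m_assoc)
    then show "x \<in> carrier G \<and> inv g \<otimes> x \<otimes> g \<in> H" using k g kc by simp
  next
    assume x: "x \<in> carrier G \<and> inv g \<otimes> x \<otimes> g \<in> H"
    then have "x = g \<otimes> (inv g \<otimes> x \<otimes> g) \<otimes> inv g" using g by (simp add: m_assoc) (simp flip: m_assoc)
    then show "x \<in> (g <# H) #> inv g" using x by (force simp: l_coset_def r_coset_def)
  qed
  then show ?thesis unfolding group_core_def using one_closed by blast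
qed

locale orbit_representatives = skew_left_brace S D
  for S D :: "'b monoid" +
  fixes a :: "'b set \<Rightarrow> 'b"
  assumes representative: "\<forall>i\<in>brace_orbits S D. a i \<in> i"
begin

sublocale SD: group "brace_semidirect S D"
  by (rule SD_group)

lemma SD_closed [simp]: "\<lbrakk>g \<in> C \<times> C; h \<in> C \<times> C\<rbrakk> \<Longrightarrow> g \<otimes>\<^bsub>SD\<^esub> h \<in> C \<times> C"
  using SD.m_closed by simp

lemma SD_inv_closed [simp]: "g \<in> C \<times> C \<Longrightarrow> inv\<^bsub>SD\<^esub> g \<in> C \<times> C"
  using SD.inv_closed by simp

lemma orbit_subset: "i \<in> brace_orbits S D \<Longrightarrow> i \<subseteq> C"
  using group_action.element_image[OF Theta_action]
  by (auto simp: brace_orbits_def orbits_def orbit_def)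

lemma representative_closed: "i \<in> brace_orbits S D \<Longrightarrow> a i \<in> C"
  using representative orbit_subset by blast

lemma orbit_eqI:
  assumes "c \<in> C" "d \<in> C" "d \<in> orbit SD Theta c"
  shows "orbit SD Theta d = orbit SD Theta c"
proof -
  interpret Th: group_action SD C Theta by (rule Theta_action)
  have "orbit SD Theta c \<in> orbits SD C Theta" "orbit SD Theta d \<in> orbits SD C Theta"
    using assms by (auto simp: orbits_def)
  then show ?thesis using Th.disjoint_union Th.orbit_refl[OF assms(2)] assms(3) by blast
qed

lemma orbit_eq:
  assumes i: "i \<in> brace_orbits S D"
  shows "i = orbit SD Theta (a i)"
proof -
  obtain c where c: "c \<in> C" "i = orbit SD Theta c" using i by (auto simp: brace_orbits_def orbits_def)
  then show ?thesis using orbit_eqI[of c "a i"] representative representative_closed i by auto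
qed

context
  fixes I J and K :: "'b set \<Rightarrow> 'j \<Rightarrow> ('b \<times> 'b) set"
  assumes data: "construction_data S D a I J K"
begin

abbreviation cosets where "cosets \<equiv> coset_space S D I J K"

lemma data_orbit: "i \<in> I \<Longrightarrow> i \<in> brace_orbits S D"
  using data by (auto simp: construction_data_def)

lemma data_a: "i \<in> I \<Longrightarrow> a i \<in> C"
  using data_orbit representative_closed by blast

lemma data_subgroup: "\<lbrakk>i \<in> I; j \<in> J i\<rbrakk> \<Longrightarrow> subgroup (K i j) SD"
  using data by (auto simp: construction_data_def)

lemma data_stabilizer: "\<lbrakk>i \<in> I; j \<in> J i; k \<in> K i j\<rbrakk> \<Longrightarrow> Theta k (a i) = a i"
  using data unfolding construction_data_def stabilizer_def by blast

lemma coset_cases: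
  assumes "x \<in> cosets"
  obtains i j h where "x = (i, j, h <#\<^bsub>SD\<^esub> K i j)" "i \<in> I" "j \<in> J i" "h \<in> C \<times> C"
  using assms by (auto simp: coset_space_def LCOSETS_def)

lemma coset_in: "\<lbrakk>i \<in> I; j \<in> J i; h \<in> C \<times> C\<rbrakk> \<Longrightarrow> (i, j, h <#\<^bsub>SD\<^esub> K i j) \<in> cosets"
  by (auto simp: coset_space_def LCOSETS_def)

lemma coset_point_coset:
  assumes i: "i \<in> I" "j \<in> J i" and h: "h \<in> C \<times> C"
  shows "coset_point S D a (i, j, h <#\<^bsub>SD\<^esub> K i j) = Theta h (a i)"
proof -
  interpret K: subgroup "K i j" SD by (rule data_subgroup[OF i])
  have "Theta (h \<otimes>\<^bsub>SD\<^esub> k) (a i) = Theta h (a i)" if k: "k \<in> K i j" for k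
    using Theta_comp[OF h _ data_a[OF i(1)], of k] K.mem_carrier[OF k] data_stabilizer[OF i k] by simp
  then have "(\<lambda>k. Theta (h \<otimes>\<^bsub>SD\<^esub> k) (a i)) ` K i j = {Theta h (a i)}"
    using K.one_closed by (simp add: image_constant_conv) blast
  then have "(\<lambda>g. Theta g (a i)) ` (h <#\<^bsub>SD\<^esub> K i j) = {Theta h (a i)}"
    by (simp add: l_coset_def image_UN) blast
  then show ?thesis by (simp add: coset_point_def)
qed

lemma coset_act_coset:
  assumes i: "i \<in> I" "j \<in> J i" and gh: "g \<in> C \<times> C" "h \<in> C \<times> C"
  shows "coset_act S D g (i, j, h <#\<^bsub>SD\<^esub> K i j) = (i, j, (g \<otimes>\<^bsub>SD\<^esub> h) <#\<^bsub>SD\<^esub> K i j)"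
  using SD.lcos_m_assoc[OF subgroup.subset[OF data_subgroup[OF i]], of g h] gh
  by (simp add: coset_act_def)

text \<open>The maps of \<open>coset_act\<close> are total functions; restriction to the coset space makes them elements of
  its permutation group.\<close>

lemma coset_action: "group_action SD cosets (\<lambda>g. restrict (coset_act S D g) cosets)"
proof (rule group_actionI[OF SD.is_group])
  show closed: "restrict (coset_act S D g) cosets x \<in> cosets" if "g \<in> carrier SD" "x \<in> cosets" for g x
    using that by (elim coset_cases) (auto simp: coset_act_coset coset_in simp del: SD_mult intro: coset_in SD_closed)
  show "restrict (coset_act S D \<one>\<^bsub>SD\<^esub>) cosets x = x" if "x \<in> cosets" for x
    using that SD.one_closed SD.l_one by (elim coset_cases) (simp add: coset_act_coset coset_in del: SD_one)
  show "restrict (coset_act S D (g \<otimes>\<^bsub>SD\<^esub> h)) cosets x =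
      restrict (coset_act S D g) cosets (restrict (coset_act S D h) cosets x)"
    if "g \<in> carrier SD" "h \<in> carrier SD" "x \<in> cosets" for g h x
    using that by (elim coset_cases) (simp add: coset_act_coset coset_in SD_closed SD.m_assoc)
qed simp

lemma coset_space_nonempty: "cosets \<noteq> {}"
proof -
  have "I \<noteq> {}" "\<forall>i\<in>I. J i \<noteq> {}" using data by (simp_all add: construction_data_def)
  then obtain i j where "i \<in> I" "j \<in> J i" by blast
  then have "(i, j, \<one>\<^bsub>SD\<^esub> <#\<^bsub>SD\<^esub> K i j) \<in> cosets" by (intro coset_in) simp_all
  then show ?thesis by blast
qed

lemma coset_brace_set:
  "brace_set S D cosets (\<lambda>g. restrict (coset_act S D g) cosets) (coset_point S D a) (coset_solution S D a)"
proof (intro brace_set.intro brace_set_axioms.intro coset_action coset_space_nonempty skew_left_brace_axioms)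
  show point: "coset_point S D a x \<in> C" if "x \<in> cosets" for x
    using that by (elim coset_cases) (simp add: coset_point_coset data_a)
  show equivariant: "coset_point S D a (restrict (coset_act S D g) cosets x) = Theta g (coset_point S D a x)"
    if "g \<in> carrier SD" "x \<in> cosets" for g x
    using that by (elim coset_cases)
      (simp add: coset_act_coset coset_point_coset coset_in SD_closed Theta_comp data_a)
  fix x y assume xy: "x \<in> cosets" "y \<in> cosets"
  define q where "q = (\<one>\<^bsub>S\<^esub>, coset_point S D a x)"
  have q: "q \<in> carrier SD" using point[OF xy(1)] by (simp add: q_def)
  define u where "u = Theta q (coset_point S D a y)"
  have u: "u \<in> C" using q point[OF xy(2)] by (simp add: u_def)
  have "coset_solution S D a (x, y) = (coset_act S D q y, coset_act S D (inv\<^bsub>D\<^esub> u, inv\<^bsub>D\<^esub> u) x)"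
    using u by (simp add: coset_solution_def Let_def SD_inv_diagonal flip: q_def u_def)
  then show "coset_solution S D a (x, y) =
      (let u = restrict (coset_act S D (\<one>\<^bsub>S\<^esub>, coset_point S D a x)) cosets y in
        (u, restrict (coset_act S D (inv\<^bsub>D\<^esub> (coset_point S D a u), inv\<^bsub>D\<^esub> (coset_point S D a u))) cosets x))"
    using equivariant[OF q xy(2)] xy by (simp add: Let_def flip: q_def u_def)
qed

lemma coset_points: "coset_point S D a ` cosets = \<Union>I"
proof
  show "coset_point S D a ` cosets \<subseteq> \<Union>I"
  proof (rule image_subsetI)
    fix x assume "x \<in> cosets"
    then obtain i j h where x: "x = (i, j, h <#\<^bsub>SD\<^esub> K i j)" "i \<in> I" "j \<in> J i" "h \<in> C \<times> C"
      by (rule coset_cases)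
    have "Theta h (a i) \<in> orbit SD Theta (a i)" using x by (auto simp: orbit_def)
    then show "coset_point S D a x \<in> \<Union>I"
      using orbit_eq[OF data_orbit[OF x(2)]] x by (auto simp: coset_point_coset)
  qed
  show "\<Union>I \<subseteq> coset_point S D a ` cosets"
  proof
    fix c assume "c \<in> \<Union>I"
    then obtain i where i: "i \<in> I" "c \<in> i" by blast
    then have "c \<in> orbit SD Theta (a i)" by (simp flip: orbit_eq[OF data_orbit[OF i(1)]])
    then obtain h where h: "h \<in> C \<times> C" "c = Theta h (a i)" by (auto simp: orbit_def)
    have "J i \<noteq> {}" using data i by (simp add: construction_data_def)
    then obtain j where j: "j \<in> J i" by blast
    then show "c \<in> coset_point S D a ` cosets"
      using i h by (intro image_eqI[OF _ coset_in[OF i(1) j h(1)]]) (simp add: coset_point_coset)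
  qed
qed

text \<open>Fixing the coset of \<open>g\<close> means lying in the conjugate of the subgroup by \<open>g\<close>.\<close>

lemma fixes_cosets_core:
  assumes x: "x \<in> C \<times> C" and fixes_all: "\<forall>y\<in>cosets. coset_act S D x y = y"
    and i: "i \<in> I" "j \<in> J i"
  shows "x \<in> group_core SD (K i j)"
proof (subst SD.group_core_iff[OF data_subgroup[OF i]], intro conjI ballI)
  fix g assume g: "g \<in> carrier SD"
  then have "(x \<otimes>\<^bsub>SD\<^esub> g) <#\<^bsub>SD\<^esub> K i j = g <#\<^bsub>SD\<^esub> K i j"
    using fixes_all coset_in[OF i, of g] coset_act_coset[OF i x, of g] by simp
  moreover have "x \<otimes>\<^bsub>SD\<^esub> g \<in> (x \<otimes>\<^bsub>SD\<^esub> g) <#\<^bsub>SD\<^esub> K i j"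
    by (rule SD.lcos_self[OF _ data_subgroup[OF i]]) (use x g SD.m_closed in simp)
  ultimately have "inv\<^bsub>SD\<^esub> g \<otimes>\<^bsub>SD\<^esub> (x \<otimes>\<^bsub>SD\<^esub> g) \<in> K i j"
    using subgroup.lcos_module_imp[OF data_subgroup[OF i] SD.is_group g] by simp
  then show "inv\<^bsub>SD\<^esub> g \<otimes>\<^bsub>SD\<^esub> x \<otimes>\<^bsub>SD\<^esub> g \<in> K i j" using x g by (simp add: SD.m_assoc)
qed (use x in simp)

theorem coset_solution_formula:
  assumes i: "i1 \<in> I" "j1 \<in> J i1" "i2 \<in> I" "j2 \<in> J i2" and g: "g \<in> carrier SD" "h \<in> carrier SD"
  shows "let u = Theta (\<one>\<^bsub>S\<^esub>, Theta g (a i1)) (Theta h (a i2)) in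
    coset_solution S D a ((i1, j1, g <#\<^bsub>SD\<^esub> K i1 j1), (i2, j2, h <#\<^bsub>SD\<^esub> K i2 j2)) =
      ((i2, j2, ((\<one>\<^bsub>S\<^esub>, Theta g (a i1)) \<otimes>\<^bsub>SD\<^esub> h) <#\<^bsub>SD\<^esub> K i2 j2),
       (i1, j1, (inv\<^bsub>SD\<^esub> (u, u) \<otimes>\<^bsub>SD\<^esub> g) <#\<^bsub>SD\<^esub> K i1 j1))"
proof -
  define q where "q = (\<one>\<^bsub>S\<^esub>, Theta g (a i1))"
  have q: "q \<in> C \<times> C" using g data_a[OF i(1)] by (simp add: q_def)
  define u where "u = Theta q (Theta h (a i2))"
  have u: "u \<in> C" using q g data_a[OF i(3)] by (simp add: u_def)
  have v: "inv\<^bsub>SD\<^esub> (u, u) \<in> C \<times> C" using SD.inv_closed[of "(u, u)"] u by simp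
  show ?thesis
    using i g q v by (simp add: coset_solution_def Let_def coset_point_coset coset_act_coset
        del: SD_mult flip: q_def u_def)
qed

theorem coset_solution_permutation_brace:
  "nondegenerate_solution cosets (coset_solution S D a)"
  "brace_isomorphic (permutation_star cosets (coset_solution S D a))
    (permutation_dot cosets (coset_solution S D a)) S D"
proof -
  interpret X: brace_set S D cosets "\<lambda>g. restrict (coset_act S D g) cosets" "coset_point S D a"
      "coset_solution S D a"
    by (rule coset_brace_set)
  show "nondegenerate_solution cosets (coset_solution S D a)" by (rule X.induced_nondegenerate)
  show "brace_isomorphic (permutation_star cosets (coset_solution S D a))
    (permutation_dot cosets (coset_solution S D a)) S D"
  proof (rule X.permutation_brace_isomorphic)
    show "generate S (coset_point S D a ` cosets) = carrier S"
      using data by (simp add: coset_points construction_data_def)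
    fix b assume b: "b \<in> C" "\<forall>x\<in>cosets. restrict (coset_act S D (\<one>\<^bsub>S\<^esub>, b)) cosets x = x"
      "\<forall>x\<in>cosets. restrict (coset_act S D (b, b)) cosets x = x"
    let ?N = "\<Inter>i\<in>I. \<Inter>j\<in>J i. group_core SD (K i j)"
    have "(\<one>\<^bsub>S\<^esub>, b) \<in> ?N" "(b, b) \<in> ?N"
      using b by (auto intro!: fixes_cosets_core)
    then have "b \<in> {b \<in> carrier S. (\<one>\<^bsub>S\<^esub>, b) \<in> ?N \<and> (b, b) \<in> ?N}" using b(1) by blast
    moreover have "{b \<in> carrier S. (\<one>\<^bsub>S\<^esub>, b) \<in> ?N \<and> (b, b) \<in> ?N} = {\<one>\<^bsub>S\<^esub>}"
      using data by (simp add: construction_data_def Let_def)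
    ultimately show "b = \<one>\<^bsub>S\<^esub>" by blast
  qed
qed

end

text \<open>By equivariance \<open>p\<close> maps each orbit on \<open>Z\<close> onto an orbit \<open>i\<close> in \<open>B\<close>, so it contains a point \<open>j\<close> with
  \<open>p j = a i\<close>. The chosen points serve as the index sets \<open>J\<close>, their stabilizers as the subgroups, and
  the orbit of \<open>j\<close> is the space of cosets of its stabilizer.\<close>

theorem induced_solution_is_coset_solution:
  fixes Z :: "'z set"
  assumes "brace_set S D Z act p t" and generating: "generate S (p ` Z) = carrier S"
    and faithful: "\<forall>b\<in>carrier S. (\<forall>x\<in>Z. act (\<one>\<^bsub>S\<^esub>, b) x = x) \<and> (\<forall>x\<in>Z. act (b, b) x = x) \<longrightarrow> b = \<one>\<^bsub>S\<^esub>"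
  shows "\<exists>(I :: 'b set set) (J :: 'b set \<Rightarrow> 'z set) K.
    construction_data S D a I J K \<and>
    solution_isomorphic Z t (coset_space S D I J K) (coset_solution S D a)"
proof -
  interpret Z: brace_set S D Z act p t by fact
  interpret act: group_action SD Z act by (rule Z.action)
  define \<iota> where "\<iota> z = orbit SD Theta (p z)" for z
  have \<iota>_orbit: "\<iota> z \<in> brace_orbits S D" if "z \<in> Z" for z
    using that by (auto simp: \<iota>_def brace_orbits_def orbits_def)
  have \<iota>_act: "\<iota> (act g z) = \<iota> z" if "g \<in> carrier SD" "z \<in> Z" for g z
    unfolding \<iota>_def by (rule orbit_eqI) (use that in \<open>auto simp: Z.p_act orbit_def\<close>)
  \<comment> \<open>The choice depends only on the orbit of \<open>z\<close>, so \<open>\<rho>\<close> picks one representative per orbit.\<close>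
  define \<rho> where "\<rho> z = (SOME w. w \<in> orbit SD act z \<and> p w = a (\<iota> w))" for z
  have \<rho>: "\<rho> z \<in> orbit SD act z" "p (\<rho> z) = a (\<iota> (\<rho> z))" if z: "z \<in> Z" for z
  proof -
    have "a (\<iota> z) \<in> \<iota> z" using representative \<iota>_orbit[OF z] by blast
    then obtain g where g: "g \<in> carrier SD" "a (\<iota> z) = Theta g (p z)" by (auto simp: \<iota>_def orbit_def)
    then have "act g z \<in> orbit SD act z" "p (act g z) = a (\<iota> (act g z))"
      using z by (auto simp: orbit_def \<iota>_act Z.p_act)
    then have "\<exists>w. w \<in> orbit SD act z \<and> p w = a (\<iota> w)" by blast
    from someI_ex[OF this] show "\<rho> z \<in> orbit SD act z" "p (\<rho> z) = a (\<iota> (\<rho> z))"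
      by (simp_all add: \<rho>_def)
  qed
  have orbit_Z: "w \<in> Z" if "z \<in> Z" "w \<in> orbit SD act z" for z w
    using that by (auto simp: orbit_def)
  have \<rho>_Z: "\<rho> z \<in> Z" if "z \<in> Z" for z
    using orbit_Z[OF that \<rho>(1)[OF that]] .
  have \<iota>\<rho>: "\<iota> (\<rho> z) = \<iota> z" if "z \<in> Z" for z
    using \<rho>(1)[OF that] that by (auto simp: orbit_def \<iota>_act)
  have orbit_same: "orbit SD act w = orbit SD act z" if "z \<in> Z" "w \<in> orbit SD act z" for z w
  proof -
    have "w \<in> Z" using orbit_Z[OF that] .
    moreover from this have "orbit SD act w \<in> orbits SD Z act" "orbit SD act z \<in> orbits SD Z act"
      using that by (auto simp: orbits_def)
    ultimately show ?thesis using act.disjoint_union act.orbit_refl[of w] that by blast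
  qed
  have \<rho>_same: "\<rho> w = \<rho> z" if "z \<in> Z" "w \<in> orbit SD act z" for z w
    using orbit_same[OF that] by (simp add: \<rho>_def)
  have \<rho>_act: "\<rho> (act g z) = \<rho> z" if "g \<in> carrier SD" "z \<in> Z" for g z
    by (rule \<rho>_same) (use that in \<open>auto simp: orbit_def\<close>)
  have from_\<rho>: "\<exists>g\<in>carrier SD. act g (\<rho> z) = z" if z: "z \<in> Z" for z
  proof -
    have "z \<in> orbit SD act (\<rho> z)" by (rule act.orbit_sym[OF z \<rho>_Z[OF z] \<rho>(1)[OF z]])
    then obtain g where "g \<in> carrier SD" "z = act g (\<rho> z)" unfolding orbit_def by blast
    from this(1) this(2)[symmetric] show ?thesis by blast
  qed
  define I where "I = \<iota> ` Z"
  define J where "J i = {\<rho> z | z. z \<in> Z \<and> \<iota> z = i}" for i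
  define K where "K i j = stabilizer SD act j" for i :: "'b set" and j
  have J: "j \<in> Z \<and> p j = a i \<and> \<iota> j = i \<and> \<rho> j = j" if "j \<in> J i" for i j
    using that \<rho> \<rho>_Z \<iota>\<rho> \<rho>_same by (auto simp: J_def)
  have K_sub: "subgroup (K i j) SD" if "j \<in> J i" for i j
    unfolding K_def using J[OF that] by (intro act.stabilizer_subgroup) blast
  have core_fixes: "act x z = z"
    if x: "x \<in> (\<Inter>i\<in>I. \<Inter>j\<in>J i. group_core SD (K i j))" and z: "z \<in> Z" for x z
  proof -
    obtain g where g: "g \<in> carrier SD" "act g (\<rho> z) = z" using from_\<rho>[OF z] by blast
    have j: "\<rho> z \<in> J (\<iota> z)" using z by (auto simp: J_def)
    have "x \<in> group_core SD (K (\<iota> z) (\<rho> z))" using x z j by (auto simp: I_def)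
    then have xc: "x \<in> carrier SD" and "inv\<^bsub>SD\<^esub> g \<otimes>\<^bsub>SD\<^esub> x \<otimes>\<^bsub>SD\<^esub> g \<in> K (\<iota> z) (\<rho> z)"
      using g(1) unfolding SD.group_core_iff[OF K_sub[OF j]] by blast+
    then have "act (inv\<^bsub>SD\<^esub> g \<otimes>\<^bsub>SD\<^esub> (x \<otimes>\<^bsub>SD\<^esub> g)) (\<rho> z) = \<rho> z"
      using g xc by (simp add: K_def stabilizer_def SD.m_assoc)
    then have "act (inv\<^bsub>SD\<^esub> g) (act x z) = \<rho> z"
      using g xc \<rho>_Z[OF z] by (simp add: Z.act_comp)
    then have "act g (act (inv\<^bsub>SD\<^esub> g) (act x z)) = z" using g by simp
    moreover have "act g (act (inv\<^bsub>SD\<^esub> g) (act x z)) = act x z"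
    proof -
      have "g \<otimes>\<^bsub>SD\<^esub> (inv\<^bsub>SD\<^esub> g \<otimes>\<^bsub>SD\<^esub> x) = x" using g xc by (simp flip: SD.m_assoc)
      then show ?thesis using g xc z by (simp flip: Z.act_comp)
    qed
    ultimately show ?thesis by simp
  qed
  have "\<Union>I = p ` Z"
  proof
    show "p ` Z \<subseteq> \<Union>I"
      using group_action.orbit_refl[OF Theta_action] by (auto simp: I_def \<iota>_def)
    show "\<Union>I \<subseteq> p ` Z"
    proof
      fix c assume "c \<in> \<Union>I"
      then obtain z g where z: "z \<in> Z" and g: "g \<in> carrier SD" "c = Theta g (p z)"
        by (auto simp: I_def \<iota>_def orbit_def)
      then have "c = p (act g z)" by (simp add: Z.p_act)
      then show "c \<in> p ` Z" using z g by simp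
    qed
  qed
  moreover have "\<one>\<^bsub>SD\<^esub> \<in> (\<Inter>i\<in>I. \<Inter>j\<in>J i. group_core SD (K i j))"
    using subgroup.one_closed[OF K_sub] by (auto simp: SD.group_core_iff[OF K_sub] simp del: SD_one SD_carrier)
  then have "{b \<in> carrier S. (\<one>\<^bsub>S\<^esub>, b) \<in> (\<Inter>i\<in>I. \<Inter>j\<in>J i. group_core SD (K i j)) \<and>
      (b, b) \<in> (\<Inter>i\<in>I. \<Inter>j\<in>J i. group_core SD (K i j))} = {\<one>\<^bsub>S\<^esub>}"
    using faithful core_fixes by (auto simp del: INT_iff)
  moreover have "K i j \<subseteq> stabilizer SD Theta (a i)" if "j \<in> J i" for i j
  proof
    fix g assume "g \<in> K i j"
    then have g: "g \<in> carrier SD" "act g j = j" by (simp_all add: K_def stabilizer_def)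
    have "Theta g (a i) = a i" using J[OF that] Z.p_act[OF g(1), of j] g(2) by simp
    then show "g \<in> stabilizer SD Theta (a i)" using g(1) by (simp add: stabilizer_def)
  qed
  moreover have "I \<noteq> {}" "I \<subseteq> brace_orbits S D" "\<forall>i\<in>I. J i \<noteq> {}"
    using Z.nonempty \<iota>_orbit by (auto simp: I_def J_def)
  ultimately have data: "construction_data S D a I J K"
    using generating K_sub by (simp add: construction_data_def Let_def)
  \<comment> \<open>A point is sent to the set of all group elements carrying the representative of its orbit to it.\<close>
  define \<Phi> where "\<Phi> z = (\<iota> z, \<rho> z, {g \<in> carrier SD. act g (\<rho> z) = z})" for z
  have transporter: "{g \<in> carrier SD. act g j = act h j} = h <#\<^bsub>SD\<^esub> K i j"
    if j: "j \<in> J i" and h: "h \<in> carrier SD" for i j h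
  proof
    have jZ: "j \<in> Z" using J[OF j] by blast
    show "h <#\<^bsub>SD\<^esub> K i j \<subseteq> {g \<in> carrier SD. act g j = act h j}"
      using h jZ by (auto simp: l_coset_def K_def stabilizer_def act.composition_rule simp del: SD_mult SD_carrier)
    show "{g \<in> carrier SD. act g j = act h j} \<subseteq> h <#\<^bsub>SD\<^esub> K i j"
    proof
      fix g assume "g \<in> {g \<in> carrier SD. act g j = act h j}"
      then have g: "g \<in> carrier SD" "act g j = act h j" by auto
      have "act (inv\<^bsub>SD\<^esub> h \<otimes>\<^bsub>SD\<^esub> g) j = j"
        using g h jZ act.orbit_sym_aux[OF h jZ HOL.refl] by (simp add: act.composition_rule del: SD_carrier)
      then have "inv\<^bsub>SD\<^esub> h \<otimes>\<^bsub>SD\<^esub> g \<in> K i j" using g h by (simp add: K_def stabilizer_def del: SD_carrier)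
      moreover have "g = h \<otimes>\<^bsub>SD\<^esub> (inv\<^bsub>SD\<^esub> h \<otimes>\<^bsub>SD\<^esub> g)" using g h by (simp del: SD_carrier SD_one flip: SD.m_assoc)
      ultimately show "g \<in> h <#\<^bsub>SD\<^esub> K i j" unfolding l_coset_def by blast
    qed
  qed
  have \<Phi>_act: "\<Phi> (act h j) = (i, j, h <#\<^bsub>SD\<^esub> K i j)"
    if j: "j \<in> J i" and h: "h \<in> carrier SD" for i j h
    using J[OF j] h transporter[OF j h] by (simp add: \<Phi>_def \<iota>_act \<rho>_act del: SD_carrier)
  have \<rho>J: "\<rho> z \<in> J (\<iota> z)" if "z \<in> Z" for z using that by (auto simp: J_def)
  have \<iota>I: "\<iota> z \<in> I" if "z \<in> Z" for z using that by (auto simp: I_def)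
  have "bij_betw \<Phi> Z (coset_space S D I J K)"
  proof (rule bij_betw_imageI)
    show "inj_on \<Phi> Z"
    proof (rule inj_onI)
      fix z w assume zw: "z \<in> Z" "w \<in> Z" and e: "\<Phi> z = \<Phi> w"
      obtain g where g: "g \<in> carrier SD" "act g (\<rho> z) = z" using from_\<rho>[OF zw(1)] by blast
      have \<rho>zw: "\<rho> z = \<rho> w"
        and "{g \<in> carrier SD. act g (\<rho> z) = z} = {g \<in> carrier SD. act g (\<rho> w) = w}"
        using e unfolding \<Phi>_def by blast+
      then have "act g (\<rho> w) = w" using g by blast
      then show "z = w" using g(2) \<rho>zw by simp
    qed
    show "\<Phi> ` Z = coset_space S D I J K"
    proof
      show "\<Phi> ` Z \<subseteq> coset_space S D I J K"
      proof (rule image_subsetI)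
        fix z assume z: "z \<in> Z"
        obtain g where g: "g \<in> carrier SD" "act g (\<rho> z) = z" using from_\<rho>[OF z] by blast
        then have "\<Phi> z = (\<iota> z, \<rho> z, g <#\<^bsub>SD\<^esub> K (\<iota> z) (\<rho> z))" using \<Phi>_act[OF \<rho>J[OF z] g(1)] by simp
        then show "\<Phi> z \<in> coset_space S D I J K"
          using coset_in[OF data \<iota>I[OF z] \<rho>J[OF z]] g by simp
      qed
      show "coset_space S D I J K \<subseteq> \<Phi> ` Z"
      proof
        fix x assume "x \<in> coset_space S D I J K"
        then obtain i j h where x: "x = (i, j, h <#\<^bsub>SD\<^esub> K i j)" "i \<in> I" "j \<in> J i" "h \<in> C \<times> C"
          by (rule coset_cases[OF data])
        have "act h j \<in> Z" using J[OF x(3)] x(4) by simp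
        then show "x \<in> \<Phi> ` Z" using \<Phi>_act[OF x(3), of h] x by (metis SD_carrier image_eqI)
      qed
    qed
  qed
  moreover have "coset_solution S D a (\<Phi> x, \<Phi> y) = map_prod \<Phi> \<Phi> (t (x, y))"
    if xy: "x \<in> Z" "y \<in> Z" for x y
  proof -
    have equivariant: "coset_act S D g (\<Phi> z) = \<Phi> (act g z)" if g: "g \<in> carrier SD" and z: "z \<in> Z" for g z
    proof -
      obtain h where h: "h \<in> carrier SD" "act h (\<rho> z) = z" using from_\<rho>[OF z] by blast
      have "coset_act S D g (\<Phi> z) = (\<iota> z, \<rho> z, (g \<otimes>\<^bsub>SD\<^esub> h) <#\<^bsub>SD\<^esub> K (\<iota> z) (\<rho> z))"
        using \<Phi>_act[OF \<rho>J[OF z] h(1)] h g coset_act_coset[OF data \<iota>I[OF z] \<rho>J[OF z], of g h] by simp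
      also have "\<dots> = \<Phi> (act (g \<otimes>\<^bsub>SD\<^esub> h) (\<rho> z))"
        using \<Phi>_act[OF \<rho>J[OF z] SD.m_closed[OF g h(1)]] by simp
      finally show ?thesis using act.composition_rule[OF \<rho>_Z[OF z] g h(1)] h by simp
    qed
    have point: "coset_point S D a (\<Phi> z) = p z" if z: "z \<in> Z" for z
    proof -
      obtain h where h: "h \<in> carrier SD" "act h (\<rho> z) = z" using from_\<rho>[OF z] by blast
      have "coset_point S D a (\<Phi> z) = Theta h (a (\<iota> z))"
        using \<Phi>_act[OF \<rho>J[OF z] h(1)] h coset_point_coset[OF data \<iota>I[OF z] \<rho>J[OF z], of h] by simp
      also have "\<dots> = p (act h (\<rho> z))"
        using Z.p_act[OF h(1) \<rho>_Z[OF z]] \<rho>(2)[OF z] \<iota>\<rho>[OF z] by simp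
      finally show ?thesis using h by simp
    qed
    define u where "u = act (\<one>\<^bsub>S\<^esub>, p x) y"
    have u: "u \<in> Z" using xy by (simp add: u_def)
    have "Theta (\<one>\<^bsub>S\<^esub>, p x) (p y) = p u" using xy by (simp add: u_def Z.p_act)
    then have "coset_solution S D a (\<Phi> x, \<Phi> y) =
        (\<Phi> u, \<Phi> (act (inv\<^bsub>D\<^esub> (p u), inv\<^bsub>D\<^esub> (p u)) x))"
      using xy u by (simp add: coset_solution_def Let_def point equivariant SD_inv_diagonal u_def)
    then show ?thesis using Z.r_eq[OF xy] by (simp add: Let_def u_def)
  qed
  ultimately have "solution_isomorphic Z t (coset_space S D I J K) (coset_solution S D a)"
    unfolding solution_isomorphic_def by blast
  with data show ?thesis by (intro exI[of _ I] exI[of _ J] exI[of _ K] conjI)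
qed

end

theorem theorem3p19:
  fixes S D :: "'b monoid" and a :: "'b set \<Rightarrow> 'b"
  defines "G \<equiv> brace_semidirect S D" and "\<Theta> \<equiv> brace_Theta S D"
  assumes "skew_left_brace S D"
    and "\<forall>i \<in> brace_orbits S D. a i \<in> i"
  shows
    "(\<forall>(I :: 'b set set) (J :: 'b set \<Rightarrow> 'j set) K.
        construction_data S D a I J K \<longrightarrow>
          (\<forall>i1\<in>I. \<forall>j1\<in>J i1. \<forall>i2\<in>I. \<forall>j2\<in>J i2.
           \<forall>(b1, c1) \<in> carrier G. \<forall>(b2, c2) \<in> carrier G.
             (let u = \<Theta> (\<one>\<^bsub>S\<^esub>, \<Theta> (b1, c1) (a i1)) (\<Theta> (b2, c2) (a i2)) in
              coset_solution S D a
                ((i1, j1, (b1, c1) <#\<^bsub>G\<^esub> K i1 j1), (i2, j2, (b2, c2) <#\<^bsub>G\<^esub> K i2 j2)) =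
                ((i2, j2, ((\<one>\<^bsub>S\<^esub>, \<Theta> (b1, c1) (a i1)) \<otimes>\<^bsub>G\<^esub> (b2, c2)) <#\<^bsub>G\<^esub> K i2 j2),
                 (i1, j1, (inv\<^bsub>G\<^esub> (u, u) \<otimes>\<^bsub>G\<^esub> (b1, c1)) <#\<^bsub>G\<^esub> K i1 j1)))) \<and>
          nondegenerate_solution (coset_space S D I J K) (coset_solution S D a) \<and>
          brace_isomorphic
            (permutation_star (coset_space S D I J K) (coset_solution S D a))
            (permutation_dot (coset_space S D I J K) (coset_solution S D a)) S D) \<and>
     (\<forall>(Z :: 'z set) t.
        nondegenerate_solution Z t \<and>
        brace_isomorphic (permutation_star Z t) (permutation_dot Z t) S D \<longrightarrow>
          (\<exists>(I :: 'b set set) (J :: 'b set \<Rightarrow> 'z set) K.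
             construction_data S D a I J K \<and>
             solution_isomorphic Z t (coset_space S D I J K) (coset_solution S D a)))"
proof -
  interpret orbit_representatives S D a
    using assms(3,4) by (intro orbit_representatives.intro orbit_representatives_axioms.intro)
  show ?thesis
    unfolding G_def \<Theta>_def
  proof (rule conjI; intro allI impI)
    fix I :: "'b set set" and J :: "'b set \<Rightarrow> 'j set" and K
    assume data: "construction_data S D a I J K"
    show "(\<forall>i1\<in>I. \<forall>j1\<in>J i1. \<forall>i2\<in>I. \<forall>j2\<in>J i2.
           \<forall>(b1, c1) \<in> carrier SD. \<forall>(b2, c2) \<in> carrier SD.
             (let u = Theta (\<one>\<^bsub>S\<^esub>, Theta (b1, c1) (a i1)) (Theta (b2, c2) (a i2)) in
              coset_solution S D a
                ((i1, j1, (b1, c1) <#\<^bsub>SD\<^esub> K i1 j1), (i2, j2, (b2, c2) <#\<^bsub>SD\<^esub> K i2 j2)) =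
                ((i2, j2, ((\<one>\<^bsub>S\<^esub>, Theta (b1, c1) (a i1)) \<otimes>\<^bsub>SD\<^esub> (b2, c2)) <#\<^bsub>SD\<^esub> K i2 j2),
                 (i1, j1, (inv\<^bsub>SD\<^esub> (u, u) \<otimes>\<^bsub>SD\<^esub> (b1, c1)) <#\<^bsub>SD\<^esub> K i1 j1)))) \<and>
          nondegenerate_solution (coset_space S D I J K) (coset_solution S D a) \<and>
          brace_isomorphic
            (permutation_star (coset_space S D I J K) (coset_solution S D a))
            (permutation_dot (coset_space S D I J K) (coset_solution S D a)) S D"
      using coset_solution_formula[OF data] coset_solution_permutation_brace[OF data] by blast
  next
    fix Z :: "'z set" and t
    assume "nondegenerate_solution Z t \<and>
      brace_isomorphic (permutation_star Z t) (permutation_dot Z t) S D"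
    then show "\<exists>(I :: 'b set set) (J :: 'b set \<Rightarrow> 'z set) K.
        construction_data S D a I J K \<and>
        solution_isomorphic Z t (coset_space S D I J K) (coset_solution S D a)"
      using nondegenerate_yang_baxter.permutation_brace_set[OF nondegenerate_yang_baxter.intro assms(3)]
        induced_solution_is_coset_solution by blast
  qed
qed

end
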